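(* Let $\mathcal{M}$ be a von Neumann algebra and $a$ a positive selfadjoint operator affiliated with $\mathcal{M}$. For every $\varphi\in\mathfrak{D}_a^h$, $$\inf\{\varphi_1(a)+\varphi_2(a):\varphi=\varphi_1-\varphi_2,\ \varphi_1,\varphi_2\in\mathfrak{D}_a^+\}=\|a^{1/2}\varphi a^{1/2}\|,$$ where the right-hand side is the norm in $\mathcal{M}_*$.
   Context: For $\lambda>0$, $a_\lambda:=\lambda\,\overline{a(\lambda+a)^{-1}}\in\mathcal{M}^+$. For $\psi\in\mathcal{M}_*^+$, $\psi(a):=\lim_{\lambda\to+\infty}\psi(a_\lambda)$; $\mathfrak{D}_a^+=\{\psi\in\mathcal{M}_*^+:\psi(a)<+\infty\}$, $\mathfrak{D}_a^h=\mathfrak{D}_a^+-\mathfrak{D}_a^+$. For $\varphi\in\mathfrak{D}_a^h$, $a^{1/2}\varphi a^{1/2}\in\mathcal{M}_*$ is the normal functional $x\mapsto\lim_{\lambda\to+\infty}\varphi(a_\lambda^{1/2}xa_\lambda^{1/2})$. *)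

theory Defs
  imports "HOL-Analysis.Analysis"
begin

text \<open>Complex Hilbert spaces are modelled as real Hilbert spaces (type class
  real_inner + complete_space) equipped with an orthogonal complex structure J
  (multiplication by the imaginary unit).\<close>

definition cstruct :: "('h::real_inner \<Rightarrow> 'h) \<Rightarrow> bool" where
  "cstruct J \<longleftrightarrow> bounded_linear J \<and> (\<forall>x. J (J x) = - x) \<and> (\<forall>x y. inner (J x) (J y) = inner x y)"

text \<open>Complex inner product, linear in the first argument.\<close>
definition cinner :: "('h::real_inner \<Rightarrow> 'h) \<Rightarrow> 'h \<Rightarrow> 'h \<Rightarrow> complex" where
  "cinner J x y = Complex (inner x y) (inner x (J y))"

definition bop :: "('h::real_inner \<Rightarrow> 'h) \<Rightarrow> ('h \<Rightarrow> 'h) \<Rightarrow> bool" where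
  "bop J T \<longleftrightarrow> bounded_linear T \<and> (\<forall>x. T (J x) = J (T x))"

definition commutant :: "('h::real_inner \<Rightarrow> 'h) \<Rightarrow> ('h \<Rightarrow> 'h) set \<Rightarrow> ('h \<Rightarrow> 'h) set" where
  "commutant J S = {T. bop J T \<and> (\<forall>A\<in>S. T \<circ> A = A \<circ> T)}"

definition vNa :: "('h::{real_inner,complete_space} \<Rightarrow> 'h) \<Rightarrow> ('h \<Rightarrow> 'h) set \<Rightarrow> bool" where
  "vNa J M \<longleftrightarrow> cstruct J \<and> M \<subseteq> Collect (bop J) \<and> (\<forall>A\<in>M. adjoint A \<in> M)
      \<and> M = commutant J (commutant J M)"

definition unitary_op :: "('h::real_inner \<Rightarrow> 'h) \<Rightarrow> ('h \<Rightarrow> 'h) \<Rightarrow> bool" where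
  "unitary_op J U \<longleftrightarrow> bop J U \<and> adjoint U \<circ> U = id \<and> U \<circ> adjoint U = id"

definition pos_op :: "('h::real_inner \<Rightarrow> 'h) \<Rightarrow> ('h \<Rightarrow> 'h) \<Rightarrow> bool" where
  "pos_op J T \<longleftrightarrow> bop J T \<and> adjoint T = T \<and> (\<forall>x. inner (T x) x \<ge> 0)"

text \<open>Unbounded operators are pairs (domain, action). Positive selfadjoint operator:\<close>
definition pos_selfadj :: "('h::real_inner \<Rightarrow> 'h) \<Rightarrow> 'h set \<Rightarrow> ('h \<Rightarrow> 'h) \<Rightarrow> bool" where
  "pos_selfadj J D f \<longleftrightarrow>
     subspace D \<and> J ` D \<subseteq> D \<and> closure D = UNIV \<and>
     (\<forall>x\<in>D. \<forall>y\<in>D. \<forall>c::real. f (x + y) = f x + f y \<and> f (c *\<^sub>R x) = c *\<^sub>R f x) \<and>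
     (\<forall>x\<in>D. f (J x) = J (f x)) \<and>
     {y. \<exists>z. \<forall>x\<in>D. inner (f x) y = inner x z} = D \<and>
     (\<forall>x\<in>D. \<forall>y\<in>D. inner (f x) y = inner x (f y)) \<and>
     (\<forall>x\<in>D. inner (f x) x \<ge> 0)"

definition affiliated :: "('h::real_inner \<Rightarrow> 'h) \<Rightarrow> ('h \<Rightarrow> 'h) set \<Rightarrow> 'h set \<Rightarrow> ('h \<Rightarrow> 'h) \<Rightarrow> bool" where
  "affiliated J M D f \<longleftrightarrow>
     (\<forall>U\<in>commutant J M. unitary_op J U \<longrightarrow> U ` D = D \<and> (\<forall>x\<in>D. U (f x) = f (U x)))"

text \<open>a_lambda = lambda a (lambda + a)^{-1}; for positive selfadjoint a this operator is
  everywhere defined and bounded, hence equal to its closure.\<close>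
definition resolv :: "'h set \<Rightarrow> ('h::real_vector \<Rightarrow> 'h) \<Rightarrow> real \<Rightarrow> 'h \<Rightarrow> 'h" where
  "resolv D f l y = (THE x. x \<in> D \<and> l *\<^sub>R x + f x = y)"

definition a_lam :: "'h set \<Rightarrow> ('h::real_vector \<Rightarrow> 'h) \<Rightarrow> real \<Rightarrow> 'h \<Rightarrow> 'h" where
  "a_lam D f l = (\<lambda>y. l *\<^sub>R f (resolv D f l y))"

definition op_sqrt :: "('h::real_inner \<Rightarrow> 'h) \<Rightarrow> ('h \<Rightarrow> 'h) \<Rightarrow> 'h \<Rightarrow> 'h" where
  "op_sqrt J T = (THE S. pos_op J S \<and> S \<circ> S = T)"

text \<open>Normal (sigma-weakly continuous) functionals on M: those of the form
  x \<mapsto> \<Sum> n. <x xi_n, eta_n> with square-summable vector sequences.\<close>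
definition normal_fun :: "('h::real_inner \<Rightarrow> 'h) \<Rightarrow> ('h \<Rightarrow> 'h) set \<Rightarrow> (('h \<Rightarrow> 'h) \<Rightarrow> complex) \<Rightarrow> bool" where
  "normal_fun J M \<phi> \<longleftrightarrow> (\<exists>\<xi> \<eta> :: nat \<Rightarrow> 'h.
      summable (\<lambda>n. (norm (\<xi> n))\<^sup>2) \<and> summable (\<lambda>n. (norm (\<eta> n))\<^sup>2) \<and>
      (\<forall>x\<in>M. \<phi> x = (\<Sum>n. cinner J (x (\<xi> n)) (\<eta> n))))"

definition normal_pos :: "('h::real_inner \<Rightarrow> 'h) \<Rightarrow> ('h \<Rightarrow> 'h) set \<Rightarrow> (('h \<Rightarrow> 'h) \<Rightarrow> complex) \<Rightarrow> bool" where
  "normal_pos J M \<psi> \<longleftrightarrow> normal_fun J M \<psi> \<and>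
      (\<forall>x\<in>M. pos_op J x \<longrightarrow> Im (\<psi> x) = 0 \<and> Re (\<psi> x) \<ge> 0)"

definition fval :: "'h set \<Rightarrow> ('h::real_inner \<Rightarrow> 'h) \<Rightarrow> (('h \<Rightarrow> 'h) \<Rightarrow> complex) \<Rightarrow> ereal" where
  "fval D f \<psi> = Lim at_top (\<lambda>l. ereal (Re (\<psi> (a_lam D f l))))"

definition Dpos :: "('h::real_inner \<Rightarrow> 'h) \<Rightarrow> ('h \<Rightarrow> 'h) set \<Rightarrow> 'h set \<Rightarrow> ('h \<Rightarrow> 'h)
      \<Rightarrow> (('h \<Rightarrow> 'h) \<Rightarrow> complex) set" where
  "Dpos J M D f = {\<psi>. normal_pos J M \<psi> \<and> fval D f \<psi> < \<infinity>}"

definition Dherm :: "('h::real_inner \<Rightarrow> 'h) \<Rightarrow> ('h \<Rightarrow> 'h) set \<Rightarrow> 'h set \<Rightarrow> ('h \<Rightarrow> 'h)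
      \<Rightarrow> (('h \<Rightarrow> 'h) \<Rightarrow> complex) set" where
  "Dherm J M D f = {\<phi>. \<exists>\<psi>1 \<psi>2. \<psi>1 \<in> Dpos J M D f \<and> \<psi>2 \<in> Dpos J M D f \<and>
       (\<forall>x\<in>M. \<phi> x = \<psi>1 x - \<psi>2 x)}"

definition sandwich :: "('h::real_inner \<Rightarrow> 'h) \<Rightarrow> 'h set \<Rightarrow> ('h \<Rightarrow> 'h) \<Rightarrow> (('h \<Rightarrow> 'h) \<Rightarrow> complex)
      \<Rightarrow> ('h \<Rightarrow> 'h) \<Rightarrow> complex" where
  "sandwich J D f \<phi> x = Lim at_top (\<lambda>l. \<phi> (op_sqrt J (a_lam D f l) \<circ> x \<circ> op_sqrt J (a_lam D f l)))"

definition pred_norm :: "('h::real_normed_vector \<Rightarrow> 'h) set \<Rightarrow> (('h \<Rightarrow> 'h) \<Rightarrow> complex) \<Rightarrow> real" where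
  "pred_norm M \<omega> = Sup {cmod (\<omega> x) | x. x \<in> M \<and> onorm x \<le> 1}"

end

theory Submission
  imports Defs "HOL-Library.Function_Algebras"
begin

text \<open>
  The inequality \<open>\<ge>\<close> is the Cauchy-Schwarz inequality for a positive functional.
  For \<open>\<le>\<close>, let p be the infimum over all decompositions; it is a seminorm on the hermitian functionals with
  finite a-value. By Hahn-Banach there is a linear F with F(\<phi>) = p(\<phi>) and |F| \<le> p, that is, |F(\<psi>)| \<le> \<psi>(a) for
  positive \<psi>. On vector functionals F is a quadratic form dominated by that of a, so
  F(\<psi>) = (a^(1/2) \<psi> a^(1/2))(x) should hold for a selfadjoint contraction x, which commutes with the unitaries of
  the commutant of M because vector functionals on M are invariant under them. To avoid the unbounded a^(1/2),
  the form is pulled back along the bounded operator R_e s_m, where R_e = (e + a)^(-1) and s_m is the square root of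
  a_m; this gives x in M depending on e and m. It satisfies \<psi>(s_n x s_n) = F(k \<psi> k) with k = R_e s_m s_n, and
  F(\<psi>) - F(k \<psi> k) tends to 0 as m tends to infinity and e to 0, uniformly in n \<ge> m. Hence p(\<phi>) = F(\<phi>) is at
  most the norm of a^(1/2) \<phi> a^(1/2).
  All estimates only use resolvents and square roots of bounded operators, so no spectral theorem is needed.
\<close>

section \<open>Positive operators on a real Hilbert space\<close>

text \<open>Nothing makes \<open>F\<close> normal: it is controlled only by the value \<psi>(a).
  Approximating \<psi> in norm therefore says nothing about F(\<psi>), and the cutoffs have to
  converge with respect to the value itself. With c = 1 - k this works because c \<psi> c has value
  at most 2 (\<psi>(a) - \<psi>(a_m)) + e \<psi>(1), by an operator inequality between functions of
  a, while the mixed terms c \<psi> and \<psi> c are absorbed by a free parameter t as in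
  Cauchy-Schwarz. The factors of k have separate tasks. R_e s_m is the map along which the form is
  pulled back; the resolvent is there because a a_m (e + a)^(-2) \<le> 1, which bounds the
  pulled-back form by 1 uniformly in e and m. The last factor is s_n and not s_m, so that x stays
  fixed while n tends to infinity and \<psi>(s_n x s_n) runs to the limit defining a^(1/2) \<psi>
  a^(1/2); with n = m the operator x would move along with the limit.\<close>

lemma closed_subspace_projection:
  fixes S :: "'h::{real_inner,complete_space} set"
  assumes S: "subspace S" "closed S"
  obtains y where "y \<in> S" "\<And>z. z \<in> S \<Longrightarrow> inner (x - y) z = 0"
proof -
  define d where "d = Inf ((\<lambda>y. (norm (x - y))\<^sup>2) ` S)"
  have ne: "S \<noteq> {}" using S(1) subspace_0 by blast
  have bdd: "bdd_below ((\<lambda>y. (norm (x - y))\<^sup>2) ` S)" by (intro bdd_belowI[of _ 0]) auto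
  have d_le: "d \<le> (norm (x - y))\<^sup>2" if "y \<in> S" for y
    unfolding d_def using bdd that by (intro cINF_lower)
  have "\<exists>y\<in>S. (norm (x - y))\<^sup>2 < d + 1 / real (Suc n)" for n
  proof -
    have "d < d + 1 / real (Suc n)" by simp
    then show ?thesis using cInf_lessD[of "(\<lambda>y. (norm (x - y))\<^sup>2) ` S" "d + 1 / real (Suc n)"] ne
      unfolding d_def by blast
  qed
  then obtain u where u: "\<And>n. u n \<in> S" "\<And>n. (norm (x - u n))\<^sup>2 < d + 1 / real (Suc n)"
    by metis
  \<comment> \<open>Parallelogram law: the midpoint of \<open>u m\<close> and \<open>u n\<close>
    lies in S, so its squared distance from x is at least d.\<close>
  have par: "(norm (u m - u n))\<^sup>2 \<le> 2 / real (Suc m) + 2 / real (Suc n)" for m n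
  proof -
    have "(1/2) *\<^sub>R (u m + u n) \<in> S" using u(1) S(1) by (simp add: subspace_add subspace_scale)
    from d_le[OF this] have "d \<le> (norm (x - (1/2) *\<^sub>R (u m + u n)))\<^sup>2" .
    moreover have "(norm (u m - u n))\<^sup>2 =
      2 * (norm (x - u m))\<^sup>2 + 2 * (norm (x - u n))\<^sup>2 - 4 * (norm (x - (1/2) *\<^sub>R (u m + u n)))\<^sup>2"
      by (simp add: power2_norm_eq_inner inner_simps algebra_simps inner_commute)
    moreover have "2 / real (Suc m) = 2 * (1 / real (Suc m))" "2 / real (Suc n) = 2 * (1 / real (Suc n))"
      by simp_all
    ultimately show ?thesis using u(2)[of m] u(2)[of n] by linarith
  qed
  have "Cauchy u"
  proof (rule metric_CauchyI)
    fix e :: real assume e: "0 < e"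
    obtain N where N: "4 / e\<^sup>2 < real (Suc N)" by (meson less_trans of_nat_less_iff reals_Archimedean2 lessI)
    have "dist (u m) (u n) < e" if "m \<ge> N" "n \<ge> N" for m n
    proof -
      have 1: "2 / real (Suc m) \<le> 2 / real (Suc N)" using that by (simp add: frac_le)
      have 2: "2 / real (Suc n) \<le> 2 / real (Suc N)" using that by (simp add: frac_le)
      have "(norm (u m - u n))\<^sup>2 \<le> 4 / real (Suc N)"
        using par[of m n] 1 2 by linarith
      also have "\<dots> < e\<^sup>2" using N e by (simp add: field_simps)
      finally show ?thesis using e by (simp add: dist_norm power_less_imp_less_base)
    qed
    then show "\<exists>N. \<forall>m\<ge>N. \<forall>n\<ge>N. dist (u m) (u n) < e" by blast
  qed
  then obtain y where y: "u \<longlonglongrightarrow> y" using Cauchy_convergent convergent_def by blast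
  have yS: "y \<in> S" using closed_sequentially[OF S(2)] u(1) y by blast
  have "(\<lambda>n. d + 1 / real (Suc n)) \<longlonglongrightarrow> d + 0"
    by (intro tendsto_add tendsto_const LIMSEQ_inverse_real_of_nat[unfolded inverse_eq_divide])
  moreover have "(\<lambda>n. (norm (x - u n))\<^sup>2) \<longlonglongrightarrow> (norm (x - y))\<^sup>2"
    by (intro tendsto_intros y)
  ultimately have yd: "(norm (x - y))\<^sup>2 \<le> d + 0"
    using u(2) by (intro LIMSEQ_le) (auto intro: less_imp_le)
  have "inner (x - y) z = 0" if z: "z \<in> S" for z
  proof (cases "z = 0")
    case False
    \<comment> \<open>The t that minimises the distance from x to y + t z; since y is already
      nearest, nothing can be gained, and the inner product vanishes.\<close>
    define t where "t = inner (x - y) z / inner z z"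
    have "y + t *\<^sub>R z \<in> S" using yS z S(1) by (simp add: subspace_add subspace_scale)
    from d_le[OF this] yd have "(norm (x - y))\<^sup>2 \<le> (norm (x - y - t *\<^sub>R z))\<^sup>2"
      by (simp only: diff_diff_eq)
    also have "\<dots> = (norm (x - y))\<^sup>2 - 2 * t * inner (x - y) z + t\<^sup>2 * inner z z"
      using dot_norm_neg[of "x - y" "t *\<^sub>R z"] by (simp add: power_mult_distrib power2_norm_eq_inner[of z])
    finally have "2 * t * inner (x - y) z \<le> t\<^sup>2 * inner z z" by simp
    moreover have "t\<^sup>2 * inner z z = t * inner (x - y) z"
      unfolding t_def using False by (simp add: power2_eq_square field_simps)
    moreover have "t * inner (x - y) z = (inner (x - y) z)\<^sup>2 / inner z z"
      unfolding t_def by (simp add: power2_eq_square)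
    ultimately have "(inner (x - y) z)\<^sup>2 / inner z z \<le> 0" by linarith
    then have "(inner (x - y) z)\<^sup>2 \<le> 0" using False
      by (metis divide_le_0_iff inner_gt_zero_iff not_less zero_le_power2 order_antisym)
    then show ?thesis by simp
  qed simp
  then show ?thesis using that yS by blast
qed

lemma riesz_representation:
  fixes f :: "'h::{real_inner,complete_space} \<Rightarrow> real"
  assumes f: "bounded_linear f"
  obtains y where "\<And>x. f x = inner y x"
proof (cases "\<forall>x. f x = 0")
  case True
  then show ?thesis using that[of 0] by simp
next
  case False
  then obtain x0 where x0: "f x0 \<noteq> 0" by blast
  interpret f: bounded_linear f by fact
  have sub: "subspace {x. f x = 0}" by (auto simp: subspace_def f.add f.scale f.zero)
  have cl: "closed {x. f x = 0}"
    by (intro closed_Collect_eq linear_continuous_on[OF f] continuous_on_const)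
  obtain y where y: "f y = 0" "\<And>z. f z = 0 \<Longrightarrow> inner (x0 - y) z = 0"
    using closed_subspace_projection[OF sub cl, of x0] by auto
  define w where "w = x0 - y"
  have fw: "f w \<noteq> 0" using x0 y(1) by (simp add: w_def f.diff)
  then have w0: "inner w w \<noteq> 0" using f.zero by auto
  have "f x = inner ((f w / inner w w) *\<^sub>R w) x" for x
  proof -
    have "f (x - (f x / f w) *\<^sub>R w) = 0" using fw by (simp add: f.diff f.scaleR)
    from y(2)[OF this] have "inner w x = (f x / f w) * inner w w"
      by (simp add: w_def[symmetric] inner_simps)
    then show ?thesis using fw w0 by simp
  qed
  then show ?thesis using that by blast
qed

text \<open>Riesz in the second variable. It supplies adjoints below and, much later, the operator x
  of the pulled-back form.\<close>

lemma bounded_bilinear_operator: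
  fixes b :: "'h::{real_inner,complete_space} \<Rightarrow> 'h \<Rightarrow> real"
  assumes b: "bounded_bilinear b"
  obtains T where "bounded_linear T" "\<And>x y. inner (T x) y = b x y"
proof -
  interpret b: bounded_bilinear b by fact
  have "\<exists>z. \<forall>y. b x y = inner z y" for x
    using riesz_representation[OF b.bounded_linear_right] by metis
  then obtain T where T: "\<And>x y. b x y = inner (T x) y" by metis
  have ext: "u = v" if "\<And>y. inner u y = inner v y" for u v :: 'h
    using that vector_eq_rdot by blast
  obtain K where K: "\<And>x y. norm (b x y) \<le> norm x * norm y * K" "K \<ge> 0" using b.nonneg_bounded by blast
  have "bounded_linear T"
  proof (rule bounded_linear_intro)
    show "T (x + y) = T x + T y" for x y
      by (rule ext) (simp add: T[symmetric] inner_add_left b.add_left)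
    show "T (r *\<^sub>R x) = r *\<^sub>R T x" for r x
      by (rule ext) (simp add: T[symmetric] b.scaleR_left)
    show "norm (T x) \<le> norm x * K" for x
    proof (cases "T x = 0")
      case False
      have "(norm (T x))\<^sup>2 \<le> norm x * norm (T x) * K"
        using K(1)[of x "T x"] by (simp add: T power2_norm_eq_inner)
      then show ?thesis using False by (simp add: power2_eq_square mult.assoc mult.left_commute[of "norm x"])
    qed (simp add: K)
  qed
  then show ?thesis using that T by metis
qed

text \<open>\<open>adjoint\<close> is defined by choice, so its defining property becomes available
  only once some adjoint is known to exist, which Riesz provides.\<close>

lemma adjoint_bounded_inner:
  fixes T :: "'h::{real_inner,complete_space} \<Rightarrow> 'h"
  assumes T: "bounded_linear T"
  shows "inner (T x) y = inner x (adjoint T y)" "inner (adjoint T x) y = inner x (T y)"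
    "bounded_linear (adjoint T)"
proof -
  have "bounded_bilinear (\<lambda>y x. inner y (T x))"
    using bounded_bilinear.comp[OF bounded_bilinear_inner bounded_linear_ident T] by simp
  then obtain S where S: "bounded_linear S" "\<And>x y. inner (S x) y = inner x (T y)"
    by (rule bounded_bilinear_operator) blast
  have "adjoint T = S" by (rule adjoint_unique) (metis S(2) inner_commute)
  then show "inner (T x) y = inner x (adjoint T y)" "inner (adjoint T x) y = inner x (T y)"
    "bounded_linear (adjoint T)" using S by (simp_all, metis inner_commute)
qed

lemma closure_of_subspace:
  fixes S :: "'a::real_normed_vector set"
  assumes "subspace S"
  shows "subspace (closure S)"
  unfolding subspace_def
proof (intro conjI ballI allI)
  show "0 \<in> closure S" using subspace_0[OF assms] closure_subset by blast
  fix x y :: 'a and c :: real assume x: "x \<in> closure S"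
  obtain u where u: "\<And>n. u n \<in> S" "u \<longlonglongrightarrow> x" using x closure_sequential by metis
  have "c *\<^sub>R u n \<in> S" for n using u(1) subspace_scale[OF assms] by blast
  moreover have "(\<lambda>n. c *\<^sub>R u n) \<longlonglongrightarrow> c *\<^sub>R x" by (intro tendsto_intros u)
  ultimately show "c *\<^sub>R x \<in> closure S"
    unfolding closure_sequential[of "c *\<^sub>R x"] by (intro exI[of _ "\<lambda>n. c *\<^sub>R u n"]) simp
  assume "y \<in> closure S"
  then obtain v where v: "\<And>n. v n \<in> S" "v \<longlonglongrightarrow> y" using closure_sequential by metis
  have "u n + v n \<in> S" for n using u(1) v(1) subspace_add[OF assms] by blast
  moreover have "(\<lambda>n. u n + v n) \<longlonglongrightarrow> x + y" by (intro tendsto_intros u v)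
  ultimately show "x + y \<in> closure S"
    unfolding closure_sequential[of "x + y"] by (intro exI[of _ "\<lambda>n. u n + v n"]) simp
qed

text \<open>Positivity without the complex structure and without \<open>adjoint\<close>, so that
  sums, multiples and products written as lambda terms can be treated directly. Symmetry is listed
  separately because on a real Hilbert space it does not follow from a nonnegative quadratic
  form.\<close>

definition psd :: "('h::real_inner \<Rightarrow> 'h) \<Rightarrow> bool" where
  "psd T \<longleftrightarrow> bounded_linear T \<and> (\<forall>x y. inner (T x) y = inner x (T y)) \<and> (\<forall>x. 0 \<le> inner (T x) x)"

lemma psdI:
  "bounded_linear T \<Longrightarrow> (\<And>x y. inner (T x) y = inner x (T y)) \<Longrightarrow> (\<And>x. 0 \<le> inner (T x) x) \<Longrightarrow> psd T"
  by (auto simp: psd_def)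

lemma psdD:
  assumes "psd T"
  shows "bounded_linear T" "inner (T x) y = inner x (T y)" "0 \<le> inner (T x) x"
  using assms by (auto simp: psd_def)

lemma pos_op_iff_psd:
  fixes T :: "'h::{real_inner,complete_space} \<Rightarrow> 'h"
  shows "pos_op J T \<longleftrightarrow> bop J T \<and> psd T"
proof -
  have "adjoint T = T \<longleftrightarrow> (\<forall>x y. inner (T x) y = inner x (T y))" if "bounded_linear T"
    using adjoint_unique[of T T] adjoint_bounded_inner[OF that] by metis
  then show ?thesis by (auto simp: pos_op_def bop_def psd_def)
qed

lemma psd_id: "psd (\<lambda>x. x)"
  by (simp add: psd_def bounded_linear_ident)

lemma psd_add: "psd S \<Longrightarrow> psd T \<Longrightarrow> psd (\<lambda>x. S x + T x)"
  by (auto simp: psd_def bounded_linear_add inner_add_left inner_add_right intro!: add_nonneg_nonneg)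

lemma psd_scaleR: "psd S \<Longrightarrow> 0 \<le> c \<Longrightarrow> psd (\<lambda>x. c *\<^sub>R S x)"
  by (auto simp: psd_def bounded_linear_const_scaleR intro!: mult_nonneg_nonneg)

lemma psd_square:
  assumes "bounded_linear T" "\<And>x y. inner (T x) y = inner x (T y)"
  shows "psd (\<lambda>x. T (T x))"
proof (rule psdI)
  show "inner (T (T x)) y = inner x (T (T y))" for x y by (simp add: assms(2))
  show "0 \<le> inner (T (T x)) x" for x unfolding assms(2)[of "T x"] by simp
qed (rule bounded_linear_compose[OF assms(1) assms(1)])

lemma quadratic_nonneg_discriminant:
  fixes p b q :: real
  assumes "0 \<le> q" and nonneg: "\<And>t. 0 \<le> p + 2 * t * b + t\<^sup>2 * q"
  shows "b\<^sup>2 \<le> p * q"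
proof (cases "q = 0")
  case True
  have "b = 0"
  proof (rule ccontr)
    assume n: "b \<noteq> 0"
    \<comment> \<open>At this t the expression p + 2 t b equals -1.\<close>
    show False using nonneg[of "- (p + 1) / (2 * b)"] True n by (simp add: field_simps)
  qed
  then show ?thesis using True by simp
next
  case False
  then have p: "q > 0" using assms(1) by simp
  have "0 \<le> p - b\<^sup>2 / q"
    using nonneg[of "- b / q"] p by (simp add: power2_eq_square field_simps)
  then show ?thesis using p by (simp add: field_simps)
qed

lemma psd_cauchy_schwarz:
  assumes "psd T"
  shows "(inner (T x) y)\<^sup>2 \<le> inner (T x) x * inner (T y) y"
proof (rule quadratic_nonneg_discriminant)
  interpret T: bounded_linear T using psdD[OF assms] by simp
  have sym: "inner (T y) x = inner (T x) y" using psdD(2)[OF assms] by (metis inner_commute)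
  show "0 \<le> inner (T x) x + 2 * t * inner (T x) y + t\<^sup>2 * inner (T y) y" for t
    using psdD(3)[OF assms, of "x + t *\<^sub>R y"]
    by (simp add: T.add T.scaleR inner_simps sym power2_eq_square algebra_simps)
qed (rule psdD(3)[OF assms])

lemma psd_kernel: "psd T \<Longrightarrow> inner (T x) x = 0 \<Longrightarrow> T x = 0"
  using psd_cauchy_schwarz[of T x "T x"] by simp

text \<open>Cauchy-Schwarz for the form of T, tested against T x: the fourth power of |T x| is at
  most <T x, x> <T T x, T x>, hence at most |x|^2 |T x|^2.\<close>

lemma psd_contraction:
  assumes T: "psd T" and le: "\<And>x. inner (T x) x \<le> inner x x"
  shows "norm (T x) \<le> norm x"
proof (cases "T x = 0")
  case False
  have "(inner (T x) (T x))\<^sup>2 \<le> inner (T x) x * inner (T (T x)) (T x)"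
    using psd_cauchy_schwarz[OF T] .
  also have "\<dots> \<le> inner x x * inner (T x) (T x)"
    by (intro mult_mono le psdD(3)[OF T]) simp_all
  finally have "inner (T x) (T x) \<le> inner x x"
    using False by (simp add: power2_eq_square)
  then show ?thesis by (simp add: norm_eq_sqrt_inner)
qed simp

text \<open>A fixed point Y of Y = (B + Y^2)/2 gives the square root 1 - Y of 1 - B. The scalar iteration is the
  case B = 1; it majorises the increments of the operator iteration, which therefore converges in norm.\<close>

primrec sqrt_scalar_iter :: "nat \<Rightarrow> real" where
  "sqrt_scalar_iter 0 = 0"
| "sqrt_scalar_iter (Suc n) = (1 + (sqrt_scalar_iter n)\<^sup>2) / 2"

primrec sqrt_iter :: "('h::real_vector \<Rightarrow> 'h) \<Rightarrow> nat \<Rightarrow> 'h \<Rightarrow> 'h" where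
  "sqrt_iter B 0 = (\<lambda>x. 0)"
| "sqrt_iter B (Suc n) = (\<lambda>x. (1/2) *\<^sub>R (B x + sqrt_iter B n (sqrt_iter B n x)))"

lemma sqrt_scalar_iter_bounds: "0 \<le> sqrt_scalar_iter n \<and> sqrt_scalar_iter n \<le> 1"
proof (induction n)
  case (Suc n)
  then have "(sqrt_scalar_iter n)\<^sup>2 \<le> 1" by (simp add: power_le_one)
  then show ?case by simp
qed simp

lemma sqrt_scalar_iter_mono: "sqrt_scalar_iter n \<le> sqrt_scalar_iter (Suc n)"
proof -
  have "0 \<le> (1 - sqrt_scalar_iter n)\<^sup>2" by simp
  then show ?thesis by (simp add: power2_eq_square algebra_simps)
qed

lemma sqrt_iter_bounded_linear: "bounded_linear B \<Longrightarrow> bounded_linear (sqrt_iter B n)"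
  by (induction n)
    (auto intro!: bounded_linear_const_scaleR bounded_linear_add bounded_linear_compose[of "sqrt_iter B _"])

lemma sqrt_iter_commute:
  assumes "bounded_linear C" "\<And>x. C (B x) = B (C x)"
  shows "C (sqrt_iter B n x) = sqrt_iter B n (C x)"
proof -
  interpret C: bounded_linear C by fact
  show ?thesis by (induction n arbitrary: x) (simp_all add: C.zero C.scaleR C.add assms(2))
qed

lemma sqrt_iter_sym:
  assumes "\<And>x y. inner (B x) y = inner x (B y)"
  shows "inner (sqrt_iter B n x) y = inner x (sqrt_iter B n y)"
  by (induction n arbitrary: x y) (simp_all add: inner_simps assms)

lemma sqrt_iter_norm:
  assumes "\<And>x. norm (B x) \<le> norm x"
  shows "norm (sqrt_iter B n x) \<le> sqrt_scalar_iter n * norm x"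
proof (induction n arbitrary: x)
  case (Suc n)
  let ?r = "sqrt_scalar_iter n" and ?S = "sqrt_iter B n"
  have "norm (?S (?S x)) \<le> ?r * (?r * norm x)"
    using Suc[of "?S x"] Suc[of x] sqrt_scalar_iter_bounds[of n]
    by (auto intro: order_trans mult_left_mono)
  then have "norm (B x + ?S (?S x)) \<le> norm x + ?r * (?r * norm x)"
    using assms[of x] norm_triangle_ineq[of "B x" "?S (?S x)"] by linarith
  then have "(1/2) * norm (B x + ?S (?S x)) \<le> (1 + ?r\<^sup>2) / 2 * norm x"
    by (simp add: power2_eq_square algebra_simps)
  then show ?case by (simp del: scaleR_add_right)
qed simp

text \<open>For consecutive iterates R and Q, R R - Q Q = R (R - Q) + (R - Q) Q. With the scalar
  bounds r and q the norm of half of this is at most (r + q) (r - q) / 2, which is exactly the next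
  scalar increment.\<close>

lemma sqrt_iter_step:
  assumes B: "bounded_linear B" "\<And>x. norm (B x) \<le> norm x"
  shows "norm (sqrt_iter B (Suc n) x - sqrt_iter B n x)
    \<le> (sqrt_scalar_iter (Suc n) - sqrt_scalar_iter n) * norm x"
proof (induction n arbitrary: x)
  case 0
  then show ?case using B(2)[of x] by simp
next
  case (Suc n)
  let ?r = "sqrt_scalar_iter (Suc n)" and ?q = "sqrt_scalar_iter n"
  let ?R = "sqrt_iter B (Suc n)" and ?Q = "sqrt_iter B n"
  interpret R: bounded_linear ?R using sqrt_iter_bounded_linear[OF B(1)] .
  have eq: "sqrt_iter B (Suc (Suc n)) x - ?R x
      = (1/2) *\<^sub>R (?R (?R x - ?Q x) + (?R (?Q x) - ?Q (?Q x)))"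
  proof -
    have "sqrt_iter B (Suc (Suc n)) x - ?R x = (1/2) *\<^sub>R (B x + ?R (?R x)) - (1/2) *\<^sub>R (B x + ?Q (?Q x))"
      by (simp only: sqrt_iter.simps(2)[of B "Suc n"] sqrt_iter.simps(2)[of B n])
    also have "\<dots> = (1/2) *\<^sub>R (?R (?R x) - ?Q (?Q x))"
      by (simp only: scaleR_diff_right[symmetric] add_diff_cancel_left)
    also have "?R (?R x) - ?Q (?Q x) = ?R (?R x - ?Q x) + (?R (?Q x) - ?Q (?Q x))"
      by (simp only: R.diff) simp
    finally show ?thesis .
  qed
  have 1: "norm (?R (?R x - ?Q x)) \<le> ?r * ((?r - ?q) * norm x)"
    using sqrt_iter_norm[OF B(2), of "Suc n" "?R x - ?Q x"] Suc[of x] sqrt_scalar_iter_bounds[of "Suc n"]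
    by (meson mult_left_mono order_trans)
  have 2: "norm (?R (?Q x) - ?Q (?Q x)) \<le> (?r - ?q) * (?q * norm x)"
    using Suc[of "?Q x"] sqrt_iter_norm[OF B(2), of n x] sqrt_scalar_iter_mono[of n]
    by (meson diff_ge_0_iff_ge mult_left_mono order_trans)
  have "norm (sqrt_iter B (Suc (Suc n)) x - ?R x) \<le> (1/2) * (?r * ((?r - ?q) * norm x) + (?r - ?q) * (?q * norm x))"
    unfolding eq using 1 2 norm_triangle_ineq[of "?R (?R x - ?Q x)" "?R (?Q x) - ?Q (?Q x)"] by simp
  also have "\<dots> = ((?r\<^sup>2 - ?q\<^sup>2) / 2) * norm x"
    by (simp add: power2_eq_square algebra_simps diff_divide_distrib add_divide_distrib del: sqrt_scalar_iter.simps)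
  also have "(?r\<^sup>2 - ?q\<^sup>2) / 2 = sqrt_scalar_iter (Suc (Suc n)) - ?r"
    by (simp only: sqrt_scalar_iter.simps(2)[of "Suc n"]) (simp add: field_simps)
  finally show ?case .
qed

lemma sqrt_iter_diff:
  assumes B: "bounded_linear B" "\<And>x. norm (B x) \<le> norm x"
  shows "norm (sqrt_iter B (n + k) x - sqrt_iter B n x)
    \<le> (sqrt_scalar_iter (n + k) - sqrt_scalar_iter n) * norm x"
proof (induction k)
  case (Suc k)
  have "norm (sqrt_iter B (n + Suc k) x - sqrt_iter B n x) \<le>
    norm (sqrt_iter B (Suc (n + k)) x - sqrt_iter B (n + k) x) + norm (sqrt_iter B (n + k) x - sqrt_iter B n x)"
    using norm_triangle_ineq[of "sqrt_iter B (Suc (n + k)) x - sqrt_iter B (n + k) x" "sqrt_iter B (n + k) x - sqrt_iter B n x"]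
    by (simp del: sqrt_iter.simps)
  also have "\<dots> \<le> (sqrt_scalar_iter (Suc (n + k)) - sqrt_scalar_iter (n + k)) * norm x
      + (sqrt_scalar_iter (n + k) - sqrt_scalar_iter n) * norm x"
    by (intro add_mono Suc sqrt_iter_step B)
  also have "\<dots> = (sqrt_scalar_iter (n + Suc k) - sqrt_scalar_iter n) * norm x"
    by (simp add: algebra_simps del: sqrt_scalar_iter.simps)
  finally show ?case .
qed simp

text \<open>The scalar sequence is increasing and bounded, hence Cauchy, and dominates the operator
  increments. Commutation passes from B to Y because every iterate is a polynomial in B.\<close>

lemma sqrt_fixpoint_exists:
  fixes B :: "'h::{real_inner,complete_space} \<Rightarrow> 'h"
  assumes B: "bounded_linear B" "\<And>x. norm (B x) \<le> norm x"
    and sym: "\<And>x y. inner (B x) y = inner x (B y)"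
  obtains Y where "bounded_linear Y" "\<And>x. norm (Y x) \<le> norm x" "\<And>x y. inner (Y x) y = inner x (Y y)"
    "\<And>x. 2 *\<^sub>R Y x = B x + Y (Y x)"
    "\<And>C x. bounded_linear C \<Longrightarrow> (\<And>x. C (B x) = B (C x)) \<Longrightarrow> C (Y x) = Y (C x)"
proof -
  let ?Y = "sqrt_iter B"
  have "incseq sqrt_scalar_iter" using sqrt_scalar_iter_mono by (rule incseq_SucI)
  then have "Cauchy sqrt_scalar_iter"
    using sqrt_scalar_iter_bounds incseq_convergent[of sqrt_scalar_iter 1] LIMSEQ_imp_Cauchy by metis
  have Cau: "Cauchy (\<lambda>n. ?Y n x)" for x
  proof (rule metric_CauchyI)
    fix e :: real assume "0 < e"
    then have "0 < e / (norm x + 1)" by (simp add: add_nonneg_pos)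
    then obtain N where N: "\<And>m n. m \<ge> N \<Longrightarrow> n \<ge> N \<Longrightarrow> dist (sqrt_scalar_iter m) (sqrt_scalar_iter n) < e / (norm x + 1)"
      using metric_CauchyD[OF \<open>Cauchy sqrt_scalar_iter\<close>] by blast
    have le: "dist (?Y (n + k) x) (?Y n x) < e" if "n \<ge> N" for n k
    proof -
      have "norm (?Y (n + k) x - ?Y n x) \<le> (sqrt_scalar_iter (n + k) - sqrt_scalar_iter n) * norm x"
        using sqrt_iter_diff[OF B] .
      also have "\<dots> \<le> (e / (norm x + 1)) * norm x"
        using N[of "n + k" n] that by (intro mult_right_mono) (auto simp: dist_real_def)
      also have "\<dots> < e" using \<open>0 < e\<close> by (simp add: divide_less_eq add_nonneg_pos)
      finally show ?thesis by (simp add: dist_norm)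
    qed
    have "dist (?Y m x) (?Y n x) < e" if "m \<ge> N" "n \<ge> N" for m n
      using le[of n "m - n"] le[of m "n - m"] that by (cases "n \<le> m") (auto simp: dist_commute)
    then show "\<exists>N. \<forall>m\<ge>N. \<forall>n\<ge>N. dist (?Y m x) (?Y n x) < e" by blast
  qed
  define Y where "Y x = lim (\<lambda>n. ?Y n x)" for x
  have lim: "(\<lambda>n. ?Y n x) \<longlonglongrightarrow> Y x" for x
    unfolding Y_def using Cau Cauchy_convergent convergent_LIMSEQ_iff by blast
  interpret Yn: bounded_linear "?Y n" for n using sqrt_iter_bounded_linear[OF B(1)] .
  have nYn: "norm (?Y n x) \<le> norm x" for n x
    using sqrt_iter_norm[OF B(2), of n x] sqrt_scalar_iter_bounds[of n]
    by (meson mult_left_le_one_le norm_ge_zero order_trans)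
  have nY: "norm (Y x) \<le> norm x" for x
    using LIMSEQ_le_const2[OF tendsto_norm[OF lim[of x]]] nYn by blast
  have linY: "bounded_linear Y"
  proof (rule bounded_linear_intro[where K = 1])
    show "Y (x + y) = Y x + Y y" for x y
      using LIMSEQ_unique[OF lim[of "x + y"]] tendsto_add[OF lim[of x] lim[of y]] by (simp add: Yn.add)
    show "Y (r *\<^sub>R x) = r *\<^sub>R Y x" for r x
      using LIMSEQ_unique[OF lim[of "r *\<^sub>R x"]] tendsto_scaleR[OF tendsto_const lim[of x]] by (simp add: Yn.scaleR)
  qed (use nY in simp)
  have symY: "inner (Y x) y = inner x (Y y)" for x y
  proof -
    have "(\<lambda>n. inner (?Y n x) y) \<longlonglongrightarrow> inner (Y x) y" by (intro tendsto_intros lim)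
    moreover have "(\<lambda>n. inner (?Y n x) y) \<longlonglongrightarrow> inner x (Y y)"
      unfolding sqrt_iter_sym[OF sym] by (intro tendsto_intros lim)
    ultimately show ?thesis by (rule LIMSEQ_unique)
  qed
  have sq: "2 *\<^sub>R Y x = B x + Y (Y x)" for x
  proof -
    \<comment> \<open>The square of the n-th iterate is split as Y_n (Y_n x - Y x) + Y_n (Y x); the
      first term vanishes in the limit since the Y_n are contractions.\<close>
    have "(\<lambda>n. ?Y n (?Y n x - Y x)) \<longlonglongrightarrow> 0"
    proof (rule Lim_null_comparison)
      show "\<forall>\<^sub>F n in sequentially. norm (?Y n (?Y n x - Y x)) \<le> norm (?Y n x - Y x)"
        using nYn by simp
      show "(\<lambda>n. norm (?Y n x - Y x)) \<longlonglongrightarrow> 0"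
        using tendsto_norm_zero[OF LIM_zero[OF lim[of x]]] .
    qed
    from tendsto_add[OF this lim[of "Y x"]] have "(\<lambda>n. ?Y n (?Y n x)) \<longlonglongrightarrow> Y (Y x)"
      by (simp add: Yn.diff)
    then have "(\<lambda>n. ?Y (Suc n) x) \<longlonglongrightarrow> (1/2) *\<^sub>R (B x + Y (Y x))"
      unfolding sqrt_iter.simps by (intro tendsto_intros)
    from LIMSEQ_unique[OF this LIMSEQ_Suc[OF lim[of x]]]
    have "Y x = (1/2) *\<^sub>R (B x + Y (Y x))" by simp
    then show ?thesis by (metis (no_types) scaleR_scaleR scaleR_one mult_2 times_divide_eq_right mult.right_neutral div_self zero_neq_numeral)
  qed
  have comm: "C (Y x) = Y (C x)" if C: "bounded_linear C" "\<And>x. C (B x) = B (C x)" for C x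
  proof -
    have "(\<lambda>n. C (?Y n x)) \<longlonglongrightarrow> C (Y x)" using bounded_linear.tendsto[OF C(1) lim] .
    then show ?thesis unfolding sqrt_iter_commute[of C B, OF C] using lim LIMSEQ_unique by blast
  qed
  show ?thesis using that[OF linY nY symY sq comm] .
qed

text \<open>Rescaling by a bound c of A gives 0 \<le> B \<le> 1 for B = 1 - A / c. From 2 Y = B +
  Y^2 one gets c (1 - Y)^2 = c (1 - B) = A. The commutation clause is what later puts roots into M
  and makes them commute with resolvents.\<close>

lemma psd_sqrt_exists:
  fixes A :: "'h::{real_inner,complete_space} \<Rightarrow> 'h"
  assumes A: "psd A"
  obtains S where "psd S" "\<And>x. S (S x) = A x"
    "\<And>C x. bounded_linear C \<Longrightarrow> (\<And>x. C (A x) = A (C x)) \<Longrightarrow> C (S x) = S (C x)"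
proof -
  interpret A: bounded_linear A using psdD[OF A] by simp
  obtain c where c: "c > 0" "\<And>x. norm (A x) \<le> norm x * c" using A.pos_bounded by blast
  define B where "B = (\<lambda>x. x - (1/c) *\<^sub>R A x)"
  have linB: "bounded_linear B" unfolding B_def
    by (intro bounded_linear_sub bounded_linear_ident bounded_linear_const_scaleR A.bounded_linear_axioms)
  have symB: "inner (B x) y = inner x (B y)" for x y
    unfolding B_def using psdD(2)[OF A] by (simp add: inner_simps)
  have "inner (A x) x \<le> c * inner x x" for x
  proof -
    have "inner (A x) x \<le> norm (A x) * norm x" by (rule norm_cauchy_schwarz)
    also have "\<dots> \<le> norm x * c * norm x" using c by (intro mult_right_mono) auto
    finally show ?thesis by (simp add: power2_norm_eq_inner[symmetric] power2_eq_square algebra_simps)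
  qed
  then have "psd B" using linB symB c(1) by (intro psdI) (auto simp: B_def inner_simps field_simps)
  moreover have "inner (B x) x \<le> inner x x" for x
    using psdD(3)[OF A] c(1) by (simp add: B_def inner_simps)
  ultimately have nB: "norm (B x) \<le> norm x" for x by (rule psd_contraction)
  obtain Y where Y: "bounded_linear Y" "\<And>x. norm (Y x) \<le> norm x" "\<And>x y. inner (Y x) y = inner x (Y y)"
    "\<And>x. 2 *\<^sub>R Y x = B x + Y (Y x)"
    "\<And>C x. bounded_linear C \<Longrightarrow> (\<And>x. C (B x) = B (C x)) \<Longrightarrow> C (Y x) = Y (C x)"
    by (rule sqrt_fixpoint_exists[OF linB nB symB]) blast
  interpret Y: bounded_linear Y by fact
  define S where "S x = sqrt c *\<^sub>R (x - Y x)" for x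
  have "psd S"
  proof (rule psdI)
    show "bounded_linear S" unfolding S_def
      by (intro bounded_linear_const_scaleR bounded_linear_sub bounded_linear_ident Y)
    show "inner (S x) y = inner x (S y)" for x y using Y(3) by (simp add: S_def inner_simps)
    show "0 \<le> inner (S x) x" for x
    proof -
      have "inner (Y x) x \<le> norm (Y x) * norm x" by (rule norm_cauchy_schwarz)
      also have "\<dots> \<le> norm x * norm x" by (intro mult_right_mono Y) auto
      finally show ?thesis using c(1)
        by (simp add: S_def inner_simps power2_norm_eq_inner[symmetric] power2_eq_square)
    qed
  qed
  moreover have "S (S x) = A x" for x
  proof -
    have "S (S x) = (sqrt c * sqrt c) *\<^sub>R (x - Y x - Y x + Y (Y x))"
      by (simp add: S_def Y.scaleR Y.diff algebra_simps)
    also have "x - Y x - Y x + Y (Y x) = (x - B x) - (2 *\<^sub>R Y x - (B x + Y (Y x)))"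
      by (simp add: scaleR_2 algebra_simps)
    also have "\<dots> = (1/c) *\<^sub>R A x" unfolding Y(4) by (simp add: B_def)
    finally show ?thesis using c(1) by simp
  qed
  moreover have "C (S x) = S (C x)" if C: "bounded_linear C" "\<And>x. C (A x) = A (C x)" for C x
  proof -
    interpret C: bounded_linear C by fact
    have "C (B x) = B (C x)" for x by (simp add: B_def C.diff C.scaleR C(2))
    then show ?thesis using Y(5)[OF C(1)] by (simp add: S_def C.diff C.scaleR)
  qed
  ultimately show ?thesis using that by blast
qed

text \<open>If P and Q commute and have equal squares, then (P + Q) (P x - Q x) = 0, so both
  operators annihilate y = P x - Q x by positivity, and <y, y> = 0. S and T are not known to commute
  with each other, but both commute with the constructed root R of their common square, so each
  equals R.\<close>

lemma psd_sqrt_unique: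
  fixes S :: "'h::{real_inner,complete_space} \<Rightarrow> 'h"
  assumes S: "psd S" and T: "psd T" and eq: "\<And>x. S (S x) = T (T x)"
  shows "S = T"
proof -
  have main: "P = Q" if P: "psd P" and Q: "psd Q" and pq: "\<And>x. P (P x) = Q (Q x)"
      and comm: "\<And>x. Q (P x) = P (Q x)" for P Q :: "'h \<Rightarrow> 'h"
  proof
    fix x
    interpret P: bounded_linear P using psdD[OF P] by simp
    interpret Q: bounded_linear Q using psdD[OF Q] by simp
    define y where "y = P x - Q x"
    have "P y + Q y = 0" unfolding y_def by (simp add: P.diff Q.diff pq comm)
    then have "inner (P y) y + inner (Q y) y = 0" by (metis inner_add_left inner_zero_left)
    then have "inner (P y) y = 0" "inner (Q y) y = 0"
      using psdD(3)[OF P, of y] psdD(3)[OF Q, of y] by linarith+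
    then have "P y = 0" "Q y = 0" using psd_kernel P Q by blast+
    then have "inner y y = 0" using psdD(2)[OF P, of x y] psdD(2)[OF Q, of x y]
      by (subst (1) y_def) (simp add: inner_simps)
    then show "P x = Q x" by (simp add: y_def)
  qed
  interpret S: bounded_linear S using psdD[OF S] by simp
  have "psd (\<lambda>x. S (S x))" using psd_square psdD[OF S] by blast
  then obtain R where R: "psd R" "\<And>x. R (R x) = S (S x)"
    "\<And>C x. bounded_linear C \<Longrightarrow> (\<And>x. C (S (S x)) = S (S (C x))) \<Longrightarrow> C (R x) = R (C x)"
    using psd_sqrt_exists[of "\<lambda>x. S (S x)"] by blast
  have "R = S" using main[OF R(1) S R(2)] R(3)[of S] psdD(1)[OF S] by blast
  moreover have "R = T" using main[OF R(1) T] R(3)[of T] psdD(1)[OF T] by (simp add: R(2) eq)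
  ultimately show ?thesis by simp
qed

text \<open>With S the root of A, which commutes with B, <A B x, x> = <B S x, S x>.\<close>

lemma psd_compose:
  fixes A :: "'h::{real_inner,complete_space} \<Rightarrow> 'h"
  assumes A: "psd A" and B: "psd B" and comm: "\<And>x. A (B x) = B (A x)"
  shows "psd (\<lambda>x. A (B x))"
proof -
  obtain S where S: "psd S" "\<And>x. S (S x) = A x"
    "\<And>C x. bounded_linear C \<Longrightarrow> (\<And>x. C (A x) = A (C x)) \<Longrightarrow> C (S x) = S (C x)"
    by (rule psd_sqrt_exists[OF A]) blast
  have SB: "B (S x) = S (B x)" for x using S(3) psdD(1)[OF B] comm by metis
  show ?thesis
  proof (rule psdI)
    show "bounded_linear (\<lambda>x. A (B x))" using psdD(1)[OF A] psdD(1)[OF B] by (rule bounded_linear_compose)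
    show "inner (A (B x)) y = inner x (A (B y))" for x y
      using psdD(2)[OF A] psdD(2)[OF B] comm by metis
    show "0 \<le> inner (A (B x)) x" for x
      using psdD(3)[OF B, of "S x"] psdD(2)[OF S(1)] by (simp add: S(2)[symmetric] SB)
  qed
qed

text \<open>Put G = S - T and P = S + T, so that G P = S^2 - T^2 \<ge> 0. Then P G P \<ge> 0, that
  is, G is positive on the closed range of P. On the orthogonal complement P vanishes, hence so do
  S, T and G.\<close>

lemma psd_sqrt_mono:
  fixes S :: "'h::{real_inner,complete_space} \<Rightarrow> 'h"
  assumes S: "psd S" and T: "psd T" and comm: "\<And>x. S (T x) = T (S x)"
    and le: "psd (\<lambda>x. S (S x) - T (T x))"
  shows "psd (\<lambda>x. S x - T x)"
proof -
  interpret S: bounded_linear S using psdD[OF S] by simp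
  interpret T: bounded_linear T using psdD[OF T] by simp
  define G where "G x = S x - T x" for x
  define P where "P x = S x + T x" for x
  have linG: "bounded_linear G" unfolding G_def
    by (intro bounded_linear_sub S.bounded_linear_axioms T.bounded_linear_axioms)
  have P: "psd P" unfolding P_def by (intro psd_add S T)
  interpret G: bounded_linear G by fact
  interpret P: bounded_linear P using psdD[OF P] by simp
  have symG: "inner (G x) y = inner x (G y)" for x y
    using psdD(2)[OF S] psdD(2)[OF T] by (simp add: G_def inner_simps)
  have GP: "G (P x) = S (S x) - T (T x)" for x by (simp add: G_def P_def S.add T.add comm)
  have PG: "P (G x) = G (P x)" for x by (simp add: G_def P_def S.add T.add S.diff T.diff comm)
  have "psd (\<lambda>x. G (P (P x)))"
  proof -
    have "psd (\<lambda>x. (\<lambda>x. S (S x) - T (T x)) (P x))"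
      by (rule psd_compose[OF le P]) (simp add: P_def S.add T.add S.diff T.diff comm)
    then show ?thesis by (simp add: GP)
  qed
  then have rP: "0 \<le> inner (G (P z)) (P z)" for z
    using psdD(3)[of "\<lambda>x. G (P (P x))" z] psdD(2)[OF P, of "G (P z)" z] PG[of "P z"] by simp
  have sub: "subspace (closure (range P))"
    by (intro closure_of_subspace linear_subspace_image) (auto simp: P.linear_axioms)
  have rcl: "0 \<le> inner (G u) u" if ucl: "u \<in> closure (range P)" for u
  proof -
    obtain f where f: "\<forall>n. f n \<in> range P" "f \<longlonglongrightarrow> u"
      using ucl unfolding closure_sequential by blast
    have "(\<lambda>n. inner (G (f n)) (f n)) \<longlonglongrightarrow> inner (G u) u"
      by (intro tendsto_intros f G.tendsto)
    moreover have "0 \<le> inner (G (f n)) (f n)" for n using spec[OF f(1), of n] rP by auto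
    ultimately show ?thesis using LIMSEQ_le_const by blast
  qed
  have "0 \<le> inner (G z) z" for z
  proof -
    obtain u where u: "u \<in> closure (range P)" "\<And>w. w \<in> closure (range P) \<Longrightarrow> inner (z - u) w = 0"
      by (rule closed_subspace_projection[OF sub closed_closure]) blast
    define v where "v = z - u"
    have "inner (P v) v = 0" using u(2)[of "P v"] closure_subset[of "range P"]
      by (auto simp: v_def inner_commute)
    then have "inner (S v) v + inner (T v) v = 0" by (simp add: P_def inner_simps)
    then have "inner (S v) v = 0" "inner (T v) v = 0"
      using psdD(3)[OF S, of v] psdD(3)[OF T, of v] by linarith+
    then have "G v = 0" using psd_kernel S T by (metis G_def diff_zero)
    then have "inner (G (u + v)) (u + v) = inner (G u) u"
      using symG[of u v] by (simp add: G.add inner_simps)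
    then show ?thesis using rcl[OF u(1)] by (simp add: v_def)
  qed
  then show ?thesis using linG symG unfolding G_def by (intro psdI) auto
qed

section \<open>Commutants and resolvents\<close>

lemma op_sqrt_psd:
  fixes A :: "'h::{real_inner,complete_space} \<Rightarrow> 'h"
  assumes J: "bounded_linear J" and A: "bop J A" "psd A"
  shows "psd (op_sqrt J A)" "op_sqrt J A (op_sqrt J A x) = A x" "bop J (op_sqrt J A)"
    "bounded_linear C \<Longrightarrow> (\<And>x. C (A x) = A (C x)) \<Longrightarrow> C (op_sqrt J A x) = op_sqrt J A (C x)"
proof -
  obtain S where S: "psd S" "\<And>x. S (S x) = A x"
    "\<And>C x. bounded_linear C \<Longrightarrow> (\<And>x. C (A x) = A (C x)) \<Longrightarrow> C (S x) = S (C x)"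
    by (rule psd_sqrt_exists[OF A(2)]) blast
  \<comment> \<open>Commutation with C = J makes the root complex linear.\<close>
  have bS: "bop J S" using S(3)[of J] J A(1) psdD(1)[OF S(1)] by (simp add: bop_def)
  have "op_sqrt J A = S" unfolding op_sqrt_def
  proof (rule the_equality)
    show "pos_op J S \<and> S \<circ> S = A" using S bS by (auto simp: pos_op_iff_psd)
    fix T assume "pos_op J T \<and> T \<circ> T = A"
    then show "T = S" using psd_sqrt_unique[of T S] S(1,2)
      by (simp add: pos_op_iff_psd) (metis comp_apply)
  qed
  then show "psd (op_sqrt J A)" "op_sqrt J A (op_sqrt J A x) = A x" "bop J (op_sqrt J A)"
    "bounded_linear C \<Longrightarrow> (\<And>x. C (A x) = A (C x)) \<Longrightarrow> C (op_sqrt J A x) = op_sqrt J A (C x)"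
    using S bS by auto
qed

lemma cstructD:
  assumes "cstruct J"
  shows "bounded_linear J" "J (J x) = - x" "inner (J x) (J y) = inner x y" "inner (J x) y = - inner x (J y)"
    "norm (J x) = norm x"
proof -
  show *: "bounded_linear J" "J (J x) = - x" "inner (J x) (J y) = inner x y" for x y
    using assms by (auto simp: cstruct_def)
  show "inner (J x) y = - inner x (J y)" using *(3)[of "J x" y] *(2)[of x] by simp
  show "norm (J x) = norm x" using *(3)[of x x] by (simp add: norm_eq_sqrt_inner)
qed

lemma commutant_iff:
  "T \<in> commutant J S \<longleftrightarrow> bop J T \<and> (\<forall>A\<in>S. \<forall>x. T (A x) = A (T x))"
  by (auto simp: commutant_def fun_eq_iff)

text \<open>Stated for adjoint-closed sets instead of algebras, so that S can be M as well as the
  commutant of M.\<close>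

locale bop_set =
  fixes J :: "'h::{real_inner,complete_space} \<Rightarrow> 'h" and S :: "('h \<Rightarrow> 'h) set"
  assumes cs: "cstruct J" and sub: "S \<subseteq> Collect (bop J)"
    and adj: "A \<in> S \<Longrightarrow> adjoint A \<in> S"
begin

interpretation J: bounded_linear J using cstructD[OF cs] by simp

lemma linS: "A \<in> S \<Longrightarrow> bounded_linear A" and JS: "A \<in> S \<Longrightarrow> A (J x) = J (A x)"
  using sub by (auto simp: bop_def)

lemma id_in: "(\<lambda>x. x) \<in> commutant J S"
  by (simp add: commutant_iff bop_def bounded_linear_ident)

lemma J_in: "J \<in> commutant J S"
  using JS by (auto simp: commutant_iff bop_def J.bounded_linear_axioms)

lemma add_in: "A \<in> commutant J S \<Longrightarrow> B \<in> commutant J S \<Longrightarrow> (\<lambda>x. A x + B x) \<in> commutant J S"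
  using linS by (simp add: commutant_iff bop_def bounded_linear_add J.add bounded_linear.linear linear_add)

lemma scale_in: "A \<in> commutant J S \<Longrightarrow> (\<lambda>x. c *\<^sub>R A x) \<in> commutant J S"
  using linS by (simp add: commutant_iff bop_def bounded_linear_const_scaleR J.scaleR bounded_linear.linear linear_scale)

lemma diff_in: "A \<in> commutant J S \<Longrightarrow> B \<in> commutant J S \<Longrightarrow> (\<lambda>x. A x - B x) \<in> commutant J S"
  using add_in[of A "\<lambda>x. (-1) *\<^sub>R B x"] scale_in[of B "-1"] by simp

lemma comp_in: "A \<in> commutant J S \<Longrightarrow> B \<in> commutant J S \<Longrightarrow> (\<lambda>x. A (B x)) \<in> commutant J S"
  by (simp add: commutant_iff bop_def bounded_linear_compose)

lemma adjoint_in: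
  assumes A: "A \<in> commutant J S" shows "adjoint A \<in> commutant J S"
proof -
  have lin: "bounded_linear A" and AJ: "A (J x) = J (A x)" for x using A by (auto simp: commutant_iff bop_def)
  note ad = adjoint_bounded_inner[OF lin]
  have "adjoint A (J x) = J (adjoint A x)" for x
  proof -
    have "inner (adjoint A (J x)) y = inner (J (adjoint A x)) y" for y
      by (simp add: ad(2) cstructD(4)[OF cs] AJ[symmetric])
    then show ?thesis using vector_eq_rdot by blast
  qed
  moreover have "adjoint A (B x) = B (adjoint A x)" if B: "B \<in> S" for B x
  proof -
    note adB = adjoint_bounded_inner[OF linS[OF B]]
    have "inner (adjoint A (B x)) y = inner (B (adjoint A x)) y" for y
      using A adj[OF B] by (simp add: ad adB commutant_iff)
    then show ?thesis using vector_eq_rdot by blast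
  qed
  ultimately show ?thesis using ad(3) by (simp add: commutant_iff bop_def)
qed

lemma op_sqrt_in:
  assumes A: "A \<in> commutant J S" "psd A" shows "op_sqrt J A \<in> commutant J S"
proof -
  have "bop J A" using A by (simp add: commutant_iff)
  note s = op_sqrt_psd[OF J.bounded_linear_axioms this A(2)]
  show ?thesis using s(3) s(4) A(1) linS by (auto simp: commutant_iff)
qed

lemma commutant_bop_set: "bop_set J (commutant J S)"
  using cs adjoint_in by unfold_locales (auto simp: commutant_iff)

text \<open>A selfadjoint contraction A is the real part of the unitary A + i (1 - A^2)^(1/2).\<close>

lemma commute_unitaries:
  assumes T: "bounded_linear T"
    and U: "\<And>U x. U \<in> commutant J S \<Longrightarrow> unitary_op J U \<Longrightarrow> T (U x) = U (T x)"
    and A: "A \<in> commutant J S"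
  shows "T (A x) = A (T x)"
proof -
  interpret T: bounded_linear T by fact
  have ctr: "T (A x) = A (T x)" if A: "A \<in> commutant J S" and sa: "\<And>x y. inner (A x) y = inner x (A y)"
    and n: "\<And>x. norm (A x) \<le> norm x" for A x
  proof -
    have AJ: "A (J x) = J (A x)" for x using A by (auto simp: commutant_iff bop_def)
    interpret A: bounded_linear A using A by (auto simp: commutant_iff bop_def)
    define B where "B = (\<lambda>x. x - A (A x))"
    have B_in: "B \<in> commutant J S" unfolding B_def by (rule diff_in[OF id_in comp_in[OF A A]])
    have "psd B" unfolding B_def
    proof (rule psdI)
      show "bounded_linear (\<lambda>x. x - A (A x))"
        by (intro bounded_linear_sub bounded_linear_ident bounded_linear_compose[OF A.bounded_linear_axioms A.bounded_linear_axioms])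
      show "inner (x - A (A x)) y = inner x (y - A (A y))" for x y by (simp add: inner_simps sa)
      show "0 \<le> inner (x - A (A x)) x" for x using n[of x]
        by (simp add: inner_diff_left sa[of "A x"] power2_norm_eq_inner[symmetric] power_mono)
    qed
    have bB: "bop J B" using B_in by (simp add: commutant_iff)
    define C where "C = op_sqrt J B"
    note s = op_sqrt_psd[OF J.bounded_linear_axioms bB \<open>psd B\<close>, folded C_def]
    have C_in: "C \<in> commutant J S" unfolding C_def by (rule op_sqrt_in[OF B_in \<open>psd B\<close>])
    have CJ: "C (J x) = J (C x)" for x using C_in by (auto simp: commutant_iff bop_def)
    interpret C: bounded_linear C using C_in by (auto simp: commutant_iff bop_def)
    have AC: "A (C x) = C (A x)" for x
      by (rule s(4)[OF A.bounded_linear_axioms]) (simp add: B_def A.diff)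
    define V where "V = (\<lambda>x. A x + J (C x))"
    define W where "W = (\<lambda>x. A x - J (C x))"
    have VW_in: "V \<in> commutant J S" "W \<in> commutant J S"
      unfolding V_def W_def by (rule add_in[OF A comp_in[OF J_in C_in]], rule diff_in[OF A comp_in[OF J_in C_in]])
    have VW: "V (W x) = x" "W (V x) = x" for x
      unfolding V_def W_def
      by (simp_all add: A.diff A.add C.diff C.add J.diff J.add AC AJ CJ cstructD(2)[OF cs] s(2) B_def)
    have JC: "inner (J (C x)) y = - inner x (J (C y))" for x y
      using psdD(2)[OF s(1), of x "J y"] by (simp add: cstructD(4)[OF cs] CJ)
    have aV: "adjoint V = W" "adjoint W = V"
      by (intro adjoint_unique allI; simp add: V_def W_def inner_add_left inner_add_right inner_diff_left
          inner_diff_right sa JC)+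
    have "unitary_op J V" "unitary_op J W"
      using VW VW_in by (auto simp: unitary_op_def aV fun_eq_iff commutant_iff)
    then have "T (V x) = V (T x)" "T (W x) = W (T x)" using U VW_in by blast+
    then have "T (V x + W x) = V (T x) + W (T x)" by (simp add: T.add)
    moreover have "V x + W x = 2 *\<^sub>R A x" for x by (simp add: V_def W_def scaleR_2)
    ultimately show ?thesis by (simp add: T.scaleR)
  qed
  have sac: "T (A x) = A (T x)" if A: "A \<in> commutant J S" and sa: "\<And>x y. inner (A x) y = inner x (A y)" for A x
  proof -
    interpret A: bounded_linear A using A by (auto simp: commutant_iff bop_def)
    obtain c where c: "c > 0" "\<And>x. norm (A x) \<le> norm x * c" using A.pos_bounded by blast
    have "T ((1/c) *\<^sub>R A x) = (1/c) *\<^sub>R A (T x)"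
      using c by (intro ctr scale_in A) (auto simp: sa field_simps)
    then show ?thesis using c(1) by (simp add: T.scaleR)
  qed
  interpret A: bounded_linear A using A by (auto simp: commutant_iff bop_def)
  note ad = adjoint_bounded_inner[OF A.bounded_linear_axioms]
  have AJ: "A (J x) = J (A x)" for x using A by (auto simp: commutant_iff bop_def)
  have A'_in: "adjoint A \<in> commutant J S" using adjoint_in[OF A] .
  then have A'J: "adjoint A (J x) = J (adjoint A x)" for x by (auto simp: commutant_iff bop_def)
  \<comment> \<open>P and Q are selfadjoint: twice the real part and minus twice the imaginary part
    of A.\<close>
  define P where "P = (\<lambda>x. A x + adjoint A x)"
  define Q where "Q = (\<lambda>x. J (A x - adjoint A x))"
  have P: "T (P x) = P (T x)" unfolding P_def
    by (rule sac[OF add_in[OF A A'_in]]) (simp add: inner_add_left inner_add_right ad)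
  have Q: "T (Q x) = Q (T x)" unfolding Q_def
    by (rule sac[OF comp_in[OF J_in diff_in[OF A A'_in]]])
      (simp add: inner_diff_left inner_diff_right ad cstructD(4)[OF cs] AJ A'J J.diff)
  \<comment> \<open>T is only real linear so far; J is itself a unitary of the commutant, so
    commutation with J is an instance of the hypothesis.\<close>
  have J: "T (J x) = J (T x)" for x
  proof (rule U[OF J_in])
    have "adjoint J = (\<lambda>x. - J x)" by (rule adjoint_unique) (simp add: cstructD(4)[OF cs])
    then show "unitary_op J J"
      by (simp add: unitary_op_def bop_def J.bounded_linear_axioms fun_eq_iff cstructD(2)[OF cs] J.neg)
  qed
  have eq: "2 *\<^sub>R A x = P x - J (Q x)" for x
    by (simp add: P_def Q_def cstructD(2)[OF cs] scaleR_2)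
  have "2 *\<^sub>R T (A x) = 2 *\<^sub>R A (T x)"
    unfolding T.scaleR[symmetric] eq by (simp add: T.diff P J Q)
  then show ?thesis by simp
qed

end

lemma vNa_bop_set: "vNa J M \<Longrightarrow> bop_set J M"
  by unfold_locales (auto simp: vNa_def)

text \<open>The unitaries determine the commutant as far as commutation is concerned, and the
  commutant of the commutant is M. This is how the resolvents and the operator x are placed in
  M.\<close>

lemma vNa_mem_if_commutes_unitaries:
  assumes M: "vNa J M" and T: "bounded_linear T"
    and U: "\<And>U x. U \<in> commutant J M \<Longrightarrow> unitary_op J U \<Longrightarrow> T (U x) = U (T x)"
  shows "T \<in> M"
proof -
  interpret bop_set J M using M by (rule vNa_bop_set)
  have *: "T (A x) = A (T x)" if "A \<in> commutant J M" for A x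
    by (rule commute_unitaries[OF T U that])
  then have "T \<in> commutant J (commutant J M)"
    using T J_in by (simp add: commutant_iff bop_def)
  then show ?thesis using M by (simp add: vNa_def)
qed

section \<open>Resolvents of a positive selfadjoint operator affiliated with M\<close>

locale affiliated_operator =
  fixes J :: "'h::{real_inner,complete_space} \<Rightarrow> 'h" and M D a
  assumes vN: "vNa J M" and psa: "pos_selfadj J D a" and aff: "affiliated J M D a"
begin

lemma cs: "cstruct J" using vN by (simp add: vNa_def)

sublocale J: bounded_linear J using cstructD[OF cs] by simp

lemma subD: "subspace D" and clD: "closure D = UNIV"
  and a_add: "x \<in> D \<Longrightarrow> y \<in> D \<Longrightarrow> a (x + y) = a x + a y"
  and a_scale: "x \<in> D \<Longrightarrow> a (c *\<^sub>R x) = c *\<^sub>R a x"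
  and a_sym: "x \<in> D \<Longrightarrow> y \<in> D \<Longrightarrow> inner (a x) y = inner x (a y)"
  and a_pos: "x \<in> D \<Longrightarrow> 0 \<le> inner (a x) x"
  using psa unfolding pos_selfadj_def by blast+

lemma a_dom: "(\<And>x. x \<in> D \<Longrightarrow> inner (a x) y = inner x z) \<Longrightarrow> y \<in> D"
  using psa unfolding pos_selfadj_def by blast

lemma dense_eq: "u = v" if "\<And>z. z \<in> D \<Longrightarrow> inner z u = inner z v" for u v
proof -
  have "u - v \<in> closure D" using clD by simp
  then obtain w where w: "\<And>n. w n \<in> D" "w \<longlonglongrightarrow> u - v" unfolding closure_sequential by blast
  have "(\<lambda>n. inner (w n) (u - v)) \<longlonglongrightarrow> inner (u - v) (u - v)" by (intro tendsto_intros w)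
  moreover have "inner (w n) (u - v) = 0" for n using that[OF w(1)] by (simp add: inner_simps)
  ultimately have "inner (u - v) (u - v) = 0" using LIMSEQ_unique[OF _ tendsto_const] by fastforce
  then show ?thesis by simp
qed

lemma shift_lower:
  assumes "x \<in> D" "0 < l" shows "l * norm x \<le> norm (l *\<^sub>R x + a x)"
proof (cases "x = 0")
  case False
  have "l * (norm x)\<^sup>2 \<le> inner (l *\<^sub>R x + a x) x"
    using a_pos[OF assms(1)] by (simp add: inner_simps power2_norm_eq_inner)
  also have "\<dots> \<le> norm (l *\<^sub>R x + a x) * norm x" by (rule norm_cauchy_schwarz)
  finally show ?thesis using False by (simp add: power2_eq_square)
qed simp

lemma shift_linear:
  assumes "x \<in> D" "y \<in> D"
  shows "l *\<^sub>R (x - y) + a (x - y) = (l *\<^sub>R x + a x) - (l *\<^sub>R y + a y)"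
proof -
  have "a (x + (-1) *\<^sub>R y) = a x - a y"
    using a_add[OF assms(1) subspace_scale[OF subD assms(2)], of "-1"] a_scale[OF assms(2), of "-1"] by simp
  then show ?thesis by (simp add: algebra_simps)
qed

text \<open>The range of l + a is closed, by the lower bound and because a limit of arguments lies
  in the domain of the adjoint, which is D. A vector w orthogonal to the range is in D for the same
  reason and satisfies a w = - l w, which positivity of a excludes unless w = 0.\<close>

lemma shift_surj:
  assumes l: "0 < l" shows "\<exists>x\<in>D. l *\<^sub>R x + a x = y"
proof -
  define G where "G x = l *\<^sub>R x + a x" for x
  have low: "l * norm (x - z) \<le> norm (G x - G z)" if "x \<in> D" "z \<in> D" for x z
    using shift_lower[OF subspace_diff[OF subD that] l] shift_linear[OF that, of l] by (simp add: G_def)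
  have subG: "subspace (G ` D)"
  proof -
    have "G 0 = 0" using a_scale[OF subspace_0[OF subD], of 0] by (simp add: G_def)
    moreover have "G x + G y = G (x + y)" if "x \<in> D" "y \<in> D" for x y
      by (simp add: G_def a_add that algebra_simps)
    moreover have "c *\<^sub>R G x = G (c *\<^sub>R x)" if "x \<in> D" for x c
      by (simp add: G_def a_scale that algebra_simps)
    ultimately show ?thesis using subD unfolding subspace_def
      by (auto simp: image_iff)
  qed
  have "closed (G ` D)"
    unfolding closed_sequential_limits
  proof (intro allI impI, elim conjE)
    fix w y assume w: "\<forall>n. w n \<in> G ` D" and lim: "w \<longlonglongrightarrow> y"
    have "\<forall>n. \<exists>v. v \<in> D \<and> w n = G v" using w by blast
    then obtain u where u: "\<And>n. u n \<in> D" "\<And>n. w n = G (u n)" by (auto dest!: choice)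
    have "Cauchy u"
    proof (rule metric_CauchyI)
      fix e :: real assume "0 < e"
      then obtain N where N: "\<And>m n. m \<ge> N \<Longrightarrow> n \<ge> N \<Longrightarrow> dist (w m) (w n) < l * e"
        using metric_CauchyD[OF LIMSEQ_imp_Cauchy[OF lim], of "l * e"] l by auto
      have "dist (u m) (u n) < e" if "m \<ge> N" "n \<ge> N" for m n
      proof -
        have "l * norm (u m - u n) < l * e"
          using low[OF u(1)[of m] u(1)[of n]] N[OF that] by (simp add: u(2) dist_norm)
        then show ?thesis using l by (simp add: dist_norm)
      qed
      then show "\<exists>N. \<forall>m\<ge>N. \<forall>n\<ge>N. dist (u m) (u n) < e" by blast
    qed
    then obtain x where x: "u \<longlonglongrightarrow> x" using Cauchy_convergent convergent_def by blast
    have au: "(\<lambda>n. a (u n)) \<longlonglongrightarrow> y - l *\<^sub>R x"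
    proof -
      have "(\<lambda>n. w n - l *\<^sub>R u n) \<longlonglongrightarrow> y - l *\<^sub>R x" by (intro tendsto_intros lim x)
      then show ?thesis by (simp add: u(2) G_def)
    qed
    have *: "inner (a z) x = inner z (y - l *\<^sub>R x)" if "z \<in> D" for z
    proof -
      have "(\<lambda>n. inner (a z) (u n)) \<longlonglongrightarrow> inner (a z) x" by (intro tendsto_intros x)
      moreover have "(\<lambda>n. inner (a z) (u n)) \<longlonglongrightarrow> inner z (y - l *\<^sub>R x)"
        unfolding a_sym[OF that u(1)] by (intro tendsto_intros au)
      ultimately show ?thesis by (rule LIMSEQ_unique)
    qed
    have xD: "x \<in> D" using a_dom[OF *] .
    have "a x = y - l *\<^sub>R x" by (rule dense_eq) (use * a_sym xD in force)
    then have "y = G x" by (simp add: G_def)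
    then show "y \<in> G ` D" using xD by blast
  qed
  then obtain u where u: "u \<in> G ` D" "\<And>z. z \<in> G ` D \<Longrightarrow> inner (y - u) z = 0"
    using closed_subspace_projection[OF subG] by blast
  define w where "w = y - u"
  have orth: "inner (G x) w = 0" if "x \<in> D" for x using u(2) that by (auto simp: w_def inner_commute)
  have wD: "w \<in> D"
  proof (rule a_dom)
    show "inner (a x) w = inner x (- l *\<^sub>R w)" if "x \<in> D" for x
      using orth[OF that] by (simp add: G_def inner_simps)
  qed
  have "l * inner w w + inner (a w) w = 0" using orth[OF wD] by (simp add: G_def inner_simps)
  then have "l * inner w w \<le> 0" using a_pos[OF wD] by simp
  then have "w = 0" using l by (metis inner_gt_zero_iff mult_pos_pos not_less)
  then show ?thesis using u(1) by (auto simp: w_def G_def)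
qed

text \<open>\<open>R l\<close> is (l + a)^(-1), and \<open>A l\<close> is the Yosida approximant of
  a, with square root \<open>s l\<close>.\<close>

abbreviation "R \<equiv> resolv D a"
abbreviation "A \<equiv> a_lam D a"
abbreviation "s l \<equiv> op_sqrt J (A l)"

lemma R_unique:
  assumes "0 < l" "x \<in> D" "l *\<^sub>R x + a x = y" shows "R l y = x"
  unfolding resolv_def
proof (rule the_equality)
  fix z assume z: "z \<in> D \<and> l *\<^sub>R z + a z = y"
  then have "l * norm (z - x) \<le> 0"
    using shift_lower[OF subspace_diff[OF subD, of z x] assms(1)] shift_linear[of z x l] assms by simp
  then have "norm (z - x) \<le> 0" using assms(1) by (metis mult_le_0_iff not_less)
  then show "z = x" by simp
qed (use assms in simp)

lemma R_eq:
  assumes "0 < l" shows "R l y \<in> D" "l *\<^sub>R R l y + a (R l y) = y"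
  using shift_surj[OF assms, of y] R_unique[OF assms] by auto

lemma A_eq: "0 < l \<Longrightarrow> A l y = l *\<^sub>R (y - l *\<^sub>R R l y)"
  unfolding a_lam_def using R_eq(2)[of l y] by (metis add_diff_cancel_left')

lemma R_linear:
  assumes l: "0 < l" shows "bounded_linear (R l)"
proof (rule bounded_linear_intro[where K = "1 / l"])
  show "R l (x + y) = R l x + R l y" for x y
  proof (rule R_unique[OF l])
    show "R l x + R l y \<in> D" using R_eq[OF l] subspace_add[OF subD] by blast
    have "l *\<^sub>R (R l x + R l y) + a (R l x + R l y) = (l *\<^sub>R R l x + a (R l x)) + (l *\<^sub>R R l y + a (R l y))"
      by (simp add: a_add R_eq(1)[OF l] algebra_simps)
    then show "l *\<^sub>R (R l x + R l y) + a (R l x + R l y) = x + y" by (simp only: R_eq(2)[OF l])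
  qed
  show "R l (c *\<^sub>R x) = c *\<^sub>R R l x" for c x
  proof (rule R_unique[OF l])
    show "c *\<^sub>R R l x \<in> D" using R_eq[OF l] subspace_scale[OF subD] by blast
    have "l *\<^sub>R (c *\<^sub>R R l x) + a (c *\<^sub>R R l x) = c *\<^sub>R (l *\<^sub>R R l x + a (R l x))"
      by (simp add: a_scale R_eq(1)[OF l] algebra_simps)
    then show "l *\<^sub>R (c *\<^sub>R R l x) + a (c *\<^sub>R R l x) = c *\<^sub>R x" by (simp only: R_eq(2)[OF l])
  qed
  show "norm (R l x) \<le> norm x * (1 / l)" for x
    using shift_lower[OF R_eq(1)[OF l, of x] l] R_eq(2)[OF l, of x] l by (simp add: field_simps)
qed

lemma R_psd:
  assumes l: "0 < l" shows "psd (R l)"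
proof (rule psdI)
  show "inner (R l x) y = inner x (R l y)" for x y
  proof -
    have "inner (R l x) (l *\<^sub>R R l y + a (R l y)) = inner (l *\<^sub>R R l x + a (R l x)) (R l y)"
      using a_sym[OF R_eq(1)[OF l] R_eq(1)[OF l], of x y] by (simp add: inner_add_left inner_add_right)
    then show ?thesis by (simp only: R_eq(2)[OF l])
  qed
  show "0 \<le> inner (R l x) x" for x
  proof -
    have "0 \<le> inner (R l x) (l *\<^sub>R R l x + a (R l x))"
      using a_pos[OF R_eq(1)[OF l], of x] l by (simp add: inner_add_right inner_commute)
    then show ?thesis by (simp only: R_eq(2)[OF l])
  qed
qed (rule R_linear[OF l])

text \<open>Affiliation is invariance of D and a under the unitaries U of the commutant, so U
  \<open>R l\<close> x solves the equation that defines \<open>R l\<close> (U x).\<close>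

lemma R_in_M:
  assumes l: "0 < l" shows "R l \<in> M"
proof (rule vNa_mem_if_commutes_unitaries[OF vN R_linear[OF l]])
  fix U x assume U: "U \<in> commutant J M" "unitary_op J U"
  interpret U: bounded_linear U using U by (simp add: commutant_iff bop_def)
  have UD: "U ` D = D" "\<And>x. x \<in> D \<Longrightarrow> U (a x) = a (U x)" using aff U by (auto simp: affiliated_def)
  show "R l (U x) = U (R l x)"
  proof (rule R_unique[OF l])
    show "U (R l x) \<in> D" using UD(1) R_eq(1)[OF l] by blast
    have "l *\<^sub>R U (R l x) + a (U (R l x)) = U (l *\<^sub>R R l x + a (R l x))"
      by (simp add: U.add U.scaleR UD(2) R_eq(1)[OF l])
    then show "l *\<^sub>R U (R l x) + a (U (R l x)) = U x" by (simp only: R_eq(2)[OF l])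
  qed
qed

lemma resolvent_identity:
  assumes l: "0 < l" and m: "0 < m" shows "R l y - R m y = (m - l) *\<^sub>R R l (R m y)"
proof -
  interpret R: bounded_linear "R l" using R_linear[OF l] .
  let ?x = "R m y"
  \<comment> \<open>Writing y through (l + a) \<open>R m\<close> y prepares the cancellation against
    \<open>R l\<close>.\<close>
  have "y = (m - l) *\<^sub>R ?x + (l *\<^sub>R ?x + a ?x)"
    using R_eq(2)[OF m, of y] by (simp add: algebra_simps)
  then have "R l y = (m - l) *\<^sub>R R l ?x + R l (l *\<^sub>R ?x + a ?x)"
    by (metis R.add R.scaleR)
  also have "R l (l *\<^sub>R ?x + a ?x) = ?x" using R_unique[OF l R_eq(1)[OF m]] by simp
  finally show ?thesis by simp
qed

lemma R_commute:
  assumes l: "0 < l" and m: "0 < m" shows "R l (R m y) = R m (R l y)"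
proof (cases "l = m")
  case False
  have "(m - l) *\<^sub>R R l (R m y) = (m - l) *\<^sub>R R m (R l y)"
    using resolvent_identity[OF l m, of y] resolvent_identity[OF m l, of y]
    by (metis minus_diff_eq scaleR_minus_left)
  then show ?thesis using False by simp
qed simp

end

section \<open>The cutoffs of the affiliated operator\<close>

context affiliated_operator
begin

lemma M_eq: "commutant J (commutant J M) = M"
  using vN by (simp add: vNa_def)

text \<open>M is the commutant of its commutant, so the closure properties of commutants become
  closure properties of M.\<close>

sublocale N: bop_set J "commutant J M"
  using bop_set.commutant_bop_set[OF vNa_bop_set[OF vN]] .

lemmas M_id = N.id_in[unfolded M_eq] and M_J = N.J_in[unfolded M_eq] and M_add = N.add_in[unfolded M_eq]
  and M_diff = N.diff_in[unfolded M_eq] and M_scale = N.scale_in[unfolded M_eq]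
  and M_comp = N.comp_in[unfolded M_eq] and M_adjoint = N.adjoint_in[unfolded M_eq]
  and M_sqrt = N.op_sqrt_in[unfolded M_eq]

lemma M_bop: "T \<in> M \<Longrightarrow> bop J T"
  using vN by (auto simp: vNa_def)

lemma M_linear: "T \<in> M \<Longrightarrow> bounded_linear T"
  using M_bop by (auto simp: bop_def)

lemma M_commute_J: "T \<in> M \<Longrightarrow> T (J x) = J (T x)"
  using M_bop by (auto simp: bop_def)

text \<open>This is a (l + a)^(-1), expressed without the unbounded a.\<close>

definition C :: "real \<Rightarrow> 'h \<Rightarrow> 'h" where "C l x = x - l *\<^sub>R R l x"

lemma A_C: "0 < l \<Longrightarrow> A l x = l *\<^sub>R C l x"
  by (simp add: A_eq C_def)

lemma A_fun: "0 < l \<Longrightarrow> A l = (\<lambda>x. l *\<^sub>R C l x)"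
  by (simp add: A_C fun_eq_iff)

lemma C_in: "0 < l \<Longrightarrow> C l \<in> M"
  unfolding C_def using M_diff[OF M_id M_scale[OF R_in_M]] .

lemma A_in: "0 < l \<Longrightarrow> A l \<in> M"
  using M_scale[OF C_in, of l l] by (simp add: A_fun)

lemma C_psd:
  assumes l: "0 < l" shows "psd (C l)"
proof (rule psdI)
  show "bounded_linear (C l)" using M_linear[OF C_in[OF l]] .
  show "inner (C l x) y = inner x (C l y)" for x y
    by (simp add: C_def inner_diff_left inner_diff_right psdD(2)[OF R_psd[OF l]])
  show "0 \<le> inner (C l x) x" for x
  proof -
    have "l * norm (R l x) \<le> norm x"
      using shift_lower[OF R_eq(1)[OF l, of x] l] R_eq(2)[OF l, of x] by simp
    then have "l * norm (R l x) * norm x \<le> norm x * norm x" by (rule mult_right_mono) simp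
    moreover have "l * inner (R l x) x \<le> l * (norm (R l x) * norm x)"
      using l norm_cauchy_schwarz by (intro mult_left_mono) auto
    ultimately show ?thesis
      by (simp add: C_def inner_diff_left mult.assoc power2_eq_square flip: power2_norm_eq_inner)
  qed
qed

lemma A_psd: "0 < l \<Longrightarrow> psd (A l)"
  using psd_scaleR[OF C_psd, of l l] by (simp add: A_fun)

lemma A_bop: "0 < l \<Longrightarrow> bop J (A l)"
  using A_in M_bop by blast

lemma s_psd: "0 < l \<Longrightarrow> psd (s l)" and s_sq: "0 < l \<Longrightarrow> s l (s l x) = A l x"
  and s_commute: "0 < l \<Longrightarrow> bounded_linear T \<Longrightarrow> (\<And>x. T (A l x) = A l (T x)) \<Longrightarrow> T (s l x) = s l (T x)"
  using op_sqrt_psd[OF J.bounded_linear_axioms A_bop A_psd] by blast+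

lemma s_in: "0 < l \<Longrightarrow> s l \<in> M"
  using M_sqrt A_in A_psd by blast

text \<open>\<open>A l\<close> is affine in \<open>R l\<close>, and the root commutes with whatever
  commutes with \<open>A l\<close>.\<close>

lemma s_commute_R:
  assumes "0 < l" "bounded_linear T" "\<And>x. T (R l x) = R l (T x)"
  shows "T (s l x) = s l (T x)"
proof -
  interpret T: bounded_linear T by fact
  show ?thesis by (rule s_commute[OF assms(1,2)]) (simp add: A_eq assms(1) T.diff T.scaleR assms(3))
qed

lemma s_R: "0 < l \<Longrightarrow> 0 < m \<Longrightarrow> R l (s m x) = s m (R l x)"
  using s_commute_R[of m "R l"] R_linear R_commute by blast

lemma s_s: "0 < l \<Longrightarrow> 0 < m \<Longrightarrow> s l (s m x) = s m (s l x)"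
  by (rule s_commute_R[of m "s l"]) (simp_all add: s_R M_linear[OF s_in])

lemma R_C:
  assumes l: "0 < l" and m: "0 < m" shows "R l (C m x) = C m (R l x)"
proof -
  interpret R: bounded_linear "R l" using R_linear[OF l] .
  show ?thesis by (simp add: C_def R.diff R.scaleR R_commute[OF l m])
qed

lemma C_C_commute:
  assumes l: "0 < l" and m: "0 < m" shows "C l (C m x) = C m (C l x)"
proof -
  interpret C: bounded_linear "C m" using M_linear[OF C_in[OF m]] .
  show ?thesis by (simp add: C_def[of l] C.diff C.scaleR R_C[OF l m])
qed

text \<open>Both sides are a (k + a)^(-1) (e + a)^(-1): the factor a may be attached to either
  resolvent.\<close>

lemma C_R_swap:
  assumes k: "0 < k" and e: "0 < e" shows "C k (R e x) = R k (C e x)"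
proof -
  interpret R: bounded_linear "R k" using R_linear[OF k] .
  have "R e x - R k x = k *\<^sub>R R k (R e x) - e *\<^sub>R R k (R e x)"
    using resolvent_identity[OF k e, of x] by (simp add: algebra_simps)
  then show ?thesis by (simp add: C_def R.diff R.scaleR algebra_simps)
qed

text \<open>In scalars, k t / (k + t) - m t / (m + t) = (k - m) t^2 / ((k + t) (m + t)).
  Monotonicity of the approximants is read off from this product.\<close>

lemma A_diff:
  assumes k: "0 < k" and m: "0 < m" shows "A k x - A m x = (k - m) *\<^sub>R C k (C m x)"
proof -
  interpret R: bounded_linear "R k" using R_linear[OF k] .
  have h: "(k - m) *\<^sub>R R k (R m x) = R m x - R k x"
    using resolvent_identity[OF k m, of x] by (simp add: algebra_simps)
  have "(k - m) *\<^sub>R C k (C m x) = (k - m) *\<^sub>R (x - m *\<^sub>R R m x - k *\<^sub>R R k x) + (k * m) *\<^sub>R ((k - m) *\<^sub>R R k (R m x))"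
    by (simp add: C_def R.diff R.scaleR algebra_simps)
  also have "\<dots> = A k x - A m x" unfolding h by (simp add: A_eq k m algebra_simps)
  finally show ?thesis by simp
qed

lemma A_mono:
  assumes m: "0 < m" and km: "m \<le> k" shows "psd (\<lambda>x. A k x - A m x)"
proof -
  have k: "0 < k" using assms by simp
  show ?thesis unfolding A_diff[OF k m]
    by (rule psd_scaleR[OF psd_compose[OF C_psd[OF k] C_psd[OF m] C_C_commute[OF k m]]]) (use km in simp)
qed

lemma s_mono:
  assumes m: "0 < m" and km: "m \<le> k" shows "psd (\<lambda>x. s k x - s m x)"
proof -
  have k: "0 < k" using assms by simp
  have "psd (\<lambda>x. s k (s k x) - s m (s m x))" using A_mono[OF m km] by (simp only: s_sq[OF k] s_sq[OF m])
  then show ?thesis by (rule psd_sqrt_mono[OF s_psd[OF k] s_psd[OF m] s_s[OF k m]])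
qed

text \<open>With a_l(t) = l t / (l + t), this is the function sqrt (a_m(t) a_n(t)) / (e + t) of a.
  It takes values between 0 and 1 and tends to 1 for t > 0 when m and n grow and e tends to
  0.\<close>

definition K :: "real \<Rightarrow> real \<Rightarrow> real \<Rightarrow> 'h \<Rightarrow> 'h" where "K e m n x = R e (s m (s n x))"

lemma K_in: "0 < e \<Longrightarrow> 0 < m \<Longrightarrow> 0 < n \<Longrightarrow> K e m n \<in> M"
  unfolding K_def using M_comp[OF R_in_M M_comp[OF s_in s_in]] by simp

lemma A_commute:
  assumes "0 < l" "bounded_linear T" "\<And>x. T (R l x) = R l (T x)"
  shows "T (A l x) = A l (T x)"
proof -
  interpret T: bounded_linear T by fact
  show ?thesis by (simp add: A_eq assms T.diff T.scaleR)
qed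

lemma K_commute:
  assumes "0 < e" "0 < m" "0 < n" "bounded_linear T" "\<And>l x. 0 < l \<Longrightarrow> T (R l x) = R l (T x)"
  shows "T (K e m n x) = K e m n (T x)"
  unfolding K_def assms(5)[OF assms(1)] s_commute_R[OF assms(2,4) assms(5)[OF assms(2)]]
    s_commute_R[OF assms(3,4) assms(5)[OF assms(3)]] ..

section \<open>Order estimates for the cutoff operator\<close>

context
  fixes e m n :: real
  assumes e: "0 < e" and m: "0 < m" and mn: "m \<le> n"
begin

lemma n: "0 < n" using m mn by simp

interpretation Re: bounded_linear "R e" using R_linear[OF e] .
interpretation sm: bounded_linear "s m" using M_linear[OF s_in[OF m]] .
interpretation sn: bounded_linear "s n" using M_linear[OF s_in[OF n]] .
interpretation Rm: bounded_linear "R m" using R_linear[OF m] .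
interpretation Rn: bounded_linear "R n" using R_linear[OF n] .
interpretation K: bounded_linear "K e m n" using M_linear[OF K_in[OF e m n]] .

lemma K_psd: "psd (K e m n)"
  unfolding K_def
  by (rule psd_compose[OF R_psd[OF e] psd_compose[OF s_psd[OF m] s_psd[OF n] s_s[OF m n]]])
    (simp only: s_R[OF e m] s_R[OF e n])

lemma RsD_psd:
  assumes l: "0 < l" shows "psd (\<lambda>x. R e (s l (s n x - s m x)))"
proof -
  interpret sl: bounded_linear "s l" using M_linear[OF s_in[OF l]] .
  have "psd (\<lambda>x. s l (s n x - s m x))"
    by (rule psd_compose[OF s_psd[OF l] s_mono[OF m mn]]) (simp only: sl.diff s_s[OF l m] s_s[OF l n])
  then show ?thesis
    by (rule psd_compose[OF R_psd[OF e]]) (simp only: s_R[OF e l] s_R[OF e m] s_R[OF e n] Re.diff)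
qed

text \<open>In scalars, 1 - l t / ((l + t) (e + t)) = t / (l + t) + l e / ((l + t) (e + t)), a sum
  of nonnegative terms.\<close>

lemma id_minus_RA:
  assumes l: "0 < l" shows "x - R e (A l x) = C l x + l *\<^sub>R R l (e *\<^sub>R R e x)"
proof -
  interpret Rl: bounded_linear "R l" using R_linear[OF l] .
  have "R e (A l x) = l *\<^sub>R R l (C e x)"
    by (simp add: A_C l Re.scaleR R_C[OF e l] C_R_swap[OF l e])
  then show ?thesis by (simp add: C_def[of e] C_def[of l] Rl.diff algebra_simps)
qed

lemma id_minus_K_psd: "psd (\<lambda>x. x - K e m n x)"
proof -
  \<comment> \<open>K is compared with \<open>R e\<close> \<open>A n\<close> by replacing
    \<open>s m\<close> with the larger \<open>s n\<close>; both differences that appear are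
    positive.\<close>
  have eq: "x - K e m n x = (C n x + n *\<^sub>R R n (e *\<^sub>R R e x)) + R e (s n (s n x - s m x))" for x
    unfolding id_minus_RA[OF n, symmetric]
    by (simp add: K_def sn.diff s_sq[OF n] Re.diff s_s[OF m n])
  have "psd (\<lambda>x. (n * e) *\<^sub>R R n (R e x))"
    by (rule psd_scaleR[OF psd_compose[OF R_psd[OF n] R_psd[OF e] R_commute[OF n e]]]) (use n e in simp)
  then have "psd (\<lambda>x. n *\<^sub>R R n (e *\<^sub>R R e x))" by (simp add: Rn.scaleR)
  then show ?thesis unfolding eq by (intro psd_add C_psd n RsD_psd)
qed

text \<open>The last term is c \<open>A k\<close> c for c = 1 - K. It is at most \<open>A k\<close>
  c because 0 \<le> K \<le> 1, and c \<le> 1 - \<open>R e\<close> \<open>A m\<close> because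
  \<open>s m\<close> \<le> \<open>s n\<close>. By \<open>id_minus_RA\<close>, \<open>A k\<close> (1
  - \<open>R e\<close> \<open>A m\<close>) splits into \<open>A k\<close> \<open>C m\<close>, a
  multiple of \<open>A k\<close> - \<open>A m\<close>, and e times a product of
  contractions.\<close>

lemma cutoff_error_psd:
  assumes mk: "m < k"
  shows "psd (\<lambda>x. (k / (k - m)) *\<^sub>R (A k x - A m x) + e *\<^sub>R x
      - (A k (x - K e m n x) - K e m n (A k (x - K e m n x))))"
proof -
  have k: "0 < k" using m mk by simp
  interpret Ak: bounded_linear "A k" using M_linear[OF A_in[OF k]] .
  interpret Rk: bounded_linear "R k" using R_linear[OF k] .
  interpret Ck: bounded_linear "C k" using M_linear[OF C_in[OF k]] .
  have AK: "A k (K e m n x) = K e m n (A k x)" for x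
    by (rule K_commute[OF e m n Ak.bounded_linear_axioms])
      (rule A_commute[OF k R_linear R_commute[OF _ k], symmetric])
  \<comment> \<open>\<open>A_diff\<close> expresses \<open>C k\<close> \<open>C m\<close> through
    \<open>A k\<close> - \<open>A m\<close>; this is the origin of the factor k / (k - m) and of the
    condition m < k.\<close>
  have 1: "A k (C m x) = (k / (k - m)) *\<^sub>R (A k x - A m x)" for x
    using mk unfolding A_diff[OF k m] by (simp add: A_C[OF k])
  \<comment> \<open>Here K is compared with \<open>R e\<close> \<open>A m\<close>, which is smaller
    than K.\<close>
  have 2: "x - K e m n x = C m x + m *\<^sub>R R m (e *\<^sub>R R e x) - R e (s m (s n x - s m x))" for x
    unfolding id_minus_RA[OF m, symmetric]
    by (simp add: K_def sm.diff s_sq[OF m] Re.diff)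
  have 3: "A k (m *\<^sub>R R m (e *\<^sub>R R e x)) = e *\<^sub>R (m *\<^sub>R R m (k *\<^sub>R R k (C e x)))" for x
    by (simp add: A_C[OF k] Rm.scaleR Ck.scaleR R_C[OF m k, symmetric] C_R_swap[OF k e] mult_ac)
  \<comment> \<open>Telescoping 1 - P Q S = (1 - P) + P (1 - Q) + P Q (1 - S) with P = m
    \<open>R m\<close>, Q = k \<open>R k\<close>, S = \<open>C e\<close>; every summand is positive,
    since 1 - \<open>C e\<close> = e \<open>R e\<close>.\<close>
  have 4: "x - m *\<^sub>R R m (k *\<^sub>R R k (C e x)) = C m x + m *\<^sub>R R m (C k x) + m *\<^sub>R R m (k *\<^sub>R R k (e *\<^sub>R R e x))" for x
    by (simp add: C_def Rm.diff Rk.diff Rk.scaleR Rm.scaleR algebra_simps)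
  have eq: "(k / (k - m)) *\<^sub>R (A k x - A m x) + e *\<^sub>R x
      - (A k (x - K e m n x) - K e m n (A k (x - K e m n x)))
    = e *\<^sub>R (C m x + m *\<^sub>R R m (C k x) + m *\<^sub>R R m (k *\<^sub>R R k (e *\<^sub>R R e x)))
      + A k (R e (s m (s n x - s m x))) + A k (K e m n (x - K e m n x))" (is "?L = ?R") for x
  proof -
    have "A k (x - K e m n x) = (k / (k - m)) *\<^sub>R (A k x - A m x)
        + e *\<^sub>R (m *\<^sub>R R m (k *\<^sub>R R k (C e x))) - A k (R e (s m (s n x - s m x)))"
      unfolding 2 by (simp only: Ak.add Ak.diff 1 3)
    then have "?L = e *\<^sub>R (x - m *\<^sub>R R m (k *\<^sub>R R k (C e x))) + A k (R e (s m (s n x - s m x)))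
        + K e m n (A k (x - K e m n x))"
      by (simp add: algebra_simps)
    then show ?thesis unfolding 4 AK .
  qed
  have p1: "psd (\<lambda>x. m *\<^sub>R R m (C k x))"
    by (rule psd_scaleR[OF psd_compose[OF R_psd[OF m] C_psd[OF k] R_C[OF m k]]]) (use m in simp)
  have p2: "psd (\<lambda>x. m *\<^sub>R R m (k *\<^sub>R R k (e *\<^sub>R R e x)))"
  proof -
    have "psd (\<lambda>x. R k (R e x))" by (rule psd_compose[OF R_psd[OF k] R_psd[OF e] R_commute[OF k e]])
    then have "psd (\<lambda>x. R m (R k (R e x)))"
      by (rule psd_compose[OF R_psd[OF m]]) (simp only: R_commute[OF m k] R_commute[OF m e])
    then have "psd (\<lambda>x. (m * k * e) *\<^sub>R R m (R k (R e x)))"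
      by (rule psd_scaleR) (use m k e in simp)
    then show ?thesis by (simp add: Rm.scaleR Rk.scaleR mult.assoc)
  qed
  have AR: "R l (A k x) = A k (R l x)" if "0 < l" for l x
    using A_commute[OF k R_linear[OF that]] R_commute[OF that k] by blast
  have As: "s l (A k x) = A k (s l x)" if "0 < l" for l x
    by (rule A_commute[OF k M_linear[OF s_in[OF that]]]) (rule s_R[OF k that, symmetric])
  have p3: "psd (\<lambda>x. A k (R e (s m (s n x - s m x))))"
    by (rule psd_compose[OF A_psd[OF k] RsD_psd[OF m]]) (simp only: As[OF m] As[OF n] Ak.diff[symmetric] AR[OF e])
  have p4: "psd (\<lambda>x. A k (K e m n (x - K e m n x)))"
  proof -
    have "psd (\<lambda>x. K e m n (x - K e m n x))"
      by (rule psd_compose[OF K_psd id_minus_K_psd]) (simp add: K.diff)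
    then show ?thesis
      by (rule psd_compose[OF A_psd[OF k]]) (simp only: AK Ak.diff)
  qed
  show ?thesis unfolding eq
    by (intro psd_add p3 p4 psd_scaleR p1 p2 C_psd m) (use e in simp)
qed

end

end

section \<open>Normal functionals\<close>

lemma Re_cinner: "Re (cinner J x y) = inner x y"
  by (simp add: cinner_def)

lemma cinner_add_left: "cinner J (x + y) z = cinner J x z + cinner J y z"
  by (simp add: cinner_def inner_add_left complex_eq_iff)

lemma cinner_scaleR_left: "cinner J (c *\<^sub>R x) z = of_real c * cinner J x z"
  by (simp add: cinner_def complex_eq_iff)

lemma norm_cinner_le:
  assumes "cstruct J" shows "norm (cinner J x y) \<le> (norm x)\<^sup>2 + (norm y)\<^sup>2"
proof -
  have "norm (cinner J x y) \<le> \<bar>inner x y\<bar> + \<bar>inner x (J y)\<bar>"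
    using cmod_le[of "cinner J x y"] by (simp add: cinner_def)
  also have "\<dots> \<le> norm x * norm y + norm x * norm y"
    using Cauchy_Schwarz_ineq2[of x y] Cauchy_Schwarz_ineq2[of x "J y"] by (simp add: cstructD(5)[OF assms])
  also have "\<dots> \<le> (norm x)\<^sup>2 + (norm y)\<^sup>2"
    using sum_squares_bound[of "norm x" "norm y"] by simp
  finally show ?thesis .
qed

lemma summable_norm_image:
  fixes T :: "'h::real_normed_vector \<Rightarrow> 'h"
  assumes "bounded_linear T" "summable (\<lambda>n. (norm (\<xi> n))\<^sup>2)"
  shows "summable (\<lambda>n. (norm (T (\<xi> n)))\<^sup>2)"
proof -
  obtain K where K: "\<And>x. norm (T x) \<le> norm x * K" using bounded_linear.bounded[OF assms(1)] by blast
  show ?thesis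
  proof (rule summable_comparison_test)
    have "(norm (T (\<xi> n)))\<^sup>2 \<le> (norm (\<xi> n) * K)\<^sup>2" for n using K by (intro power_mono) auto
    then show "\<exists>N. \<forall>n\<ge>N. norm ((norm (T (\<xi> n)))\<^sup>2) \<le> K\<^sup>2 * (norm (\<xi> n))\<^sup>2"
      by (simp add: power_mult_distrib mult.commute)
    show "summable (\<lambda>n. K\<^sup>2 * (norm (\<xi> n))\<^sup>2)" using assms(2) by (rule summable_mult)
  qed
qed

lemma summable_cinner:
  fixes T :: "'h::real_inner \<Rightarrow> 'h"
  assumes J: "cstruct J" and T: "bounded_linear T"
    and s: "summable (\<lambda>n. (norm (\<xi> n))\<^sup>2)" "summable (\<lambda>n. (norm (\<eta> n))\<^sup>2)"
  shows "summable (\<lambda>n. cinner J (T (\<xi> n)) (\<eta> n))"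
proof (rule summable_comparison_test)
  show "\<exists>N. \<forall>n\<ge>N. norm (cinner J (T (\<xi> n)) (\<eta> n)) \<le> (norm (T (\<xi> n)))\<^sup>2 + (norm (\<eta> n))\<^sup>2"
    using norm_cinner_le[OF J] by blast
  show "summable (\<lambda>n. (norm (T (\<xi> n)))\<^sup>2 + (norm (\<eta> n))\<^sup>2)"
    by (intro summable_add summable_norm_image[OF T] s)
qed

lemma sums_interleave_real:
  fixes f g :: "nat \<Rightarrow> real"
  assumes "f sums x" "g sums y"
  shows "(\<lambda>n. if even n then f (n div 2) else g (n div 2)) sums (x + y)"
proof -
  have "(\<lambda>n. if even n then f (n div 2) else g ((n - 1) div 2)) = (\<lambda>n. if even n then f (n div 2) else g (n div 2))"
    by (auto simp: fun_eq_iff elim!: oddE)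
  then show ?thesis using sums_if[OF assms(2,1)] by (simp add: add.commute)
qed

lemma sums_interleave_complex:
  fixes f g :: "nat \<Rightarrow> complex"
  assumes "f sums x" "g sums y"
  shows "(\<lambda>n. if even n then f (n div 2) else g (n div 2)) sums (x + y)"
  using assms sums_interleave_real[of "\<lambda>n. Re (f n)" "Re x" "\<lambda>n. Re (g n)" "Re y"]
    sums_interleave_real[of "\<lambda>n. Im (f n)" "Im x" "\<lambda>n. Im (g n)" "Im y"]
  by (simp add: sums_complex_iff if_distrib[of Re] if_distrib[of Im] cong: if_cong)

text \<open>A normal functional is given by one pair of sequences, so the two representing pairs are
  interleaved along even and odd indices.\<close>

lemma normal_fun_add:
  assumes J: "cstruct J" and M: "M \<subseteq> Collect (bop J)" and "normal_fun J M \<psi>" "normal_fun J M \<rho>"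
  shows "normal_fun J M (\<lambda>x. \<psi> x + \<rho> x)"
proof -
  obtain \<xi> \<eta> where 1: "summable (\<lambda>n. (norm (\<xi> n))\<^sup>2)" "summable (\<lambda>n. (norm (\<eta> n))\<^sup>2)"
    "\<And>x. x \<in> M \<Longrightarrow> \<psi> x = (\<Sum>n. cinner J (x (\<xi> n)) (\<eta> n))" using assms(3) by (auto simp: normal_fun_def)
  obtain \<xi>' \<eta>' where 2: "summable (\<lambda>n. (norm (\<xi>' n))\<^sup>2)" "summable (\<lambda>n. (norm (\<eta>' n))\<^sup>2)"
    "\<And>x. x \<in> M \<Longrightarrow> \<rho> x = (\<Sum>n. cinner J (x (\<xi>' n)) (\<eta>' n))" using assms(4) by (auto simp: normal_fun_def)
  define u where "u n = (if even n then \<xi> (n div 2) else \<xi>' (n div 2))" for n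
  define v where "v n = (if even n then \<eta> (n div 2) else \<eta>' (n div 2))" for n
  have "summable (\<lambda>n. (norm (u n))\<^sup>2)"
    using sums_summable[OF sums_interleave_real[OF summable_sums[OF 1(1)] summable_sums[OF 2(1)]]]
    by (simp add: u_def if_distrib[of "\<lambda>z. (norm z)\<^sup>2"] cong: if_cong)
  moreover have "summable (\<lambda>n. (norm (v n))\<^sup>2)"
    using sums_summable[OF sums_interleave_real[OF summable_sums[OF 1(2)] summable_sums[OF 2(2)]]]
    by (simp add: v_def if_distrib[of "\<lambda>z. (norm z)\<^sup>2"] cong: if_cong)
  moreover have "\<psi> x + \<rho> x = (\<Sum>n. cinner J (x (u n)) (v n))" if x: "x \<in> M" for x
  proof -
    have lin: "bounded_linear x" using x M by (auto simp: bop_def)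
    have "(\<lambda>n. cinner J (x (u n)) (v n)) =
        (\<lambda>n. if even n then cinner J (x (\<xi> (n div 2))) (\<eta> (n div 2)) else cinner J (x (\<xi>' (n div 2))) (\<eta>' (n div 2)))"
      by (auto simp: u_def v_def)
    then have "(\<lambda>n. cinner J (x (u n)) (v n)) sums (\<psi> x + \<rho> x)"
      using sums_interleave_complex[OF summable_sums[OF summable_cinner[OF J lin 1(1,2)]]
        summable_sums[OF summable_cinner[OF J lin 2(1,2)]]] 1(3)[OF x] 2(3)[OF x] by simp
    then show ?thesis by (rule sums_unique)
  qed
  ultimately show ?thesis unfolding normal_fun_def
    by (intro exI[of _ u] exI[of _ v]) simp
qed

lemma normal_fun_scale:
  assumes J: "cstruct J" and M: "M \<subseteq> Collect (bop J)" and "normal_fun J M \<psi>"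
  shows "normal_fun J M (\<lambda>x. of_real c * \<psi> x)"
proof -
  obtain \<xi> \<eta> where 1: "summable (\<lambda>n. (norm (\<xi> n))\<^sup>2)" "summable (\<lambda>n. (norm (\<eta> n))\<^sup>2)"
    "\<And>x. x \<in> M \<Longrightarrow> \<psi> x = (\<Sum>n. cinner J (x (\<xi> n)) (\<eta> n))" using assms(3) by (auto simp: normal_fun_def)
  have "summable (\<lambda>n. (norm (c *\<^sub>R \<xi> n))\<^sup>2)"
    using summable_mult[OF 1(1), of "c\<^sup>2"] by (simp add: power_mult_distrib)
  moreover have "of_real c * \<psi> x = (\<Sum>n. cinner J (x (c *\<^sub>R \<xi> n)) (\<eta> n))" if x: "x \<in> M" for x
  proof -
    have lin: "bounded_linear x" using x M by (auto simp: bop_def)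
    show ?thesis using suminf_mult[OF summable_cinner[OF J lin 1(1,2)], of "of_real c"] 1(3)[OF x]
      by (simp add: bounded_linear.linear[OF lin] linear_scale cinner_scaleR_left)
  qed
  ultimately show ?thesis using 1(2) unfolding normal_fun_def
    by (intro exI[of _ "\<lambda>n. c *\<^sub>R \<xi> n"] exI[of _ \<eta>]) simp
qed

section \<open>Linearity and Cauchy-Schwarz inequalities for positive normal functionals on
  M\<close>

context affiliated_operator
begin

lemma M_sub: "M \<subseteq> Collect (bop J)" using M_bop by auto

lemma cinner_J_left: "cinner J (J x) y = \<i> * cinner J x y"
  by (simp add: cinner_def complex_eq_iff cstructD[OF cs])

lemma cinner_commute: "cinner J y x = cnj (cinner J x y)"
  using cstructD(4)[OF cs, of x y] by (simp add: cinner_def complex_eq_iff inner_commute)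

lemma normal_fun_linear:
  assumes "normal_fun J M \<psi>" "x \<in> M" "y \<in> M"
  shows "\<psi> (\<lambda>v. x v + y v) = \<psi> x + \<psi> y" "\<psi> (\<lambda>v. c *\<^sub>R x v) = of_real c * \<psi> x"
    "\<psi> (\<lambda>v. J (x v)) = \<i> * \<psi> x" "\<psi> (\<lambda>v. x v - y v) = \<psi> x - \<psi> y"
proof -
  obtain \<xi> \<eta> where 1: "summable (\<lambda>n. (norm (\<xi> n))\<^sup>2)" "summable (\<lambda>n. (norm (\<eta> n))\<^sup>2)"
    "\<And>x. x \<in> M \<Longrightarrow> \<psi> x = (\<Sum>n. cinner J (x (\<xi> n)) (\<eta> n))" using assms(1) by (auto simp: normal_fun_def)
  note sm = summable_cinner[OF cs M_linear 1(1,2)]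
  have add: "\<psi> (\<lambda>v. x v + y v) = \<psi> x + \<psi> y" if "x \<in> M" "y \<in> M" for x y
    using suminf_add[OF sm[OF that(1)] sm[OF that(2)]] by (simp add: 1(3) M_add that cinner_add_left)
  have scale: "\<psi> (\<lambda>v. c *\<^sub>R x v) = of_real c * \<psi> x" if "x \<in> M" for x c
    using suminf_mult[OF sm[OF that], of "of_real c"] by (simp add: 1(3) M_scale that cinner_scaleR_left)
  show "\<psi> (\<lambda>v. x v + y v) = \<psi> x + \<psi> y" "\<psi> (\<lambda>v. c *\<^sub>R x v) = of_real c * \<psi> x"
    using add scale assms by blast+
  show "\<psi> (\<lambda>v. J (x v)) = \<i> * \<psi> x"
    using suminf_mult[OF sm[OF assms(2)], of "\<i>"] by (simp add: 1(3) M_comp[OF M_J] assms cinner_J_left)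
  show "\<psi> (\<lambda>v. x v - y v) = \<psi> x - \<psi> y"
    using add[OF assms(2) M_scale[OF assms(3), of "-1"]] scale[OF assms(3), of "-1"] by simp
qed

lemma normal_posD:
  assumes "normal_pos J M \<psi>" "x \<in> M" "psd x"
  shows "0 \<le> Re (\<psi> x)" "Im (\<psi> x) = 0"
  using assms M_bop by (auto simp: normal_pos_def pos_op_iff_psd)

lemma normal_pos_fun: "normal_pos J M \<psi> \<Longrightarrow> normal_fun J M \<psi>"
  by (simp add: normal_pos_def)

lemma normal_pos_mono:
  assumes p: "normal_pos J M \<psi>" and xy: "x \<in> M" "y \<in> M" "psd (\<lambda>v. y v - x v)"
  shows "Re (\<psi> x) \<le> Re (\<psi> y)"
  using normal_posD(1)[OF p M_diff[OF xy(2,1)] xy(3)] normal_fun_linear(4)[OF normal_pos_fun[OF p] xy(2,1)]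
  by simp

text \<open>Positivity only speaks about positive operators; adding a bound k of x times the
  identity reaches them, and the identity has a real value.\<close>

lemma normal_pos_sa_real:
  assumes p: "normal_pos J M \<psi>" and x: "x \<in> M" and sa: "\<And>u v. inner (x u) v = inner u (x v)"
  shows "Im (\<psi> x) = 0"
proof -
  interpret x: bounded_linear x using M_linear[OF x] .
  obtain k where k: "k \<ge> 0" "\<And>v. norm (x v) \<le> norm v * k" using x.nonneg_bounded by blast
  have kin: "(\<lambda>v. k *\<^sub>R v) \<in> M" using M_scale[OF M_id] .
  have "psd (\<lambda>v. x v + k *\<^sub>R v)"
  proof (rule psdI)
    show "bounded_linear (\<lambda>v. x v + k *\<^sub>R v)" using M_linear[OF M_add[OF x kin]] .
    show "inner (x u + k *\<^sub>R u) v = inner u (x v + k *\<^sub>R v)" for u v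
      by (simp add: inner_add_left inner_add_right sa)
    show "0 \<le> inner (x u + k *\<^sub>R u) u" for u
    proof -
      have "- inner (x u) u \<le> norm (x u) * norm u"
        using Cauchy_Schwarz_ineq2[of "x u" u] by linarith
      also have "\<dots> \<le> norm u * k * norm u" using k by (intro mult_right_mono) auto
      finally show ?thesis
        by (simp add: inner_add_left power2_norm_eq_inner[symmetric] power2_eq_square mult_ac)
    qed
  qed
  then have "Im (\<psi> (\<lambda>v. x v + k *\<^sub>R v)) = 0" using normal_posD(2)[OF p M_add[OF x kin]] by blast
  moreover have "Im (\<psi> (\<lambda>v. k *\<^sub>R v)) = 0"
    by (rule normal_posD(2)[OF p kin psd_scaleR[OF psd_id k(1)]])
  ultimately show ?thesis using normal_fun_linear(1)[OF normal_pos_fun[OF p] x kin] by simp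
qed

text \<open>The operator i (x' y - y' x) is selfadjoint, so \<psi> is real on it, which equates the
  two real parts. The adjoints are separate variables so that selfadjoint operators can be inserted
  for both.\<close>

lemma normal_pos_adjoint_sym:
  assumes p: "normal_pos J M \<psi>" and x: "x \<in> M" "x' \<in> M" "\<And>u v. inner (x' u) v = inner u (x v)"
    and y: "y \<in> M" "y' \<in> M" "\<And>u v. inner (y' u) v = inner u (y v)"
  shows "Re (\<psi> (\<lambda>v. x' (y v))) = Re (\<psi> (\<lambda>v. y' (x v)))"
proof -
  note nf = normal_fun_linear[OF normal_pos_fun[OF p]]
  have in1: "(\<lambda>v. x' (y v)) \<in> M" "(\<lambda>v. y' (x v)) \<in> M" using M_comp x y by blast+
  note w = M_diff[OF in1]
  have xx: "inner (x u) v = inner u (x' v)" and yy: "inner (y u) v = inner u (y' v)" for u v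
    using x(3) y(3) by (metis inner_commute)+
  have "Im (\<psi> (\<lambda>v. J (x' (y v) - y' (x v)))) = 0"
  proof (rule normal_pos_sa_real[OF p M_comp[OF M_J w]])
    show "inner (J (x' (y u) - y' (x u))) v = inner u (J (x' (y v) - y' (x v)))" for u v
      by (simp add: cstructD(4)[OF cs] inner_diff_left inner_diff_right x(3) y(3) xx yy J.diff
          M_commute_J x y)
  qed
  then show ?thesis using nf(3)[OF w w] nf(4)[OF in1] by simp
qed

lemma normal_pos_cauchy_schwarz:
  assumes p: "normal_pos J M \<psi>" and x: "x \<in> M" "x' \<in> M" "\<And>u v. inner (x' u) v = inner u (x v)"
    and y: "y \<in> M" "y' \<in> M" "\<And>u v. inner (y' u) v = inner u (y v)"
  shows "(Re (\<psi> (\<lambda>v. y' (x v))))\<^sup>2 \<le> Re (\<psi> (\<lambda>v. x' (x v))) * Re (\<psi> (\<lambda>v. y' (y v)))"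
proof (rule quadratic_nonneg_discriminant)
  show "0 \<le> Re (\<psi> (\<lambda>v. y' (y v)))"
  proof (rule normal_posD(1)[OF p M_comp[OF y(2,1)] psdI])
    show "inner (y' (y u)) v = inner u (y' (y v))" for u v by (metis y(3) inner_commute)
  qed (simp_all add: y(3) M_linear[OF M_comp[OF y(2,1)]])
  fix t
  note nf = normal_fun_linear[OF normal_pos_fun[OF p]]
  have in1: "(\<lambda>v. x' (x v)) \<in> M" "(\<lambda>v. y' (y v)) \<in> M" "(\<lambda>v. x' (y v)) \<in> M" "(\<lambda>v. y' (x v)) \<in> M"
    using M_comp x y by blast+
  \<comment> \<open>z is the adjoint of x + t y composed with x + t y, written out so that \<psi>
    can be applied term by term.\<close>
  define z where "z v = (x' (x v) + t\<^sup>2 *\<^sub>R y' (y v)) + t *\<^sub>R (x' (y v) + y' (x v))" for v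
  have zin: "z \<in> M" unfolding z_def by (intro M_add M_scale in1)
  interpret x': bounded_linear x' using M_linear x by blast
  interpret y': bounded_linear y' using M_linear y by blast
  have zz: "inner (z u) v = inner (x u + t *\<^sub>R y u) (x v + t *\<^sub>R y v)" for u v
    by (simp add: z_def inner_add_left inner_add_right x(3) y(3) power2_eq_square algebra_simps)
  have "psd z"
  proof (rule psdI)
    show "bounded_linear z" using M_linear[OF zin] .
    show "inner (z u) v = inner u (z v)" for u v
      using zz[of u v] zz[of v u] by (simp add: inner_commute)
    show "0 \<le> inner (z u) u" for u by (simp add: zz)
  qed
  then have "0 \<le> Re (\<psi> z)" using normal_posD(1)[OF p zin] by blast
  also have "\<psi> z = \<psi> (\<lambda>v. x' (x v)) + of_real (t\<^sup>2) * \<psi> (\<lambda>v. y' (y v))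
      + of_real t * (\<psi> (\<lambda>v. x' (y v)) + \<psi> (\<lambda>v. y' (x v)))"
    unfolding z_def
    by (simp only: nf(1)[OF M_add[OF in1(1) M_scale[OF in1(2)]] M_scale[OF M_add[OF in1(3,4)]]]
        nf(1)[OF in1(1) M_scale[OF in1(2)]] nf(1)[OF in1(3,4)] nf(2)[OF in1(2) in1(2)]
        nf(2)[OF M_add[OF in1(3,4)] M_add[OF in1(3,4)]])
  finally show "0 \<le> Re (\<psi> (\<lambda>v. x' (x v))) + 2 * t * Re (\<psi> (\<lambda>v. y' (x v))) + t\<^sup>2 * Re (\<psi> (\<lambda>v. y' (y v)))"
    using normal_pos_adjoint_sym[OF p x y] by (simp add: algebra_simps del: of_real_power)
qed

text \<open>Cauchy-Schwarz for S and x T leaves the factor \<psi>(T x' x T), and T x' x T \<le> k^2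
  T^2.\<close>

lemma normal_pos_sandwich_bound:
  assumes p: "normal_pos J M \<psi>" and S: "S \<in> M" "\<And>u v. inner (S u) v = inner u (S v)"
    and T: "T \<in> M" "\<And>u v. inner (T u) v = inner u (T v)"
    and x: "x \<in> M" and k: "0 \<le> k" "\<And>v. norm (x v) \<le> k * norm v"
  shows "\<bar>Re (\<psi> (\<lambda>v. S (x (T v))))\<bar> \<le> k * sqrt (Re (\<psi> (\<lambda>v. S (S v)))) * sqrt (Re (\<psi> (\<lambda>v. T (T v))))"
proof -
  define x' where "x' = adjoint x"
  have x': "x' \<in> M" "\<And>u v. inner (x' u) v = inner u (x v)"
    using M_adjoint[OF x] adjoint_bounded_inner(2)[OF M_linear[OF x]] by (auto simp: x'_def)
  have in1: "(\<lambda>v. x (T v)) \<in> M" "(\<lambda>v. T (x' v)) \<in> M" using M_comp x x' T by blast+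
  have in2: "(\<lambda>v. T (x' (x (T v)))) \<in> M" "(\<lambda>v. T (T v)) \<in> M" "(\<lambda>v. S (S v)) \<in> M"
    using M_comp[OF in1(2) in1(1)] M_comp[OF T(1) T(1)] M_comp[OF S(1) S(1)] by auto
  have cs': "(Re (\<psi> (\<lambda>v. S (x (T v)))))\<^sup>2 \<le> Re (\<psi> (\<lambda>v. T (x' (x (T v))))) * Re (\<psi> (\<lambda>v. S (S v)))"
    by (rule normal_pos_cauchy_schwarz[OF p in1 _ S(1) S(1) S(2)]) (simp add: T(2) x'(2))
  have "Re (\<psi> (\<lambda>v. T (x' (x (T v))))) \<le> Re (\<psi> (\<lambda>v. k\<^sup>2 *\<^sub>R T (T v)))"
  proof (rule normal_pos_mono[OF p in2(1) M_scale[OF in2(2)]])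
    show "psd (\<lambda>v. k\<^sup>2 *\<^sub>R T (T v) - T (x' (x (T v))))"
    proof (rule psdI)
      show "bounded_linear (\<lambda>v. k\<^sup>2 *\<^sub>R T (T v) - T (x' (x (T v))))"
        using M_linear[OF M_diff[OF M_scale[OF in2(2)] in2(1)]] .
      have e: "inner (k\<^sup>2 *\<^sub>R T (T u) - T (x' (x (T u)))) v = k\<^sup>2 * inner (T u) (T v) - inner (x (T u)) (x (T v))" for u v
        by (simp add: inner_diff_left T(2)[of "T u"] T(2)[of "x' (x (T u))"] x'(2))
      show "inner (k\<^sup>2 *\<^sub>R T (T u) - T (x' (x (T u)))) v = inner u (k\<^sup>2 *\<^sub>R T (T v) - T (x' (x (T v))))" for u v
        using e[of u v] e[of v u] by (simp add: inner_commute)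
      show "0 \<le> inner (k\<^sup>2 *\<^sub>R T (T u) - T (x' (x (T u)))) u" for u
      proof -
        have "(norm (x (T u)))\<^sup>2 \<le> (k * norm (T u))\<^sup>2" using k by (intro power_mono) auto
        then show ?thesis unfolding e by (simp add: power2_norm_eq_inner[symmetric] power_mult_distrib)
      qed
    qed
  qed
  also have "\<dots> = k\<^sup>2 * Re (\<psi> (\<lambda>v. T (T v)))"
    using normal_fun_linear(2)[OF normal_pos_fun[OF p] in2(2) in2(2)] by (simp del: of_real_power)
  finally have "Re (\<psi> (\<lambda>v. T (x' (x (T v))))) * Re (\<psi> (\<lambda>v. S (S v))) \<le> k\<^sup>2 * Re (\<psi> (\<lambda>v. T (T v))) * Re (\<psi> (\<lambda>v. S (S v)))"
    using normal_posD(1)[OF p in2(3) psd_square[OF M_linear[OF S(1)] S(2)]] by (intro mult_right_mono)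
  with cs' have "(Re (\<psi> (\<lambda>v. S (x (T v)))))\<^sup>2 \<le> k\<^sup>2 * Re (\<psi> (\<lambda>v. T (T v))) * Re (\<psi> (\<lambda>v. S (S v)))"
    by linarith
  then have "sqrt ((Re (\<psi> (\<lambda>v. S (x (T v)))))\<^sup>2) \<le> sqrt (k\<^sup>2 * Re (\<psi> (\<lambda>v. T (T v))) * Re (\<psi> (\<lambda>v. S (S v))))"
    by (rule real_sqrt_le_mono)
  then show ?thesis using k(1) by (simp add: real_sqrt_mult mult_ac)
qed

text \<open>With G = S - T, the difference of the sandwiches is G x S + T x G. Moreover G^2 \<le>
  S^2 - T^2, since S^2 - T^2 - G^2 = 2 T G \<ge> 0, so a small difference of \<psi>(S^2) and
  \<psi>(T^2) makes both terms small.\<close>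

lemma normal_pos_sandwich_diff:
  assumes p: "normal_pos J M \<psi>" and S: "S \<in> M" "psd S" and T: "T \<in> M" "psd T"
    and comm: "\<And>v. S (T v) = T (S v)" and le: "psd (\<lambda>v. S (S v) - T (T v))"
    and x: "x \<in> M" and k: "0 \<le> k" "\<And>v. norm (x v) \<le> k * norm v"
  shows "\<bar>Re (\<psi> (\<lambda>v. S (x (S v)))) - Re (\<psi> (\<lambda>v. T (x (T v))))\<bar>
    \<le> 2 * k * sqrt (Re (\<psi> (\<lambda>v. S (S v)))) * sqrt (Re (\<psi> (\<lambda>v. S (S v))) - Re (\<psi> (\<lambda>v. T (T v))))"
proof -
  note nf = normal_fun_linear[OF normal_pos_fun[OF p]]
  interpret S: bounded_linear S using psdD[OF S(2)] by simp
  interpret T: bounded_linear T using psdD[OF T(2)] by simp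
  interpret x: bounded_linear x using M_linear[OF x] .
  let ?G = "\<lambda>v. S v - T v"
  have G: "?G \<in> M" using M_diff[OF S(1) T(1)] .
  have Gp: "psd ?G" by (rule psd_sqrt_mono[OF S(2) T(2) comm le])
  have TG: "psd (\<lambda>v. T (S v - T v))" by (rule psd_compose[OF T(2) Gp]) (simp add: T.diff comm)
  have in1: "(\<lambda>v. S (S v)) \<in> M" "(\<lambda>v. T (T v)) \<in> M" "(\<lambda>v. ?G (?G v)) \<in> M"
    using M_comp[OF S(1) S(1)] M_comp[OF T(1) T(1)] M_comp[OF G G] by auto
  have "Re (\<psi> (\<lambda>v. ?G (?G v))) \<le> Re (\<psi> (\<lambda>v. S (S v) - T (T v)))"
  proof (rule normal_pos_mono[OF p in1(3) M_diff[OF in1(1,2)]])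
    have "psd (\<lambda>v. 2 *\<^sub>R T (S v - T v))" by (rule psd_scaleR[OF TG]) simp
    then show "psd (\<lambda>v. S (S v) - T (T v) - ?G (?G v))"
      by (simp add: S.diff T.diff comm scaleR_2 algebra_simps)
  qed
  then have g: "sqrt (Re (\<psi> (\<lambda>v. ?G (?G v)))) \<le> sqrt (Re (\<psi> (\<lambda>v. S (S v))) - Re (\<psi> (\<lambda>v. T (T v))))" (is "?g \<le> ?d")
    by (simp add: nf(4)[OF in1(1,2)])
  have st: "sqrt (Re (\<psi> (\<lambda>v. T (T v)))) \<le> sqrt (Re (\<psi> (\<lambda>v. S (S v))))" (is "?t \<le> ?s")
    using normal_pos_mono[OF p in1(2,1) le] by simp
  have s0: "0 \<le> ?s" using normal_posD(1)[OF p in1(1) psd_square[OF psdD(1,2)[OF S(2)]]] by simp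
  have d0: "0 \<le> ?d" using normal_pos_mono[OF p in1(2,1) le] by simp
  have in2: "(\<lambda>v. ?G (x (S v))) \<in> M" "(\<lambda>v. T (x (?G v))) \<in> M"
      "(\<lambda>v. S (x (S v))) \<in> M" "(\<lambda>v. T (x (T v))) \<in> M"
    using M_comp[OF G M_comp[OF x S(1)]] M_comp[OF T(1) M_comp[OF x G]]
       M_comp[OF S(1) M_comp[OF x S(1)]] M_comp[OF T(1) M_comp[OF x T(1)]] by auto
  have "(\<lambda>v. S (x (S v)) - T (x (T v))) = (\<lambda>v. ?G (x (S v)) + T (x (?G v)))"
    by (simp add: x.diff T.diff)
  then have "\<psi> (\<lambda>v. S (x (S v))) - \<psi> (\<lambda>v. T (x (T v))) = \<psi> (\<lambda>v. ?G (x (S v))) + \<psi> (\<lambda>v. T (x (?G v)))"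
    using nf(4)[OF in2(3,4)] nf(1)[OF in2(1,2)] by simp
  then have eq: "Re (\<psi> (\<lambda>v. S (x (S v)))) - Re (\<psi> (\<lambda>v. T (x (T v)))) = Re (\<psi> (\<lambda>v. ?G (x (S v)))) + Re (\<psi> (\<lambda>v. T (x (?G v))))"
    by (metis minus_complex.sel(1) plus_complex.sel(1))
  have "\<bar>Re (\<psi> (\<lambda>v. ?G (x (S v))))\<bar> \<le> k * ?g * ?s"
    by (rule normal_pos_sandwich_bound[OF p G psdD(2)[OF Gp] S(1) psdD(2)[OF S(2)] x k])
  also have "\<dots> \<le> k * ?d * ?s" using g k(1) s0 by (intro mult_right_mono mult_left_mono)
  finally have 1: "\<bar>Re (\<psi> (\<lambda>v. ?G (x (S v))))\<bar> \<le> k * ?d * ?s" .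
  have "\<bar>Re (\<psi> (\<lambda>v. T (x (?G v))))\<bar> \<le> k * ?t * ?g"
    by (rule normal_pos_sandwich_bound[OF p T(1) psdD(2)[OF T(2)] G psdD(2)[OF Gp] x k])
  also have "\<dots> \<le> k * ?s * ?d" using g k(1) s0 st normal_posD(1)[OF p in1(3) psd_square[OF psdD(1,2)[OF Gp]]]
    by (intro mult_mono mult_left_mono mult_nonneg_nonneg) auto
  finally have 2: "\<bar>Re (\<psi> (\<lambda>v. T (x (?G v))))\<bar> \<le> k * ?s * ?d" .
  show ?thesis unfolding eq using 1 2 abs_triangle_ineq[of "Re (\<psi> (\<lambda>v. ?G (x (S v))))" "Re (\<psi> (\<lambda>v. T (x (?G v))))"]
    by (simp add: mult_ac)
qed

section \<open>The value of a positive normal functional at a\<close>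

lemma normal_pos_A_mono:
  "normal_pos J M \<psi> \<Longrightarrow> 0 < m \<Longrightarrow> m \<le> k \<Longrightarrow> Re (\<psi> (A m)) \<le> Re (\<psi> (A k))"
  using normal_pos_mono A_in A_mono by simp

text \<open>A real version of \<psi>(a), for use with real seminorms. It is meaningful for
  functionals in \<open>Dpos\<close>; an infinite value would be sent to 0 by
  \<open>real_of_ereal\<close>.\<close>

definition val :: "(('h \<Rightarrow> 'h) \<Rightarrow> complex) \<Rightarrow> real" where
  "val \<psi> = real_of_ereal (fval D a \<psi>)"

lemma fval_tendsto:
  assumes "((\<lambda>l. Re (\<psi> (A l))) \<longlongrightarrow> v) at_top"
  shows "fval D a \<psi> = ereal v" "val \<psi> = v"
proof -
  show "fval D a \<psi> = ereal v" unfolding fval_def using assms by (intro tendsto_Lim) auto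
  then show "val \<psi> = v" by (simp add: val_def)
qed

text \<open>By monotonicity in l the limit is the supremum. The third and fifth conclusions are the
  standard way to show that a functional lies in \<open>Dpos\<close> and to estimate its value: a
  bound for all \<psi>(a_l) suffices.\<close>

lemma normal_pos_bounded_tendsto:
  assumes p: "normal_pos J M \<psi>" and B: "\<And>l. 0 < l \<Longrightarrow> Re (\<psi> (A l)) \<le> B"
  shows "((\<lambda>l. Re (\<psi> (A l))) \<longlongrightarrow> val \<psi>) at_top" "fval D a \<psi> = ereal (val \<psi>)" "\<psi> \<in> Dpos J M D a"
    "\<And>l. 0 < l \<Longrightarrow> Re (\<psi> (A l)) \<le> val \<psi>" "val \<psi> \<le> B"
proof -
  define V where "V = (SUP l\<in>{0<..}. Re (\<psi> (A l)))"
  have bdd: "bdd_above ((\<lambda>l. Re (\<psi> (A l))) ` {0<..})" using B by (intro bdd_aboveI[of _ B]) auto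
  have up: "Re (\<psi> (A l)) \<le> V" if "0 < l" for l
    unfolding V_def using bdd that by (intro cSUP_upper) auto
  have lim: "((\<lambda>l. Re (\<psi> (A l))) \<longlongrightarrow> V) at_top"
  proof (rule order_tendstoI)
    fix r assume "r < V"
    then obtain m where m: "0 < m" "r < Re (\<psi> (A m))"
      unfolding V_def using less_cSUP_iff[OF _ bdd] by auto
    show "\<forall>\<^sub>F l in at_top. r < Re (\<psi> (A l))"
      using eventually_ge_at_top[of m] by eventually_elim (use normal_pos_A_mono[OF p m(1)] m(2) in force)
  next
    fix r assume "V < r"
    show "\<forall>\<^sub>F l in at_top. Re (\<psi> (A l)) < r"
      using eventually_gt_at_top[of 0] by eventually_elim (use up \<open>V < r\<close> in force)
  qed
  note f = fval_tendsto[OF lim]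
  show "((\<lambda>l. Re (\<psi> (A l))) \<longlongrightarrow> val \<psi>) at_top" using lim f by simp
  show "fval D a \<psi> = ereal (val \<psi>)" using f by simp
  show "\<psi> \<in> Dpos J M D a" using p f by (simp add: Dpos_def)
  show "Re (\<psi> (A l)) \<le> val \<psi>" if "0 < l" for l using up that f by simp
  have "V \<le> B" unfolding V_def by (rule cSUP_least) (use B in \<open>auto simp: gt_ex\<close>)
  then show "val \<psi> \<le> B" using f by simp
qed

lemma Dpos_normal: "\<psi> \<in> Dpos J M D a \<Longrightarrow> normal_pos J M \<psi>"
  by (simp add: Dpos_def)

text \<open>If the values are unbounded, monotonicity makes them tend to \<infinity>; thus
  \<open>Lim\<close> in \<open>fval\<close> is a true limit, equal to \<infinity>, and not an
  unspecified value.\<close>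

lemma Dpos_bounded:
  assumes "\<psi> \<in> Dpos J M D a" shows "\<exists>B. \<forall>l>0. Re (\<psi> (A l)) \<le> B"
proof (rule ccontr)
  assume "\<not> ?thesis"
  then have n: "\<exists>l>0. B < Re (\<psi> (A l))" for B by (auto simp: not_le)
  have "((\<lambda>l. ereal (Re (\<psi> (A l)))) \<longlongrightarrow> \<infinity>) at_top"
    unfolding tendsto_PInfty
  proof
    fix r
    obtain m where m: "0 < m" "r < Re (\<psi> (A m))" using n by blast
    show "\<forall>\<^sub>F l in at_top. ereal r < ereal (Re (\<psi> (A l)))"
      using eventually_ge_at_top[of m]
      by eventually_elim (use normal_pos_A_mono[OF Dpos_normal[OF assms] m(1)] m(2) in force)
  qed
  then have "fval D a \<psi> = \<infinity>" unfolding fval_def by (intro tendsto_Lim) auto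
  then show False using assms by (simp add: Dpos_def)
qed

lemma Dpos_val:
  assumes "\<psi> \<in> Dpos J M D a"
  shows "((\<lambda>l. Re (\<psi> (A l))) \<longlongrightarrow> val \<psi>) at_top" "fval D a \<psi> = ereal (val \<psi>)"
    "\<And>l. 0 < l \<Longrightarrow> Re (\<psi> (A l)) \<le> val \<psi>" "0 \<le> val \<psi>"
proof -
  obtain B where B: "\<And>l. 0 < l \<Longrightarrow> Re (\<psi> (A l)) \<le> B" using Dpos_bounded[OF assms] by blast
  note b = normal_pos_bounded_tendsto[OF Dpos_normal[OF assms] B]
  show "((\<lambda>l. Re (\<psi> (A l))) \<longlongrightarrow> val \<psi>) at_top" "fval D a \<psi> = ereal (val \<psi>)"
    "\<And>l. 0 < l \<Longrightarrow> Re (\<psi> (A l)) \<le> val \<psi>" using b by auto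
  have "0 \<le> Re (\<psi> (A 1))" using normal_posD(1)[OF Dpos_normal[OF assms] A_in A_psd] by simp
  then show "0 \<le> val \<psi>" using b(4)[of 1] by simp
qed

lemma normal_pos_add: "normal_pos J M \<psi> \<Longrightarrow> normal_pos J M \<rho> \<Longrightarrow> normal_pos J M (\<lambda>x. \<psi> x + \<rho> x)"
  using normal_fun_add[OF cs M_sub] by (simp add: normal_pos_def)

lemma normal_pos_scale: "normal_pos J M \<psi> \<Longrightarrow> 0 \<le> c \<Longrightarrow> normal_pos J M (\<lambda>x. of_real c * \<psi> x)"
  using normal_fun_scale[OF cs M_sub] by (simp add: normal_pos_def)

lemma Dpos_add:
  assumes "\<psi> \<in> Dpos J M D a" "\<rho> \<in> Dpos J M D a"
  shows "(\<lambda>x. \<psi> x + \<rho> x) \<in> Dpos J M D a" "val (\<lambda>x. \<psi> x + \<rho> x) = val \<psi> + val \<rho>"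
proof -
  have "((\<lambda>l. Re (\<psi> (A l) + \<rho> (A l))) \<longlongrightarrow> val \<psi> + val \<rho>) at_top"
    using tendsto_add[OF Dpos_val(1)[OF assms(1)] Dpos_val(1)[OF assms(2)]] by simp
  note f = fval_tendsto[of "\<lambda>x. \<psi> x + \<rho> x", OF this]
  show "(\<lambda>x. \<psi> x + \<rho> x) \<in> Dpos J M D a"
    using f(1) normal_pos_add[OF Dpos_normal[OF assms(1)] Dpos_normal[OF assms(2)]] by (simp add: Dpos_def)
  show "val (\<lambda>x. \<psi> x + \<rho> x) = val \<psi> + val \<rho>" by (rule f)
qed

lemma Dpos_scale:
  assumes "\<psi> \<in> Dpos J M D a" "0 \<le> c"
  shows "(\<lambda>x. of_real c * \<psi> x) \<in> Dpos J M D a" "val (\<lambda>x. of_real c * \<psi> x) = c * val \<psi>"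
proof -
  have "((\<lambda>l. Re (of_real c * \<psi> (A l))) \<longlongrightarrow> c * val \<psi>) at_top"
    using tendsto_mult[OF tendsto_const[of c] Dpos_val(1)[OF assms(1)]] by simp
  note f = fval_tendsto[of "\<lambda>x. of_real c * \<psi> x", OF this]
  show "(\<lambda>x. of_real c * \<psi> x) \<in> Dpos J M D a"
    using f(1) normal_pos_scale[OF Dpos_normal[OF assms(1)] assms(2)] by (simp add: Dpos_def)
  show "val (\<lambda>x. of_real c * \<psi> x) = c * val \<psi>" by (rule f)
qed

text \<open>The outer k moves to the other vector: <k y k \<xi>, \<eta>> = <y k \<xi>, k
  \<eta>>.\<close>

lemma normal_pos_conj:
  assumes p: "normal_pos J M \<psi>" and k: "k \<in> M" "\<And>u v. inner (k u) v = inner u (k v)"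
  shows "normal_pos J M (\<lambda>y. \<psi> (\<lambda>v. k (y (k v))))"
proof -
  obtain \<xi> \<eta> where 1: "summable (\<lambda>n. (norm (\<xi> n))\<^sup>2)" "summable (\<lambda>n. (norm (\<eta> n))\<^sup>2)"
    "\<And>x. x \<in> M \<Longrightarrow> \<psi> x = (\<Sum>n. cinner J (x (\<xi> n)) (\<eta> n))"
    using normal_pos_fun[OF p] by (auto simp: normal_fun_def)
  have kin: "(\<lambda>v. k (y (k v))) \<in> M" if "y \<in> M" for y
    using M_comp[OF k(1) M_comp[OF that k(1)]] .
  have "normal_fun J M (\<lambda>y. \<psi> (\<lambda>v. k (y (k v))))"
    unfolding normal_fun_def
  proof (intro exI conjI ballI)
    show "summable (\<lambda>n. (norm (k (\<xi> n)))\<^sup>2)" "summable (\<lambda>n. (norm (k (\<eta> n)))\<^sup>2)"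
      using summable_norm_image[OF M_linear[OF k(1)]] 1 by blast+
    show "\<psi> (\<lambda>v. k (y (k v))) = (\<Sum>n. cinner J (y (k (\<xi> n))) (k (\<eta> n)))" if "y \<in> M" for y
      using 1(3)[OF kin[OF that]] by (simp add: cinner_def k(2) M_commute_J[OF k(1)])
  qed
  moreover have "psd (\<lambda>v. k (y (k v)))" if "psd y" "y \<in> M" for y
  proof (rule psdI)
    show "bounded_linear (\<lambda>v. k (y (k v)))" using M_linear[OF kin[OF that(2)]] .
    show "inner (k (y (k u))) v = inner u (k (y (k v)))" for u v by (simp add: k(2) psdD(2)[OF that(1)])
    show "0 \<le> inner (k (y (k u))) u" for u
      using psdD(3)[OF that(1), of "k u"] k(2)[of "y (k u)" u] by simp
  qed
  ultimately show ?thesis using normal_posD[OF p kin] by (simp add: normal_pos_def pos_op_iff_psd)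
qed

end

section \<open>The Hahn-Banach theorem\<close>

text \<open>Makes functionals on operators elements of a \<open>real_vector\<close> type, so that
  Hahn-Banach can be stated for subspaces.\<close>

instantiation "fun" :: (type, real_vector) real_vector
begin

definition scaleR_fun :: "real \<Rightarrow> ('a \<Rightarrow> 'b) \<Rightarrow> 'a \<Rightarrow> 'b" where
  "scaleR_fun c f = (\<lambda>x. c *\<^sub>R f x)"

instance
  by standard (simp_all add: scaleR_fun_def fun_eq_iff algebra_simps)

end

text \<open>Homogeneity is an inequality for c > 0, the form that is easy to check for infima;
  applying it to 1 / c as well restores equality.\<close>

definition sublinear_on :: "'v::real_vector set \<Rightarrow> ('v \<Rightarrow> real) \<Rightarrow> bool" where
  "sublinear_on W q \<longleftrightarrow> (\<forall>v\<in>W. \<forall>w\<in>W. q (v + w) \<le> q v + q w) \<and> (\<forall>v\<in>W. \<forall>c>0. q (c *\<^sub>R v) \<le> c * q v)"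

lemma sublinear_onD:
  assumes "sublinear_on W q" "subspace W"
  shows "v \<in> W \<Longrightarrow> w \<in> W \<Longrightarrow> q (v + w) \<le> q v + q w"
    "v \<in> W \<Longrightarrow> 0 \<le> c \<Longrightarrow> q (c *\<^sub>R v) = c * q v" "q 0 = 0" "v \<in> W \<Longrightarrow> - q (- v) \<le> q v"
proof -
  show sub: "q (v + w) \<le> q v + q w" if "v \<in> W" "w \<in> W" for v w using assms(1) that by (auto simp: sublinear_on_def)
  have le: "q (c *\<^sub>R v) \<le> c * q v" if "v \<in> W" "0 < c" for v c using assms(1) that by (auto simp: sublinear_on_def)
  have W0: "0 \<in> W" using subspace_0[OF assms(2)] .
  show q0: "q 0 = 0" using sub[OF W0 W0] le[OF W0, of "1/2"] by simp
  show "q (c *\<^sub>R v) = c * q v" if "v \<in> W" "0 \<le> c"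
  proof (cases "c = 0")
    case False
    then have c: "c > 0" using that by simp
    have "q v \<le> (1 / c) * q (c *\<^sub>R v)"
      using le[OF subspace_scale[OF assms(2) that(1), of c], of "1 / c"] c by simp
    then have "c * q v \<le> q (c *\<^sub>R v)" using c by (simp add: field_simps)
    then show ?thesis using le[OF that(1) c] by simp
  qed (simp add: q0)
  show "- q (- v) \<le> q v" if "v \<in> W"
    using sub[OF that subspace_neg[OF assms(2) that]] q0 by simp
qed

text \<open>q' is the infimum over t \<ge> 0 of q (v + t y) - t q y. Then t = 0 gives q' \<le> q,
  and t = 1 at v = - y gives q' (- y) \<le> - q y. It serves twice: to prescribe the value at w0 and
  to show that a minimal sublinear functional is additive.\<close>

lemma sublinear_shift:
  assumes q: "sublinear_on W q" and W: "subspace W" and y: "y \<in> W"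
  obtains q' where "sublinear_on W q'" "\<And>v. v \<notin> W \<Longrightarrow> q' v = 0"
    "\<And>v t. v \<in> W \<Longrightarrow> 0 \<le> t \<Longrightarrow> q' v \<le> q (v + t *\<^sub>R y) - t * q y"
proof -
  note qD = sublinear_onD[OF q W]
  define h where "h v t = q (v + t *\<^sub>R y) - t * q y" for v t
  define q' where "q' v = (if v \<in> W then (INF t\<in>{0..}. h v t) else 0)" for v
  have tyW: "v + t *\<^sub>R y \<in> W" if "v \<in> W" for v t
    using subspace_add[OF W that subspace_scale[OF W y]] .
  have low: "- q (- v) \<le> h v t" if "v \<in> W" "0 \<le> t" for v t
  proof -
    have "q (t *\<^sub>R y) \<le> q (v + t *\<^sub>R y) + q (- v)"
      using qD(1)[OF tyW[OF that(1)] subspace_neg[OF W that(1)], of t] by simp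
    then show ?thesis using qD(2)[OF y that(2)] by (simp add: h_def)
  qed
  have bdd: "bdd_below (h v ` {0..})" if "v \<in> W" for v
    using low[OF that] by (intro bdd_belowI[of _ "- q (- v)"]) auto
  have up: "q' v \<le> h v t" if "v \<in> W" "0 \<le> t" for v t
    unfolding q'_def using that bdd by (auto intro!: cINF_lower)
  have "sublinear_on W q'" unfolding sublinear_on_def
  proof (intro conjI ballI allI impI)
    fix v w assume v: "v \<in> W" and w: "w \<in> W"
    have vw: "v + w \<in> W" using subspace_add[OF W v w] .
    have le: "q' (v + w) \<le> h v t + h w r" if "0 \<le> t" "0 \<le> r" for t r
    proof -
      have "q' (v + w) \<le> h (v + w) (t + r)" using up[OF vw] that by simp
      also have "\<dots> = q ((v + t *\<^sub>R y) + (w + r *\<^sub>R y)) - (t + r) * q y" by (simp add: h_def algebra_simps)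
      also have "\<dots> \<le> h v t + h w r" using qD(1)[OF tyW[OF v] tyW[OF w], of t r] by (simp add: h_def algebra_simps)
      finally show ?thesis .
    qed
    have "q' (v + w) - h v t \<le> q' w" if "0 \<le> t" for t
    proof -
      have "q' (v + w) - h v t \<le> (INF r\<in>{0..}. h w r)"
        by (rule cINF_greatest) (use le[OF that] in \<open>auto simp: algebra_simps\<close>)
      then show ?thesis using w by (simp add: q'_def)
    qed
    then have "q' (v + w) - q' w \<le> (INF t\<in>{0..}. h v t)"
      by (intro cINF_greatest) (auto simp: algebra_simps)
    then show "q' (v + w) \<le> q' v + q' w" using v by (simp add: q'_def)
  next
    fix v and c :: real assume v: "v \<in> W" and c: "0 < c"
    have "q' (c *\<^sub>R v) / c \<le> h v t" if "0 \<le> t" for t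
    proof -
      have "q' (c *\<^sub>R v) \<le> h (c *\<^sub>R v) (c * t)" using up[OF subspace_scale[OF W v]] c that by simp
      also have "\<dots> = q (c *\<^sub>R (v + t *\<^sub>R y)) - c * t * q y" by (simp add: h_def algebra_simps)
      also have "\<dots> = c * h v t" using qD(2)[OF tyW[OF v], of c t] c by (simp add: h_def algebra_simps)
      finally show ?thesis using c by (simp add: field_simps)
    qed
    then have "q' (c *\<^sub>R v) / c \<le> (INF t\<in>{0..}. h v t)" by (intro cINF_greatest) auto
    then show "q' (c *\<^sub>R v) \<le> c * q' v" using v c by (simp add: q'_def field_simps)
  qed
  moreover have "q' v = 0" if "v \<notin> W" for v using that by (simp add: q'_def)
  ultimately show ?thesis using that[of q'] up by (auto simp: h_def)
qed

text \<open>A minimal sublinear functional below p is linear, and Zorn's lemma provides one.\<close>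

lemma hahn_banach_dominated:
  fixes W :: "'v::real_vector set"
  assumes W: "subspace W" and p: "sublinear_on W p" and w0: "w0 \<in> W"
  obtains F where "\<And>v w. v \<in> W \<Longrightarrow> w \<in> W \<Longrightarrow> F (v + w) = F v + F w"
    "\<And>v c. v \<in> W \<Longrightarrow> F (c *\<^sub>R v) = c * F v"
    "\<And>v. v \<in> W \<Longrightarrow> F v \<le> p v" "F w0 = p w0"
proof -
  \<comment> \<open>The last condition yields F w0 = p w0 once F is linear. Vanishing off W allows
    functionals that matter only on W to be ordered and identified as whole functions.\<close>
  define Q where "Q = {q. sublinear_on W q \<and> (\<forall>v. v \<notin> W \<longrightarrow> q v = 0) \<and> (\<forall>v\<in>W. q v \<le> p v) \<and> q (- w0) \<le> - p w0}"
  have mw0: "- w0 \<in> W" using subspace_neg[OF W w0] .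
  have "\<exists>q. q \<in> Q"
  proof -
    obtain q where q: "sublinear_on W q" "\<And>v. v \<notin> W \<Longrightarrow> q v = 0"
      "\<And>v t. v \<in> W \<Longrightarrow> 0 \<le> t \<Longrightarrow> q v \<le> p (v + t *\<^sub>R w0) - t * p w0"
      by (rule sublinear_shift[OF p W w0]) blast
    have "q v \<le> p v" if "v \<in> W" for v using q(3)[OF that, of 0] by simp
    moreover have "q (- w0) \<le> - p w0" using q(3)[OF mw0, of 1] sublinear_onD(3)[OF p W] by simp
    ultimately show ?thesis using q(1,2) by (auto simp: Q_def)
  qed
  then obtain q0 where q0: "q0 \<in> Q" by blast
  \<comment> \<open>Zorn yields maximal elements, so the pointwise order is reversed.\<close>
  define P where "P q q' \<longleftrightarrow> (\<forall>v. q' v \<le> (q v :: real))" for q q' :: "'v \<Rightarrow> real"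
  have "\<exists>m\<in>Q. \<forall>q\<in>Q. P m q \<longrightarrow> q = m"
  proof (rule predicate_Zorn)
    show "partial_order_on Q (relation_of P Q)"
    proof (rule partial_order_on_relation_ofI)
      show "P q q" for q by (simp add: P_def)
      show "P q r \<Longrightarrow> P r u \<Longrightarrow> P q u" for q r u unfolding P_def by (meson order_trans)
      show "P q r \<Longrightarrow> P r q \<Longrightarrow> q = r" for q r unfolding P_def by (meson antisym ext)
    qed
    fix C assume "C \<in> Chains (relation_of P Q)"
    then have CQ: "C \<subseteq> Q" and tot: "\<And>q r. q \<in> C \<Longrightarrow> r \<in> C \<Longrightarrow> P q r \<or> P r q"
      by (auto simp: Chains_def relation_of_def)
    show "\<exists>u\<in>Q. \<forall>q\<in>C. P q u"
    proof (cases "C = {}")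
      case True
      then show ?thesis using q0 by blast
    next
      case False
      define u where "u v = (if v \<in> W then (INF q\<in>C. q v) else 0)" for v
      have QD: "sublinear_on W q" "\<And>v. v \<notin> W \<Longrightarrow> q v = 0" "\<And>v. v \<in> W \<Longrightarrow> q v \<le> p v" "q (- w0) \<le> - p w0" if "q \<in> C" for q
        using that CQ by (auto simp: Q_def)
      have bdd: "bdd_below ((\<lambda>q. q v) ` C)" if "v \<in> W" for v
      proof (intro bdd_belowI[of _ "- p (- v)"], clarify)
        fix q assume q: "q \<in> C"
        show "- p (- v) \<le> q v"
          using sublinear_onD(4)[OF QD(1)[OF q] W that] QD(3)[OF q subspace_neg[OF W that]] by simp
      qed
      have up: "u v \<le> q v" if "q \<in> C" "v \<in> W" for q v
        unfolding u_def using that bdd by (auto intro!: cINF_lower)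
      have great: "r \<le> u v" if "v \<in> W" "\<And>q. q \<in> C \<Longrightarrow> r \<le> q v" for r v
        using that cINF_greatest[OF False, of r "\<lambda>q. q v"] by (simp add: u_def)
      have "sublinear_on W u" unfolding sublinear_on_def
      proof (intro conjI ballI allI impI)
        fix v w assume v: "v \<in> W" and w: "w \<in> W"
        have vw: "v + w \<in> W" using subspace_add[OF W v w] .
        \<comment> \<open>Of two members of the chain, the smaller one bounds both terms.\<close>
        have le: "u (v + w) \<le> q v + r w" if q: "q \<in> C" and r: "r \<in> C" for q r
          using tot[OF q r]
        proof
          assume "P q r"
          then have "r v \<le> q v" by (simp add: P_def)
          then show ?thesis using up[OF r vw] sublinear_onD(1)[OF QD(1)[OF r] W v w] by linarith
        next
          assume "P r q"
          then have "q w \<le> r w" by (simp add: P_def)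
          then show ?thesis using up[OF q vw] sublinear_onD(1)[OF QD(1)[OF q] W v w] by linarith
        qed
        have "u (v + w) - q v \<le> u w" if "q \<in> C" for q
          by (rule great[OF w]) (use le[OF that] in \<open>simp add: algebra_simps\<close>)
        then have "u (v + w) - u w \<le> u v" by (intro great[OF v]) (simp add: algebra_simps)
        then show "u (v + w) \<le> u v + u w" by simp
      next
        fix v and c :: real assume v: "v \<in> W" and c: "0 < c"
        have "u (c *\<^sub>R v) / c \<le> u v"
        proof (rule great[OF v])
          fix q assume q: "q \<in> C"
          have "u (c *\<^sub>R v) \<le> c * q v"
            using up[OF q subspace_scale[OF W v], of c] sublinear_onD(2)[OF QD(1)[OF q] W v, of c] c by simp
          then show "u (c *\<^sub>R v) / c \<le> q v" using c by (simp add: field_simps)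
        qed
        then show "u (c *\<^sub>R v) \<le> c * u v" using c by (simp add: field_simps)
      qed
      moreover obtain q1 where q1: "q1 \<in> C" using False by blast
      ultimately have "u \<in> Q"
        using up[OF q1] QD(3,4)[OF q1] mw0 by (force simp: Q_def u_def)
      moreover have "P q u" if "q \<in> C" for q
        using up[OF that] QD(2)[OF that] by (auto simp: P_def u_def)
      ultimately show ?thesis by blast
    qed
  qed
  then obtain F where F: "F \<in> Q" and min: "\<And>q. q \<in> Q \<Longrightarrow> (\<And>v. q v \<le> F v) \<Longrightarrow> q = F"
    unfolding P_def by blast
  have Fs: "sublinear_on W F" and F0: "\<And>v. v \<notin> W \<Longrightarrow> F v = 0" and Fp: "\<And>v. v \<in> W \<Longrightarrow> F v \<le> p v"
    and Fw: "F (- w0) \<le> - p w0" using F by (auto simp: Q_def)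
  note FD = sublinear_onD[OF Fs W]
  have add: "F (v + w) = F v + F w" if v: "v \<in> W" and w: "w \<in> W" for v w
  proof -
    obtain q where q: "sublinear_on W q" "\<And>v. v \<notin> W \<Longrightarrow> q v = 0"
      "\<And>v t. v \<in> W \<Longrightarrow> 0 \<le> t \<Longrightarrow> q v \<le> F (v + t *\<^sub>R w) - t * F w"
      by (rule sublinear_shift[OF Fs W w]) blast
    have qF: "q v \<le> F v" for v using q(3)[of v 0] q(2)[of v] F0[of v] by (cases "v \<in> W") auto
    have "q \<in> Q" unfolding Q_def using q(1,2) qF Fp Fw by (auto intro: order_trans)
    then have "q = F" using min qF by blast
    \<comment> \<open>For q = F and t = 1 the bound reads F v \<le> F (v + w) - F w, the converse of
      subadditivity.\<close>
    then show ?thesis using q(3)[OF v, of 1] FD(1)[OF v w] by simp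
  qed
  have neg: "F (- v) = - F v" if "v \<in> W" for v
    using add[OF that subspace_neg[OF W that]] FD(3) by simp
  have scale: "F (c *\<^sub>R v) = c * F v" if v: "v \<in> W" for c v
  proof (cases "0 \<le> c")
    case False
    then show ?thesis using FD(2)[OF v, of "- c"] neg[OF subspace_scale[OF W v, of c]] by simp
  qed (rule FD(2)[OF v])
  have "F w0 = p w0" using neg[OF w0] Fw Fp[OF w0] by simp
  then show ?thesis using that add scale Fp by blast
qed

section \<open>Existence of the sandwich limit and the lower bound\<close>

text \<open>Beyond m the function varies by at most h m. The limit is first found along the positive
  integers, where the hypothesis applies.\<close>

lemma Cauchy_control_tendsto:
  fixes f h :: "real \<Rightarrow> real"
  assumes h: "(h \<longlongrightarrow> 0) at_top" and f: "\<And>k m. 0 < m \<Longrightarrow> m \<le> k \<Longrightarrow> \<bar>f k - f m\<bar> \<le> h m"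
  obtains L where "(f \<longlongrightarrow> L) at_top"
proof -
  define g where "g n = f (real (Suc n))" for n
  have hs: "(\<lambda>n. h (real (Suc n))) \<longlonglongrightarrow> 0"
    by (rule filterlim_compose[OF h]) (intro filterlim_compose[OF filterlim_real_sequentially] filterlim_Suc)
  have "Cauchy g"
  proof (rule metric_CauchyI)
    fix e :: real assume "0 < e"
    then have "\<forall>\<^sub>F n in sequentially. h (real (Suc n)) < e / 2" using order_tendstoD(2)[OF hs, of "e / 2"] by simp
    then obtain N where N: "h (real (Suc N)) < e / 2" unfolding eventually_sequentially by blast
    have le: "\<bar>g n - g N\<bar> < e / 2" if "n \<ge> N" for n
      using f[of "real (Suc N)" "real (Suc n)"] that N by (simp add: g_def)
    have "dist (g m) (g n) < e" if "m \<ge> N" "n \<ge> N" for m n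
      using le[OF that(1)] le[OF that(2)] unfolding dist_real_def by linarith
    then show "\<exists>N. \<forall>m\<ge>N. \<forall>n\<ge>N. dist (g m) (g n) < e" by blast
  qed
  then obtain L where L: "g \<longlonglongrightarrow> L" using Cauchy_convergent convergent_def by blast
  have le: "\<bar>f m - L\<bar> \<le> h m" if m: "0 < m" for m
  proof (rule tendsto_upperbound)
    show "(\<lambda>n. \<bar>f m - g n\<bar>) \<longlonglongrightarrow> \<bar>f m - L\<bar>" by (intro tendsto_intros L)
    obtain N where N: "m \<le> real N" using real_arch_simple by blast
    have "\<bar>f m - g n\<bar> \<le> h m" if "n \<ge> N" for n
      using f[OF m, of "real (Suc n)"] that N by (simp add: g_def abs_minus_commute)
    then show "\<forall>\<^sub>F n in sequentially. \<bar>f m - g n\<bar> \<le> h m" unfolding eventually_sequentially by blast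
  qed simp
  have "((\<lambda>m. f m - L) \<longlongrightarrow> 0) at_top"
  proof (rule Lim_null_comparison[OF _ h])
    show "\<forall>\<^sub>F m in at_top. norm (f m - L) \<le> h m"
      using eventually_gt_at_top[of 0] by eventually_elim (use le in simp)
  qed
  then have "(f \<longlongrightarrow> L) at_top" by (simp add: LIM_zero_iff)
  then show ?thesis using that by blast
qed

context affiliated_operator
begin

lemma s_s_fun: "0 < l \<Longrightarrow> (\<lambda>v. s l (s l v)) = A l"
  by (simp add: s_sq fun_eq_iff)

lemma M_norm_bound:
  assumes "x \<in> M" obtains k where "0 \<le> k" "\<And>v. norm (x v) \<le> k * norm v"
  using bounded_linear.nonneg_bounded[OF M_linear[OF assms]] by (metis mult.commute)

text \<open>\<open>normal_pos_sandwich_diff\<close> for \<open>s l\<close> and \<open>s m\<close>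
  bounds the oscillation by a constant times the root of \<psi>(a_l) - \<psi>(a_m), which is at most
  \<psi>(a) - \<psi>(a_m) and tends to 0 with growing m.\<close>

lemma Dpos_sandwich_Re_tendsto:
  assumes \<psi>: "\<psi> \<in> Dpos J M D a" and x: "x \<in> M"
  obtains L where "((\<lambda>l. Re (\<psi> (\<lambda>v. s l (x (s l v))))) \<longlongrightarrow> L) at_top"
proof -
  note p = Dpos_normal[OF \<psi>] and V = Dpos_val[OF \<psi>]
  obtain k where k: "0 \<le> k" "\<And>v. norm (x v) \<le> k * norm v" by (rule M_norm_bound[OF x]) blast
  define h where "h m = 2 * k * sqrt (val \<psi>) * sqrt (val \<psi> - Re (\<psi> (A m)))" for m
  have "(h \<longlongrightarrow> 2 * k * sqrt (val \<psi>) * sqrt (val \<psi> - val \<psi>)) at_top"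
    unfolding h_def by (intro tendsto_intros V)
  then have h: "(h \<longlongrightarrow> 0) at_top" by simp
  show ?thesis
  proof (rule Cauchy_control_tendsto[OF h])
    fix l m :: real assume m: "0 < m" and ml: "m \<le> l"
    then have l: "0 < l" by simp
    have "psd (\<lambda>v. s l (s l v) - s m (s m v))" using A_mono[OF m ml] by (simp only: s_sq[OF l] s_sq[OF m])
    from normal_pos_sandwich_diff[OF p s_in[OF l] s_psd[OF l] s_in[OF m] s_psd[OF m] s_s[OF l m] this x k]
    have "\<bar>Re (\<psi> (\<lambda>v. s l (x (s l v)))) - Re (\<psi> (\<lambda>v. s m (x (s m v))))\<bar>
        \<le> 2 * k * sqrt (Re (\<psi> (A l))) * sqrt (Re (\<psi> (A l)) - Re (\<psi> (A m)))"
      by (simp only: s_s_fun[OF l] s_s_fun[OF m])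
    also have "\<dots> \<le> h m" unfolding h_def
      using V(3)[OF l] V(3)[OF m] k(1) V(4) normal_posD(1)[OF p A_in[OF l] A_psd[OF l]]
        normal_pos_A_mono[OF p m ml]
      by (intro mult_mono mult_left_mono) auto
    finally show "\<bar>Re (\<psi> (\<lambda>v. s l (x (s l v)))) - Re (\<psi> (\<lambda>v. s m (x (s m v))))\<bar> \<le> h m" .
  qed (rule that)
qed

text \<open>Replacing x by i x reduces imaginary parts to real parts.\<close>

lemma Re_normal_fun_J:
  assumes "normal_fun J M \<psi>" "x \<in> M" "S \<in> M"
  shows "Re (\<psi> (\<lambda>v. S (J (x (S v))))) = - Im (\<psi> (\<lambda>v. S (x (S v))))"
proof -
  have "(\<lambda>v. S (x (S v))) \<in> M" using M_comp[OF assms(3) M_comp[OF assms(2,3)]] .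
  from normal_fun_linear(3)[OF assms(1) this this] show ?thesis by (simp add: M_commute_J[OF assms(3)])
qed

lemma Dpos_sandwich_tendsto:
  assumes \<psi>: "\<psi> \<in> Dpos J M D a" and x: "x \<in> M"
  obtains L where "((\<lambda>l. \<psi> (s l \<circ> x \<circ> s l)) \<longlongrightarrow> L) at_top"
proof -
  obtain L1 where L1: "((\<lambda>l. Re (\<psi> (\<lambda>v. s l (x (s l v))))) \<longlongrightarrow> L1) at_top"
    by (rule Dpos_sandwich_Re_tendsto[OF \<psi> x])
  obtain L2 where L2: "((\<lambda>l. Re (\<psi> (\<lambda>v. s l (J (x (s l v)))))) \<longlongrightarrow> L2) at_top"
    by (rule Dpos_sandwich_Re_tendsto[OF \<psi> M_comp[OF M_J x]])
  have "((\<lambda>l. Im (\<psi> (\<lambda>v. s l (x (s l v))))) \<longlongrightarrow> - L2) at_top"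
  proof (rule Lim_transform_eventually[OF tendsto_minus[OF L2]])
    show "\<forall>\<^sub>F l in at_top. - Re (\<psi> (\<lambda>v. s l (J (x (s l v))))) = Im (\<psi> (\<lambda>v. s l (x (s l v))))"
      using eventually_gt_at_top[of 0]
      by eventually_elim (simp add: Re_normal_fun_J[OF normal_pos_fun[OF Dpos_normal[OF \<psi>]] x s_in])
  qed
  then have "((\<lambda>l. \<psi> (s l \<circ> x \<circ> s l)) \<longlongrightarrow> Complex L1 (- L2)) at_top"
    using L1 by (simp add: tendsto_complex_iff comp_def)
  then show ?thesis using that by blast
qed

lemma sandwich_in: "x \<in> M \<Longrightarrow> 0 < l \<Longrightarrow> s l \<circ> x \<circ> s l \<in> M"
  using M_comp[OF s_in M_comp[OF _ s_in]] by (simp add: comp_def)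

lemma sandwich_tendsto:
  assumes \<phi>: "\<phi> \<in> Dherm J M D a" and x: "x \<in> M"
  shows "((\<lambda>l. \<phi> (s l \<circ> x \<circ> s l)) \<longlongrightarrow> sandwich J D a \<phi> x) at_top"
proof -
  obtain \<psi> \<rho> where d: "\<psi> \<in> Dpos J M D a" "\<rho> \<in> Dpos J M D a" "\<And>x. x \<in> M \<Longrightarrow> \<phi> x = \<psi> x - \<rho> x"
    using \<phi> by (auto simp: Dherm_def)
  obtain L1 where L1: "((\<lambda>l. \<psi> (s l \<circ> x \<circ> s l)) \<longlongrightarrow> L1) at_top" by (rule Dpos_sandwich_tendsto[OF d(1) x])
  obtain L2 where L2: "((\<lambda>l. \<rho> (s l \<circ> x \<circ> s l)) \<longlongrightarrow> L2) at_top" by (rule Dpos_sandwich_tendsto[OF d(2) x])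
  have "((\<lambda>l. \<phi> (s l \<circ> x \<circ> s l)) \<longlongrightarrow> L1 - L2) at_top"
  proof (rule Lim_transform_eventually[OF tendsto_diff[OF L1 L2]])
    show "\<forall>\<^sub>F l in at_top. \<psi> (s l \<circ> x \<circ> s l) - \<rho> (s l \<circ> x \<circ> s l) = \<phi> (s l \<circ> x \<circ> s l)"
      using eventually_gt_at_top[of 0] by eventually_elim (simp add: d(3) sandwich_in x)
  qed
  moreover from this have "sandwich J D a \<phi> x = L1 - L2"
    unfolding sandwich_def by (intro tendsto_Lim) auto
  ultimately show ?thesis by simp
qed

lemma normal_pos_cmod_sandwich:
  assumes p: "normal_pos J M \<psi>" and S: "S \<in> M" "psd S"
    and x: "x \<in> M" "\<And>v. norm (x v) \<le> norm v"
  shows "cmod (\<psi> (\<lambda>v. S (x (S v)))) \<le> Re (\<psi> (\<lambda>v. S (S v)))"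
proof (cases "\<psi> (\<lambda>v. S (x (S v))) = 0")
  case True
  then show ?thesis using normal_posD(1)[OF p M_comp[OF S(1) S(1)] psd_square[OF psdD(1,2)[OF S(2)]]] by simp
next
  case False
  define z where "z = \<psi> (\<lambda>v. S (x (S v)))"
  \<comment> \<open>The phase that rotates z onto its modulus; w x is again a contraction in M, so
    the bound for real parts yields the modulus.\<close>
  define w where "w = cnj z / cmod z"
  have wz: "w * z = cmod z" unfolding w_def using False
    by (simp add: z_def field_simps complex_norm_square[symmetric] power2_eq_square)
  have "cmod w = 1" unfolding w_def using False by (simp add: z_def norm_divide)
  then have w1: "(Re w)\<^sup>2 + (Im w)\<^sup>2 = 1" by (metis cmod_power2 one_power2)
  define y where "y v = Re w *\<^sub>R x v + Im w *\<^sub>R J (x v)" for v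
  have y: "y \<in> M" unfolding y_def by (intro M_add M_scale M_comp[OF M_J] x)
  interpret S: bounded_linear S using psdD[OF S(2)] by simp
  have "norm (y v) = norm (x v)" for v
  proof -
    have "inner (x v) (J (x v)) = 0" using cstructD(4)[OF cs, of "x v" "x v"] by (simp add: inner_commute)
    then have "inner (y v) (y v) = ((Re w)\<^sup>2 + (Im w)\<^sup>2) * inner (x v) (x v)"
      by (simp add: y_def inner_add_left inner_add_right cstructD(3)[OF cs] inner_commute power2_eq_square algebra_simps)
    then show ?thesis by (simp add: w1 norm_eq_sqrt_inner)
  qed
  then have ny: "norm (y v) \<le> 1 * norm v" for v using x(2) by simp
  have in1: "(\<lambda>v. S (x (S v))) \<in> M" "(\<lambda>v. S (J (x (S v)))) \<in> M"
    using M_comp[OF S(1) M_comp[OF x(1) S(1)]] M_comp[OF S(1) M_comp[OF M_J M_comp[OF x(1) S(1)]]] by auto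
  note nf = normal_fun_linear[OF normal_pos_fun[OF p]]
  have "\<psi> (\<lambda>v. S (y (S v))) = \<psi> (\<lambda>v. Re w *\<^sub>R S (x (S v)) + Im w *\<^sub>R S (J (x (S v))))"
    by (simp add: y_def S.add S.scaleR)
  also have "\<dots> = of_real (Re w) * z + of_real (Im w) * (\<i> * z)"
    using nf(3)[OF in1(1) in1(1)] nf(1)[OF M_scale[OF in1(1)] M_scale[OF in1(2)]]
      nf(2)[OF in1(1) in1(1)] nf(2)[OF in1(2) in1(2)] by (simp add: z_def M_commute_J[OF S(1)])
  also have "\<dots> = w * z" by (simp add: complex_eq_iff algebra_simps)
  finally have "Re (\<psi> (\<lambda>v. S (y (S v)))) = cmod z" by (simp add: wz)
  moreover have "Re (\<psi> (\<lambda>v. S (y (S v)))) \<le> 1 * sqrt (Re (\<psi> (\<lambda>v. S (S v)))) * sqrt (Re (\<psi> (\<lambda>v. S (S v))))"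
    using normal_pos_sandwich_bound[OF p S(1) psdD(2)[OF S(2)] S(1) psdD(2)[OF S(2)] y _ ny] by simp
  ultimately show ?thesis
    using normal_posD(1)[OF p M_comp[OF S(1) S(1)] psd_square[OF psdD(1,2)[OF S(2)]]] by (simp add: z_def)
qed

text \<open>For every l the modulus of \<psi>(s_l x s_l) is at most \<psi>(s_l s_l) = \<psi>(a_l).
  The limit gives one inequality of the theorem for an arbitrary decomposition.\<close>

lemma cmod_sandwich_le:
  assumes d: "\<psi> \<in> Dpos J M D a" "\<rho> \<in> Dpos J M D a" "\<And>x. x \<in> M \<Longrightarrow> \<phi> x = \<psi> x - \<rho> x"
    and x: "x \<in> M" "\<And>v. norm (x v) \<le> norm v"
  shows "cmod (sandwich J D a \<phi> x) \<le> val \<psi> + val \<rho>"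
proof (rule tendsto_le)
  have \<phi>: "\<phi> \<in> Dherm J M D a" using d by (auto simp: Dherm_def)
  show "((\<lambda>l. cmod (\<phi> (s l \<circ> x \<circ> s l))) \<longlongrightarrow> cmod (sandwich J D a \<phi> x)) at_top"
    by (intro tendsto_norm sandwich_tendsto \<phi> x)
  show "((\<lambda>l. Re (\<psi> (A l)) + Re (\<rho> (A l))) \<longlongrightarrow> val \<psi> + val \<rho>) at_top"
    by (intro tendsto_add Dpos_val(1) d)
  show "\<forall>\<^sub>F l in at_top. cmod (\<phi> (s l \<circ> x \<circ> s l)) \<le> Re (\<psi> (A l)) + Re (\<rho> (A l))"
    using eventually_gt_at_top[of 0]
  proof eventually_elim
    fix l :: real assume l: "0 < l"
    have "cmod (\<phi> (s l \<circ> x \<circ> s l)) \<le> cmod (\<psi> (s l \<circ> x \<circ> s l)) + cmod (\<rho> (s l \<circ> x \<circ> s l))"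
      using d(3)[OF sandwich_in[OF x(1) l]] norm_triangle_ineq4 by metis
    also have "\<dots> \<le> Re (\<psi> (A l)) + Re (\<rho> (A l))"
      using normal_pos_cmod_sandwich[OF Dpos_normal[OF d(1)] s_in[OF l] s_psd[OF l] x]
        normal_pos_cmod_sandwich[OF Dpos_normal[OF d(2)] s_in[OF l] s_psd[OF l] x]
      by (simp add: comp_def s_s_fun[OF l])
    finally show "cmod (\<phi> (s l \<circ> x \<circ> s l)) \<le> Re (\<psi> (A l)) + Re (\<rho> (A l))" .
  qed
qed simp

lemma onorm_le_1D: "x \<in> M \<Longrightarrow> onorm x \<le> 1 \<Longrightarrow> norm (x v) \<le> norm v"
  using onorm[OF M_linear, of x v] mult_right_mono[of "onorm x" 1 "norm v"] by simp

lemma pred_norm_sandwich_le: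
  assumes d: "\<psi> \<in> Dpos J M D a" "\<rho> \<in> Dpos J M D a" "\<And>x. x \<in> M \<Longrightarrow> \<phi> x = \<psi> x - \<rho> x"
  shows "pred_norm M (sandwich J D a \<phi>) \<le> val \<psi> + val \<rho>"
  unfolding pred_norm_def
proof (rule cSup_least)
  have "(\<lambda>v. 0) \<in> M" using M_scale[OF M_id, of 0] by simp
  then have "cmod (sandwich J D a \<phi> (\<lambda>v. 0)) \<in> {cmod (sandwich J D a \<phi> x) |x. x \<in> M \<and> onorm x \<le> 1}"
    using onorm_zero[where 'a = 'h and 'b = 'h] by force
  then show "{cmod (sandwich J D a \<phi> x) |x. x \<in> M \<and> onorm x \<le> 1} \<noteq> {}" by blast
qed (use cmod_sandwich_le[OF d] onorm_le_1D in auto)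

lemma Re_sandwich_le_pred_norm:
  assumes \<phi>: "\<phi> \<in> Dherm J M D a" and x: "x \<in> M" "\<And>v. norm (x v) \<le> norm v"
  shows "Re (sandwich J D a \<phi> x) \<le> pred_norm M (sandwich J D a \<phi>)"
proof -
  obtain \<psi> \<rho> where d: "\<psi> \<in> Dpos J M D a" "\<rho> \<in> Dpos J M D a" "\<And>x. x \<in> M \<Longrightarrow> \<phi> x = \<psi> x - \<rho> x"
    using \<phi> by (auto simp: Dherm_def)
  have "onorm x \<le> 1" by (rule onorm_bound) (use x in auto)
  then have "cmod (sandwich J D a \<phi> x) \<le> pred_norm M (sandwich J D a \<phi>)"
    \<comment> \<open>Any decomposition of \<phi> bounds the set below \<open>Sup\<close>, which
      makes \<open>Sup\<close> an actual supremum.\<close>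
    unfolding pred_norm_def
    by (intro cSup_upper bdd_aboveI[of _ "val \<psi> + val \<rho>"]) (use x cmod_sandwich_le[OF d] onorm_le_1D in auto)
  then show ?thesis using complex_Re_le_cmod order_trans by blast
qed

end

section \<open>Decompositions of hermitian functionals\<close>

context affiliated_operator
begin

lemma cinner_psd:
  assumes "y \<in> M" "psd y" shows "cinner J (y u) u = of_real (inner (y u) u)"
proof -
  have "inner (y u) (J u) = inner u (J (y u))" using psdD(2)[OF assms(2)] M_commute_J[OF assms(1)] by metis
  moreover have "inner (J (y u)) u = - inner (y u) (J u)" by (rule cstructD(4)[OF cs])
  ultimately have "inner (y u) (J u) = 0" by (simp add: inner_commute)
  then show ?thesis by (simp add: cinner_def complex_eq_iff)
qed

text \<open>Normal functionals whose two representing sequences coincide; they are visibly positive,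
  and polarization reduces all positive normal functionals to them.\<close>

definition vecs_fun :: "(nat \<Rightarrow> 'h) \<Rightarrow> ('h \<Rightarrow> 'h) \<Rightarrow> complex" where
  "vecs_fun \<zeta> y = (\<Sum>n. cinner J (y (\<zeta> n)) (\<zeta> n))"

definition vec_fun :: "'h \<Rightarrow> ('h \<Rightarrow> 'h) \<Rightarrow> complex" where
  "vec_fun u y = cinner J (y u) u"

lemma vecs_fun_psd:
  assumes \<zeta>: "summable (\<lambda>n. (norm (\<zeta> n))\<^sup>2)" and y: "y \<in> M" "psd y"
  shows "vecs_fun \<zeta> y = of_real (\<Sum>n. inner (y (\<zeta> n)) (\<zeta> n))" "summable (\<lambda>n. inner (y (\<zeta> n)) (\<zeta> n))"
proof -
  note sm = summable_cinner[OF cs M_linear[OF y(1)] \<zeta> \<zeta>]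
  show sm': "summable (\<lambda>n. inner (y (\<zeta> n)) (\<zeta> n))"
    using summable_Re[OF sm] by (simp add: Re_cinner)
  show "vecs_fun \<zeta> y = of_real (\<Sum>n. inner (y (\<zeta> n)) (\<zeta> n))"
    unfolding vecs_fun_def cinner_psd[OF y] by (rule suminf_of_real[OF sm', symmetric])
qed

lemma vecs_fun_normal_pos:
  assumes \<zeta>: "summable (\<lambda>n. (norm (\<zeta> n))\<^sup>2)"
  shows "normal_pos J M (vecs_fun \<zeta>)"
proof -
  have "normal_fun J M (vecs_fun \<zeta>)" unfolding normal_fun_def vecs_fun_def
    by (intro exI[of _ \<zeta>]) (simp add: \<zeta>)
  moreover have "Im (vecs_fun \<zeta> y) = 0 \<and> 0 \<le> Re (vecs_fun \<zeta> y)" if "y \<in> M" "psd y" for y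
    using vecs_fun_psd[OF \<zeta> that] psdD(3)[OF that(2)] by (simp add: suminf_nonneg)
  ultimately show ?thesis by (simp add: normal_pos_def pos_op_iff_psd)
qed

lemma vec_fun_eq:
  assumes "y \<in> M" shows "vec_fun u y = vecs_fun (\<lambda>n. if n = 0 then u else 0) y"
proof -
  interpret y: bounded_linear y using M_linear[OF assms] .
  have eq: "(\<lambda>n. cinner J (y (if n = 0 then u else 0)) (if n = 0 then u else 0)) = (\<lambda>n. if n = 0 then vec_fun u y else 0)"
    by (auto simp: fun_eq_iff vec_fun_def y.zero cinner_def zero_complex.code)
  show ?thesis unfolding vecs_fun_def eq by (rule sums_unique[OF sums_single[of 0 "\<lambda>_. vec_fun u y"]])
qed

lemma vec_fun_normal_pos: "normal_pos J M (vec_fun u)"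
proof -
  have "summable (\<lambda>n. (norm (if n = 0 then u else 0 :: 'h))\<^sup>2)"
    by (rule summable_finite[of "{0}"]) auto
  from vecs_fun_normal_pos[OF this] show ?thesis
    by (simp add: normal_pos_def normal_fun_def vec_fun_eq)
qed

lemma zero_Dpos: "(\<lambda>x. 0) \<in> Dpos J M D a" "val (\<lambda>x. 0) = 0"
proof -
  have "normal_pos J M (\<lambda>x. 0)" using normal_pos_scale[OF vec_fun_normal_pos, of 0] by simp
  moreover have "fval D a (\<lambda>x. 0) = ereal 0" "val (\<lambda>x. 0) = 0" by (rule fval_tendsto, simp)+
  ultimately show "(\<lambda>x. 0) \<in> Dpos J M D a" "val (\<lambda>x. 0) = 0" by (simp_all add: Dpos_def)
qed

section \<open>The real vector space of hermitian functionals of finite value and its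
  seminorm\<close>

lemma DhermI:
  "\<psi> \<in> Dpos J M D a \<Longrightarrow> \<rho> \<in> Dpos J M D a \<Longrightarrow> (\<And>x. x \<in> M \<Longrightarrow> v x = \<psi> x - \<rho> x) \<Longrightarrow> v \<in> Dherm J M D a"
  by (auto simp: Dherm_def)

lemma Dpos_Dherm: "\<psi> \<in> Dpos J M D a \<Longrightarrow> \<psi> \<in> Dherm J M D a"
  by (rule DhermI[OF _ zero_Dpos(1)]) auto

lemma Dherm_cong: "v \<in> Dherm J M D a \<Longrightarrow> (\<And>x. x \<in> M \<Longrightarrow> w x = v x) \<Longrightarrow> w \<in> Dherm J M D a"
  by (auto simp: Dherm_def)

lemma Dherm_add:
  assumes "v \<in> Dherm J M D a" "w \<in> Dherm J M D a" shows "(\<lambda>x. v x + w x) \<in> Dherm J M D a"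
proof -
  obtain \<psi> \<rho> where 1: "\<psi> \<in> Dpos J M D a" "\<rho> \<in> Dpos J M D a" "\<And>x. x \<in> M \<Longrightarrow> v x = \<psi> x - \<rho> x"
    using assms(1) by (auto simp: Dherm_def)
  obtain \<psi>' \<rho>' where 2: "\<psi>' \<in> Dpos J M D a" "\<rho>' \<in> Dpos J M D a" "\<And>x. x \<in> M \<Longrightarrow> w x = \<psi>' x - \<rho>' x"
    using assms(2) by (auto simp: Dherm_def)
  show ?thesis
    by (rule DhermI[OF Dpos_add(1)[OF 1(1) 2(1)] Dpos_add(1)[OF 1(2) 2(2)]]) (simp add: 1(3) 2(3))
qed

lemma Dherm_scale:
  assumes "v \<in> Dherm J M D a" shows "(\<lambda>x. of_real c * v x) \<in> Dherm J M D a"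
proof -
  obtain \<psi> \<rho> where 1: "\<psi> \<in> Dpos J M D a" "\<rho> \<in> Dpos J M D a" "\<And>x. x \<in> M \<Longrightarrow> v x = \<psi> x - \<rho> x"
    using assms(1) by (auto simp: Dherm_def)
  show ?thesis
  proof (cases "0 \<le> c")
    case True
    show ?thesis
      by (rule DhermI[OF Dpos_scale(1)[OF 1(1) True] Dpos_scale(1)[OF 1(2) True]]) (simp add: 1(3) right_diff_distrib)
  next
    case False
    then have mc: "0 \<le> - c" by simp
    show ?thesis
      by (rule DhermI[OF Dpos_scale(1)[OF 1(2) mc] Dpos_scale(1)[OF 1(1) mc]]) (simp add: 1(3) right_diff_distrib)
  qed
qed

lemma Dherm_comb:
  assumes "v \<in> Dherm J M D a" "w \<in> Dherm J M D a" "\<And>x. x \<in> M \<Longrightarrow> u x = of_real c * v x + of_real d * w x"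
  shows "u \<in> Dherm J M D a"
  by (rule Dherm_cong[OF Dherm_add[OF Dherm_scale[OF assms(1), of c] Dherm_scale[OF assms(2), of d]]]) (rule assms(3))

definition decomps :: "(('h \<Rightarrow> 'h) \<Rightarrow> complex) \<Rightarrow> ((('h \<Rightarrow> 'h) \<Rightarrow> complex) \<times> (('h \<Rightarrow> 'h) \<Rightarrow> complex)) set" where
  "decomps v = {(\<psi>, \<rho>). \<psi> \<in> Dpos J M D a \<and> \<rho> \<in> Dpos J M D a \<and> (\<forall>x\<in>M. v x = \<psi> x - \<rho> x)}"

text \<open>The seminorm p. For functionals in \<open>Dherm\<close> the infimum is over a nonempty
  set bounded below by 0, so the real \<open>INF\<close> is the intended one.\<close>

definition decomp_norm :: "(('h \<Rightarrow> 'h) \<Rightarrow> complex) \<Rightarrow> real" where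
  "decomp_norm v = (INF p\<in>decomps v. val (fst p) + val (snd p))"

lemma decomp_norm_bdd: "bdd_below ((\<lambda>p. val (fst p) + val (snd p)) ` decomps v)"
  using Dpos_val(4) by (intro bdd_belowI[of _ 0]) (fastforce simp: decomps_def)

lemma decomp_norm_le:
  assumes "\<psi> \<in> Dpos J M D a" "\<rho> \<in> Dpos J M D a" "\<And>x. x \<in> M \<Longrightarrow> v x = \<psi> x - \<rho> x"
  shows "decomp_norm v \<le> val \<psi> + val \<rho>"
  unfolding decomp_norm_def using cINF_lower[OF decomp_norm_bdd, of "(\<psi>, \<rho>)" v] assms by (simp add: decomps_def)

lemma decomp_norm_ge:
  assumes "v \<in> Dherm J M D a"
    and "\<And>\<psi> \<rho>. \<psi> \<in> Dpos J M D a \<Longrightarrow> \<rho> \<in> Dpos J M D a \<Longrightarrow> (\<And>x. x \<in> M \<Longrightarrow> v x = \<psi> x - \<rho> x) \<Longrightarrow> r \<le> val \<psi> + val \<rho>"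
  shows "r \<le> decomp_norm v"
proof -
  have "decomps v \<noteq> {}" using assms(1) by (auto simp: decomps_def Dherm_def)
  then show ?thesis unfolding decomp_norm_def
    by (rule cINF_greatest) (auto simp: decomps_def intro: assms(2))
qed

lemma Dherm_subspace: "subspace (Dherm J M D a)"
  using Dherm_add Dherm_scale Dpos_Dherm[OF zero_Dpos(1)]
  by (simp add: subspace_def plus_fun_def zero_fun_def scaleR_fun_def scaleR_conv_of_real)

lemma decomp_norm_sublinear: "sublinear_on (Dherm J M D a) decomp_norm"
  unfolding sublinear_on_def plus_fun_def scaleR_fun_def scaleR_conv_of_real
proof (intro conjI ballI allI impI)
  fix v w assume v: "v \<in> Dherm J M D a" and w: "w \<in> Dherm J M D a"
  let ?s = "decomp_norm (\<lambda>x. v x + w x)"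
  have le: "?s \<le> (val \<psi> + val \<rho>) + (val \<psi>' + val \<rho>')"
    if 1: "\<psi> \<in> Dpos J M D a" "\<rho> \<in> Dpos J M D a" "\<And>x. x \<in> M \<Longrightarrow> v x = \<psi> x - \<rho> x"
      and 2: "\<psi>' \<in> Dpos J M D a" "\<rho>' \<in> Dpos J M D a" "\<And>x. x \<in> M \<Longrightarrow> w x = \<psi>' x - \<rho>' x" for \<psi> \<rho> \<psi>' \<rho>'
    using decomp_norm_le[OF Dpos_add(1)[OF 1(1) 2(1)] Dpos_add(1)[OF 1(2) 2(2)], of "\<lambda>x. v x + w x"] 1(3) 2(3)
    by (simp add: Dpos_add(2) 1 2)
  have "?s - (val \<psi> + val \<rho>) \<le> decomp_norm w"
    if 1: "\<psi> \<in> Dpos J M D a" "\<rho> \<in> Dpos J M D a" "\<And>x. x \<in> M \<Longrightarrow> v x = \<psi> x - \<rho> x" for \<psi> \<rho>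
    by (rule decomp_norm_ge[OF w]) (use le[OF 1] in force)
  then have "?s - decomp_norm w \<le> decomp_norm v"
    by (intro decomp_norm_ge[OF v]) force
  then show "?s \<le> decomp_norm v + decomp_norm w" by simp
next
  fix v and c :: real assume v: "v \<in> Dherm J M D a" and c: "0 < c"
  have "decomp_norm (\<lambda>x. of_real c * v x) / c \<le> decomp_norm v"
  proof (rule decomp_norm_ge[OF v])
    fix \<psi> \<rho> assume 1: "\<psi> \<in> Dpos J M D a" "\<rho> \<in> Dpos J M D a" "\<And>x. x \<in> M \<Longrightarrow> v x = \<psi> x - \<rho> x"
    have "decomp_norm (\<lambda>x. of_real c * v x) \<le> c * val \<psi> + c * val \<rho>"
      using decomp_norm_le[OF Dpos_scale(1)[OF 1(1), of c] Dpos_scale(1)[OF 1(2), of c], of "\<lambda>x. of_real c * v x"] c 1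
      by (simp add: Dpos_scale(2) algebra_simps)
    then show "decomp_norm (\<lambda>x. of_real c * v x) / c \<le> val \<psi> + val \<rho>" using c by (simp add: field_simps)
  qed
  then show "decomp_norm (\<lambda>x. of_real c * v x) \<le> c * decomp_norm v" using c by (simp add: field_simps)
qed

text \<open>Elements of \<open>Dherm\<close> are functions on all operators, while only their values
  on M count. Hence linearity of F is stated for relations that hold on M.\<close>

lemma dominated_functional_exists:
  assumes \<phi>: "\<phi> \<in> Dherm J M D a"
  obtains F where
    "\<And>u v w c d. v \<in> Dherm J M D a \<Longrightarrow> w \<in> Dherm J M D a \<Longrightarrow>
      (\<And>x. x \<in> M \<Longrightarrow> u x = of_real c * v x + of_real d * w x) \<Longrightarrow> F u = c * F v + d * F w"
    "\<And>\<psi>. \<psi> \<in> Dpos J M D a \<Longrightarrow> \<bar>F \<psi>\<bar> \<le> val \<psi>"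
    "F \<phi> = decomp_norm \<phi>"
proof -
  let ?W = "Dherm J M D a"
  obtain F where F: "\<And>v w. v \<in> ?W \<Longrightarrow> w \<in> ?W \<Longrightarrow> F (v + w) = F v + F w"
    "\<And>v c. v \<in> ?W \<Longrightarrow> F (c *\<^sub>R v) = c * F v"
    "\<And>v. v \<in> ?W \<Longrightarrow> F v \<le> decomp_norm v" "F \<phi> = decomp_norm \<phi>"
    by (rule hahn_banach_dominated[OF Dherm_subspace decomp_norm_sublinear \<phi>]) blast
  have neg: "F (- v) = - F v" if "v \<in> ?W" for v using F(2)[OF that, of "-1"] by simp
  have negW: "- v \<in> ?W" if "v \<in> ?W" for v using subspace_neg[OF Dherm_subspace that] .
  \<comment> \<open>If v vanishes on M, then 0 - 0 decomposes both v and - v, so the seminorm and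
    with it F vanish there.\<close>
  have zero: "F v = 0" if v: "v \<in> ?W" "\<And>x. x \<in> M \<Longrightarrow> v x = 0" for v
  proof -
    have "decomp_norm v \<le> 0" using decomp_norm_le[OF zero_Dpos(1) zero_Dpos(1), of v] v zero_Dpos(2) by simp
    moreover have "decomp_norm (- v) \<le> 0"
      using decomp_norm_le[OF zero_Dpos(1) zero_Dpos(1), of "- v"] v zero_Dpos(2) by simp
    ultimately show ?thesis using F(3)[OF v(1)] F(3)[OF negW[OF v(1)]] neg[OF v(1)] by simp
  qed
  have "F u = c * F v + d * F w" if v: "v \<in> ?W" and w: "w \<in> ?W"
    and u: "\<And>x. x \<in> M \<Longrightarrow> u x = of_real c * v x + of_real d * w x" for u v w c d
  proof -
    have uW: "u \<in> ?W" using Dherm_comb[OF v w u] .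
    have sW: "c *\<^sub>R v \<in> ?W" "d *\<^sub>R w \<in> ?W" using subspace_scale[OF Dherm_subspace] v w by blast+
    let ?z = "c *\<^sub>R v + d *\<^sub>R w"
    have zW: "?z \<in> ?W" using subspace_add[OF Dherm_subspace sW] .
    have "u + - ?z \<in> ?W" using subspace_add[OF Dherm_subspace uW negW[OF zW]] .
    then have "F (u + - ?z) = 0"
      by (rule zero) (simp add: u plus_fun_def fun_Compl_def scaleR_fun_def scaleR_conv_of_real)
    then have "F u = F ?z" using F(1)[OF uW negW[OF zW]] neg[OF zW] by simp
    then show ?thesis using F(1)[OF sW] F(2)[OF v] F(2)[OF w] by simp
  qed
  moreover have "\<bar>F \<psi>\<bar> \<le> val \<psi>" if \<psi>: "\<psi> \<in> Dpos J M D a" for \<psi>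
  proof -
    have "decomp_norm \<psi> \<le> val \<psi>" using decomp_norm_le[OF \<psi> zero_Dpos(1), of \<psi>] zero_Dpos(2) by simp
    moreover have "decomp_norm (- \<psi>) \<le> val \<psi>" using decomp_norm_le[OF zero_Dpos(1) \<psi>, of "- \<psi>"] zero_Dpos(2) by simp
    ultimately show ?thesis
      using F(3)[OF Dpos_Dherm[OF \<psi>]] F(3)[OF negW[OF Dpos_Dherm[OF \<psi>]]] neg[OF Dpos_Dherm[OF \<psi>]] by simp
  qed
  ultimately show ?thesis using that F(4) by blast
qed

section \<open>Vectors of finite value, and polarization\<close>

lemma R_contraction: "0 < l \<Longrightarrow> norm (l *\<^sub>R R l u) \<le> norm u"
  using shift_lower[OF R_eq(1), of l l u] R_eq(2)[of l u] by simp

lemma C_contraction: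
  assumes "0 < l" shows "norm (C l u) \<le> norm u"
  by (rule psd_contraction[OF C_psd[OF assms]])
    (use psdD(3)[OF R_psd[OF assms]] assms in \<open>simp add: C_def inner_diff_left\<close>)

text \<open>All operators commute, so the left-hand side is <\<open>A l\<close> \<open>R e\<close>
  z, \<open>A m\<close> \<open>R e\<close> z>. Each factor is a contraction, because
  \<open>A l\<close> \<open>R e\<close> = l \<open>R l\<close> \<open>C e\<close>: the resolvent
  \<open>R e\<close> absorbs a full power of a, uniformly in all parameters.\<close>

lemma A_Rs_bound:
  assumes e: "0 < e" and m: "0 < m" and l: "0 < l"
  shows "inner (A l (R e (s m z))) (R e (s m z)) \<le> (norm z)\<^sup>2"
proof -
  have AR: "A k (R e u) = k *\<^sub>R R k (C e u)" if "0 < k" for k u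
    using that by (simp add: A_C C_R_swap[OF that e])
  have sC: "C e (s m u) = s m (C e u)" for u
    using s_commute_R[OF m M_linear[OF C_in[OF e]]] R_C[OF m e] by metis
  have sm: "bounded_linear (s m)" using M_linear[OF s_in[OF m]] .
  have "A l (R e (s m z)) = s m (l *\<^sub>R R l (C e z))"
    by (simp only: AR[OF l] sC s_R[OF l m] linear_scale[OF bounded_linear.linear[OF sm]])
  then have "inner (A l (R e (s m z))) (R e (s m z)) = inner (s m (l *\<^sub>R R l (C e z))) (s m (R e z))"
    by (simp only: s_R[OF e m])
  also have "\<dots> = inner (l *\<^sub>R R l (C e z)) (A m (R e z))"
    by (simp only: psdD(2)[OF s_psd[OF m]] s_sq[OF m])
  also have "\<dots> \<le> norm (l *\<^sub>R R l (C e z)) * norm (A m (R e z))" by (rule norm_cauchy_schwarz)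
  also have "\<dots> \<le> norm z * norm z"
  proof (rule mult_mono)
    show "norm (l *\<^sub>R R l (C e z)) \<le> norm z" using R_contraction[OF l] C_contraction[OF e] order_trans by blast
    show "norm (A m (R e z)) \<le> norm z" unfolding AR[OF m]
      using R_contraction[OF m] C_contraction[OF e] order_trans by blast
  qed simp_all
  finally show ?thesis by (simp add: power2_eq_square)
qed

lemma normal_pos_adjoint:
  assumes p: "normal_pos J M \<psi>" and z: "z \<in> M" "z' \<in> M" "\<And>u v. inner (z' u) v = inner u (z v)"
  shows "\<psi> z' = cnj (\<psi> z)"
proof -
  note nf = normal_fun_linear[OF normal_pos_fun[OF p]]
  have 1: "Re (\<psi> z') = Re (\<psi> z)"
    using normal_pos_adjoint_sym[OF p z M_id M_id] by simp
  have Jz: "(\<lambda>v. J (z v)) \<in> M" "(\<lambda>v. (-1) *\<^sub>R J (z' v)) \<in> M" by (intro M_scale M_comp[OF M_J] z)+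
  have "inner ((-1) *\<^sub>R J (z' u)) v = inner u (J (z v))" for u v
    by (simp add: cstructD(4)[OF cs] z M_commute_J)
  from normal_pos_adjoint_sym[OF p Jz this M_id M_id]
  have "Re (\<psi> (\<lambda>v. (-1) *\<^sub>R J (z' v))) = Re (\<psi> (\<lambda>v. J (z v)))" by simp
  then have "Im (\<psi> z') = - Im (\<psi> z)"
    using nf(2)[OF M_comp[OF M_J z(2)] z(1), of "-1"] nf(3)[OF z(1) z(1)] nf(3)[OF z(2) z(2)] by simp
  with 1 show ?thesis by (simp add: complex_eq_iff)
qed

lemma summable_norm_add_diff:
  fixes \<xi> \<eta> :: "nat \<Rightarrow> 'h"
  assumes s: "summable (\<lambda>n. (norm (\<xi> n))\<^sup>2)" "summable (\<lambda>n. (norm (\<eta> n))\<^sup>2)"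
  shows "summable (\<lambda>n. (norm (\<xi> n + \<eta> n))\<^sup>2)" "summable (\<lambda>n. (norm (\<xi> n - \<eta> n))\<^sup>2)"
proof -
  have sm: "summable (\<lambda>n. 2 * (norm (\<xi> n))\<^sup>2 + 2 * (norm (\<eta> n))\<^sup>2)"
    by (intro summable_add summable_mult s)
  have par: "(norm (u + v))\<^sup>2 + (norm (u - v))\<^sup>2 = 2 * (norm u)\<^sup>2 + 2 * (norm v)\<^sup>2" for u v :: 'h
    by (simp add: power2_norm_eq_inner inner_add_left inner_add_right inner_diff_left inner_diff_right inner_commute)
  have le: "norm ((norm (u + v))\<^sup>2) \<le> 2 * (norm u)\<^sup>2 + 2 * (norm v)\<^sup>2"
    "norm ((norm (u - v))\<^sup>2) \<le> 2 * (norm u)\<^sup>2 + 2 * (norm v)\<^sup>2" for u v :: 'h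
    unfolding par[symmetric] by simp_all
  show "summable (\<lambda>n. (norm (\<xi> n + \<eta> n))\<^sup>2)" "summable (\<lambda>n. (norm (\<xi> n - \<eta> n))\<^sup>2)"
    by (rule summable_comparison_test[OF _ sm]; use le in blast)+
qed

text \<open>A positive functional is hermitian, so exchanging \<xi> and \<eta> leaves \<psi>
  unchanged. Averaging both representations cancels the imaginary terms of the polarization
  identity; real coefficients remain, to which the real linear F can be applied.\<close>

lemma normal_pos_polarization:
  assumes p: "normal_pos J M \<psi>"
    and s: "summable (\<lambda>n. (norm (\<xi> n))\<^sup>2)" "summable (\<lambda>n. (norm (\<eta> n))\<^sup>2)"
    and \<psi>: "\<And>x. x \<in> M \<Longrightarrow> \<psi> x = (\<Sum>n. cinner J (x (\<xi> n)) (\<eta> n))"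
    and y: "y \<in> M"
  shows "\<psi> y = of_real (1/4) * vecs_fun (\<lambda>n. \<xi> n + \<eta> n) y + of_real (- 1/4) * vecs_fun (\<lambda>n. \<xi> n - \<eta> n) y"
proof -
  define y' where "y' = adjoint y"
  have y': "y' \<in> M" "\<And>u v. inner (y' u) v = inner u (y v)"
    using M_adjoint[OF y] adjoint_bounded_inner(2)[OF M_linear[OF y]] by (auto simp: y'_def)
  interpret y: bounded_linear y using M_linear[OF y] .
  have adj: "cnj (cinner J (y' u) v) = cinner J (y v) u" for u v
  proof -
    have "cnj (cinner J (y' u) v) = cinner J v (y' u)" by (rule cinner_commute[symmetric])
    also have "\<dots> = cinner J (y v) u"
    proof -
      have "inner v (y' u) = inner (y v) u" for u v using y'(2)[of u v] by (simp add: inner_commute)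
      then show ?thesis by (simp add: cinner_def M_commute_J[OF y'(1), symmetric])
    qed
    finally show ?thesis .
  qed
  note sm1 = summable_cinner[OF cs M_linear[OF y] s] and sm2 = summable_cinner[OF cs M_linear[OF y] s(2,1)]
  have "\<psi> y = cnj (\<psi> y')" using normal_pos_adjoint[OF p y y'] by simp
  also have "\<dots> = (\<Sum>n. cinner J (y (\<eta> n)) (\<xi> n))"
  proof -
    have "(\<lambda>n. cinner J (y' (\<xi> n)) (\<eta> n)) sums \<psi> y'"
      using summable_sums[OF summable_cinner[OF cs M_linear[OF y'(1)] s]] \<psi>[OF y'(1)] by simp
    then have "(\<lambda>n. cinner J (y (\<eta> n)) (\<xi> n)) sums cnj (\<psi> y')"
      using iffD2[OF sums_cnj] by (fastforce simp: adj)
    then show ?thesis by (rule sums_unique)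
  qed
  finally have sym: "\<psi> y = (\<Sum>n. cinner J (y (\<eta> n)) (\<xi> n))" .
  let ?p = "\<lambda>n. cinner J (y (\<xi> n + \<eta> n)) (\<xi> n + \<eta> n)" and ?m = "\<lambda>n. cinner J (y (\<xi> n - \<eta> n)) (\<xi> n - \<eta> n)"
  note sp = summable_norm_add_diff[OF s]
  note sp' = summable_cinner[OF cs M_linear[OF y] sp(1) sp(1)] summable_cinner[OF cs M_linear[OF y] sp(2) sp(2)]
  have pol: "?p n - ?m n = 2 * (cinner J (y (\<xi> n)) (\<eta> n) + cinner J (y (\<eta> n)) (\<xi> n))" for n
    by (simp add: cinner_def y.add y.diff J.add J.diff inner_add_left inner_add_right inner_diff_left inner_diff_right complex_eq_iff)
  have "vecs_fun (\<lambda>n. \<xi> n + \<eta> n) y - vecs_fun (\<lambda>n. \<xi> n - \<eta> n) y = (\<Sum>n. ?p n - ?m n)"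
    unfolding vecs_fun_def by (rule suminf_diff[OF sp'])
  also have "\<dots> = 2 * (\<psi> y + \<psi> y)"
    unfolding pol using suminf_mult[OF summable_add[OF sm1 sm2], of 2] suminf_add[OF sm1 sm2] \<psi>[OF y] sym by simp
  finally have "4 * \<psi> y = vecs_fun (\<lambda>n. \<xi> n + \<eta> n) y - vecs_fun (\<lambda>n. \<xi> n - \<eta> n) y" by simp
  then show ?thesis by (simp add: field_simps)
qed

end

section \<open>Representation of dominated functionals\<close>

text \<open>Isolates what is retained from Hahn-Banach: real linear relations on M are respected,
  and F is dominated by the value.\<close>

locale dominated_functional = affiliated_operator +
  fixes F :: "(('a \<Rightarrow> 'a) \<Rightarrow> complex) \<Rightarrow> real"
  assumes F_comb: "v \<in> Dherm J M D a \<Longrightarrow> w \<in> Dherm J M D a \<Longrightarrow>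
      (\<And>x. x \<in> M \<Longrightarrow> u x = of_real c * v x + of_real d * w x) \<Longrightarrow> F u = c * F v + d * F w"
    and F_bound: "\<psi> \<in> Dpos J M D a \<Longrightarrow> \<bar>F \<psi>\<bar> \<le> val \<psi>"
begin

lemma F_cong:
  assumes "v \<in> Dherm J M D a" "\<And>x. x \<in> M \<Longrightarrow> u x = v x" shows "F u = F v"
  using F_comb[OF assms(1) assms(1), of u 1 0] assms(2) by simp

section \<open>The contraction in M that represents a dominated functional\<close>

context
  fixes e m :: real
  assumes e: "0 < e" and m: "0 < m"
begin

definition g :: "'a \<Rightarrow> 'a" where "g z = R e (s m z)"

lemma g_in: "g \<in> M"
  unfolding g_def using M_comp[OF R_in_M[OF e] s_in[OF m]] .

interpretation g: bounded_linear g using M_linear[OF g_in] .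

lemma vec_fun_g: "vec_fun (g z) \<in> Dpos J M D a" "val (vec_fun (g z)) \<le> (norm z)\<^sup>2"
proof -
  have "Re (vec_fun (g z) (A l)) \<le> (norm z)\<^sup>2" if "0 < l" for l
    using A_Rs_bound[OF e m that, of z] by (simp add: vec_fun_def Re_cinner g_def)
  from normal_pos_bounded_tendsto(3,5)[OF vec_fun_normal_pos this]
  show "vec_fun (g z) \<in> Dpos J M D a" "val (vec_fun (g z)) \<le> (norm z)\<^sup>2" by auto
qed

text \<open>The hermitian part of the functional that sends y to <y u, w>, which by itself need not
  be a real combination of positive functionals.\<close>

definition herm_fun :: "'a \<Rightarrow> 'a \<Rightarrow> ('a \<Rightarrow> 'a) \<Rightarrow> complex" where
  "herm_fun u w y = of_real (1/2) * (cinner J (y u) w + cinner J (y w) u)"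

lemma herm_fun_polar:
  assumes "y \<in> M"
  shows "herm_fun u w y = of_real (1/4) * vec_fun (u + w) y + of_real (- 1/4) * vec_fun (u - w) y"
proof -
  interpret y: bounded_linear y using M_linear[OF assms] .
  show ?thesis
    by (simp add: herm_fun_def vec_fun_def cinner_def y.add y.diff J.add J.diff inner_add_left inner_add_right
        inner_diff_left inner_diff_right complex_eq_iff field_simps)
qed

definition form :: "'a \<Rightarrow> 'a \<Rightarrow> real" where "form z w = F (herm_fun (g z) (g w))"

lemma vec_fun_g_Dherm: "vec_fun (g z) \<in> Dherm J M D a"
  using Dpos_Dherm vec_fun_g(1) by blast

lemma herm_fun_g_polar:
  "y \<in> M \<Longrightarrow> herm_fun (g z) (g w) y = of_real (1/4) * vec_fun (g (z + w)) y + of_real (- 1/4) * vec_fun (g (z - w)) y"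
  using herm_fun_polar[of y "g z" "g w"] by (simp add: g.add g.diff)

lemma herm_fun_Dherm: "herm_fun (g z) (g w) \<in> Dherm J M D a"
  by (rule Dherm_comb[OF vec_fun_g_Dherm vec_fun_g_Dherm herm_fun_g_polar])

lemma form_polar: "form z w = 1/4 * F (vec_fun (g (z + w))) + (- 1/4) * F (vec_fun (g (z - w)))"
  unfolding form_def by (rule F_comb[OF vec_fun_g_Dherm vec_fun_g_Dherm herm_fun_g_polar])

lemma form_sym: "form z w = form w z"
  unfolding form_def herm_fun_def by (simp add: add.commute)

lemma form_diag: "form z z = F (vec_fun (g z))"
  unfolding form_def by (rule F_cong[OF vec_fun_g_Dherm]) (simp add: herm_fun_def vec_fun_def)

lemma form_comb: "form (c *\<^sub>R z + d *\<^sub>R z') w = c * form z w + d * form z' w"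
  unfolding form_def
proof (rule F_comb[OF herm_fun_Dherm herm_fun_Dherm])
  fix y assume y: "y \<in> M"
  interpret y: bounded_linear y using M_linear[OF y] .
  show "herm_fun (g (c *\<^sub>R z + d *\<^sub>R z')) (g w) y = of_real c * herm_fun (g z) (g w) y + of_real d * herm_fun (g z') (g w) y"
    by (simp add: herm_fun_def cinner_def g.add g.scaleR y.add y.scaleR J.add J.scaleR inner_add_left inner_add_right
        complex_eq_iff algebra_simps add_divide_distrib)
qed

lemma form_add: "form (z + z') w = form z w + form z' w"
  using form_comb[of 1 z 1 z' w] by simp

lemma form_scale: "form (c *\<^sub>R z) w = c * form z w"
  using form_comb[of c z 0 z w] by simp

text \<open>Polarization, domination by the value and the parallelogram law give the bound (|z|^2 +
  |w|^2) / 2; normalising both vectors turns it into the product of the norms.\<close>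

lemma form_bound: "\<bar>form z w\<bar> \<le> norm z * norm w"
proof (cases "z = 0 \<or> w = 0")
  case True
  then show ?thesis using form_scale[of 0 z w] form_scale[of 0 w z] form_sym[of z w] by auto
next
  case False
  have half: "\<bar>form z w\<bar> \<le> ((norm z)\<^sup>2 + (norm w)\<^sup>2) / 2" for z w
  proof -
    have "\<bar>form z w\<bar> \<le> 1/4 * (norm (z + w))\<^sup>2 + 1/4 * (norm (z - w))\<^sup>2"
      unfolding form_polar
      using order_trans[OF F_bound[OF vec_fun_g(1)] vec_fun_g(2), of "z + w"]
        order_trans[OF F_bound[OF vec_fun_g(1)] vec_fun_g(2), of "z - w"] by linarith
    also have "\<dots> = ((norm z)\<^sup>2 + (norm w)\<^sup>2) / 2"
      by (simp add: power2_norm_eq_inner inner_add_left inner_add_right inner_diff_left inner_diff_right inner_commute field_simps)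
    finally show ?thesis .
  qed
  have "\<bar>form ((1 / norm z) *\<^sub>R z) ((1 / norm w) *\<^sub>R w)\<bar> \<le> 1"
    using half[of "(1 / norm z) *\<^sub>R z" "(1 / norm w) *\<^sub>R w"] False by simp
  also have "form ((1 / norm z) *\<^sub>R z) ((1 / norm w) *\<^sub>R w) = form z w / (norm z * norm w)"
    by (simp only: form_scale form_sym[of z "(1 / norm w) *\<^sub>R w"]) (simp add: form_sym[of w z])
  finally show ?thesis using False by (simp add: field_simps abs_mult)
qed

lemma form_bilinear: "bounded_bilinear form"
proof
  show "form (z + z') w = form z w + form z' w" for z z' w by (rule form_add)
  show "form z (w + w') = form z w + form z w'" for z w w'
    using form_add[of w w' z] by (simp add: form_sym)
  show "form (c *\<^sub>R z) w = c *\<^sub>R form z w" for c z w by (simp add: form_scale)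
  show "form z (c *\<^sub>R w) = c *\<^sub>R form z w" for c z w
    using form_scale[of c w z] by (simp add: form_sym)
  show "\<exists>k. \<forall>z w. norm (form z w) \<le> norm z * norm w * k" using form_bound by (intro exI[of _ 1]) simp
qed

text \<open>Riesz gives x, a contraction by \<open>form_bound\<close>. The membership criterion
  works with a real linear x, so only commutation with the unitaries of the commutant remains;
  complex linearity comes with membership in M.\<close>

lemma form_operator:
  obtains x where "x \<in> M" "\<And>v. norm (x v) \<le> norm v" "\<And>z w. inner (x z) w = form z w"
proof -
  obtain x where x: "bounded_linear x" "\<And>z w. inner (x z) w = form z w"
    by (rule bounded_bilinear_operator[OF form_bilinear]) blast
  have "norm (x v) \<le> norm v" for v
  proof (cases "x v = 0")
    case False
    have "norm (x v) * norm (x v) \<le> norm v * norm (x v)"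
      using form_bound[of v "x v"] x(2)[of v "x v"] by (simp add: power2_eq_square flip: power2_norm_eq_inner)
    then show ?thesis using False by simp
  qed simp
  moreover have "x \<in> M"
  proof (rule vNa_mem_if_commutes_unitaries[OF vN x(1)])
    fix U z assume U: "U \<in> commutant J M" "unitary_op J U"
    have linU: "bounded_linear U" and UJ: "\<And>v. U (J v) = J (U v)" using U by (auto simp: commutant_iff bop_def)
    have Uy: "U (y v) = y (U v)" if "y \<in> M" for y v using U(1) that by (auto simp: commutant_iff)
    have UU: "adjoint U (U v) = v" "U (adjoint U v) = v" for v
      using U(2) by (auto simp: unitary_op_def fun_eq_iff)
    have iso: "inner (U v) (U w) = inner v w" for v w
      using adjoint_bounded_inner(1)[OF linU, of v "U w"] UU by simp
    have ciso: "cinner J (U v) (U w) = cinner J v w" for v w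
      using iso[of v "J w"] by (simp add: cinner_def iso UJ)
    \<comment> \<open>U commutes with \<open>g\<close> and with every y in M, hence <y g U v, U g w>
      = <U y g v, U g w> = <y g v, g w>.\<close>
    have inv: "form (U v) (U w) = form v w" for v w
      unfolding form_def
    proof (rule F_cong[OF herm_fun_Dherm])
      fix y assume y: "y \<in> M"
      show "herm_fun (g (U v)) (g (U w)) y = herm_fun (g v) (g w) y"
        by (simp add: herm_fun_def Uy[OF g_in, symmetric] Uy[OF y, symmetric] ciso)
    qed
    have "inner (x (U z)) w = inner (U (x z)) w" for w
    proof -
      have "inner (x (U z)) (U (adjoint U w)) = inner (U (x z)) (U (adjoint U w))"
        by (simp only: x(2) inv iso)
      then show ?thesis by (simp only: UU)
    qed
    then show "x (U z) = U (x z)" using vector_eq_rdot by blast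
  qed
  ultimately show ?thesis using that x(2) by blast
qed

lemma vecs_fun_g:
  assumes u: "summable (\<lambda>i. (norm (u i))\<^sup>2)"
  shows "vecs_fun (\<lambda>i. g (u i)) \<in> Dpos J M D a" "val (vecs_fun (\<lambda>i. g (u i))) \<le> (\<Sum>i. (norm (u i))\<^sup>2)"
proof -
  have gu: "summable (\<lambda>i. (norm (g (u i)))\<^sup>2)" by (rule summable_norm_image[OF g.bounded_linear_axioms u])
  have "Re (vecs_fun (\<lambda>i. g (u i)) (A l)) \<le> (\<Sum>i. (norm (u i))\<^sup>2)" if l: "0 < l" for l
    using vecs_fun_psd[OF gu A_in[OF l] A_psd[OF l]] A_Rs_bound[OF e m l]
    by (auto intro!: suminf_le u simp: g_def)
  from normal_pos_bounded_tendsto(3,5)[OF vecs_fun_normal_pos[OF gu] this]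
  show "vecs_fun (\<lambda>i. g (u i)) \<in> Dpos J M D a" "val (vecs_fun (\<lambda>i. g (u i))) \<le> (\<Sum>i. (norm (u i))\<^sup>2)" by auto
qed

lemma F_vecs_fun_split:
  assumes u: "summable (\<lambda>i. (norm (u i))\<^sup>2)"
  shows "F (vecs_fun (\<lambda>i. g (u i))) = (\<Sum>i<N. form (u i) (u i)) + F (vecs_fun (\<lambda>i. g (u (i + N))))"
proof (induction N)
  case (Suc N)
  have su: "summable (\<lambda>i. (norm (u (i + N)))\<^sup>2)" "summable (\<lambda>i. (norm (u (i + Suc N)))\<^sup>2)"
    by (rule summable_ignore_initial_segment[OF u])+
  have "F (vecs_fun (\<lambda>i. g (u (i + N)))) = 1 * F (vec_fun (g (u N))) + 1 * F (vecs_fun (\<lambda>i. g (u (i + Suc N))))"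
  proof (rule F_comb[OF vec_fun_g_Dherm Dpos_Dherm[OF vecs_fun_g(1)[OF su(2)]]])
    fix y assume y: "y \<in> M"
    have "summable (\<lambda>i. (norm (g (u (i + N))))\<^sup>2)" by (rule summable_norm_image[OF g.bounded_linear_axioms su(1)])
    from suminf_split_head[OF summable_cinner[OF cs M_linear[OF y] this this]]
    show "vecs_fun (\<lambda>i. g (u (i + N))) y = of_real 1 * vec_fun (g (u N)) y + of_real 1 * vecs_fun (\<lambda>i. g (u (i + Suc N))) y"
      by (simp add: vecs_fun_def vec_fun_def)
  qed
  then show ?case using Suc by (simp add: form_diag)
qed simp

text \<open>F is only finitely additive. Countable additivity along this series comes from
  domination: F of a tail is at most its value, which is at most the tail of the sum of
  |u_i|^2.\<close>

lemma F_vecs_fun_sums: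
  assumes u: "summable (\<lambda>i. (norm (u i))\<^sup>2)"
  shows "(\<lambda>i. form (u i) (u i)) sums F (vecs_fun (\<lambda>i. g (u i)))"
proof -
  have "(\<lambda>N. F (vecs_fun (\<lambda>i. g (u (i + N))))) \<longlonglongrightarrow> 0"
  proof (rule Lim_null_comparison)
    show "\<forall>\<^sub>F N in sequentially. norm (F (vecs_fun (\<lambda>i. g (u (i + N))))) \<le> (\<Sum>i. (norm (u (i + N)))\<^sup>2)"
    proof (rule always_eventually, rule allI)
      fix N
      have su: "summable (\<lambda>i. (norm (u (i + N)))\<^sup>2)" by (rule summable_ignore_initial_segment[OF u])
      show "norm (F (vecs_fun (\<lambda>i. g (u (i + N))))) \<le> (\<Sum>i. (norm (u (i + N)))\<^sup>2)"
        using F_bound[OF vecs_fun_g(1)[OF su]] vecs_fun_g(2)[OF su] by simp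
    qed
    have "(\<lambda>N. (\<Sum>i. (norm (u i))\<^sup>2) - (\<Sum>i<N. (norm (u i))\<^sup>2)) \<longlonglongrightarrow> (\<Sum>i. (norm (u i))\<^sup>2) - (\<Sum>i. (norm (u i))\<^sup>2)"
      by (intro tendsto_intros summable_LIMSEQ u)
    then show "(\<lambda>N. \<Sum>i. (norm (u (i + N)))\<^sup>2) \<longlonglongrightarrow> 0"
      by (simp add: suminf_minus_initial_segment[OF u])
  qed
  then have "(\<lambda>N. F (vecs_fun (\<lambda>i. g (u i))) - F (vecs_fun (\<lambda>i. g (u (i + N))))) \<longlonglongrightarrow> F (vecs_fun (\<lambda>i. g (u i))) - 0"
    by (intro tendsto_intros)
  moreover have "F (vecs_fun (\<lambda>i. g (u i))) - F (vecs_fun (\<lambda>i. g (u (i + N)))) = (\<Sum>i<N. form (u i) (u i))" for N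
    using F_vecs_fun_split[OF u, of N] by simp
  ultimately show ?thesis unfolding sums_def by simp
qed

text \<open>K = \<open>g\<close> \<open>s n\<close>, so the conjugated functional is represented by
  the vectors g s_n \<xi>_i and g s_n \<eta>_i. Polarization makes it a difference of diagonal
  functionals, on which F sums the form; undoing the polarization by the symmetry of the form leaves
  the sum of <x s_n \<xi>_i, s_n \<eta>_i>.\<close>

lemma F_conj_K:
  assumes mn: "m \<le> n" and p: "normal_pos J M \<psi>"
    and x: "\<And>z w. inner (x z) w = form z w" and xM: "x \<in> M"
  shows "(\<lambda>y. \<psi> (\<lambda>v. K e m n (y (K e m n v)))) \<in> Dherm J M D a"
    "F (\<lambda>y. \<psi> (\<lambda>v. K e m n (y (K e m n v)))) = Re (\<psi> (\<lambda>v. s n (x (s n v))))"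
proof -
  have n: "0 < n" using m mn by simp
  define k where "k = K e m n"
  interpret sn: bounded_linear "s n" using M_linear[OF s_in[OF n]] .
  interpret x: bounded_linear x using M_linear[OF xM] .
  have kin: "k \<in> M" unfolding k_def by (rule K_in[OF e m n])
  have kg: "k v = g (s n v)" for v by (simp add: k_def K_def g_def)
  have ksym: "inner (k u) v = inner u (k v)" for u v
    unfolding k_def using psdD(2)[OF K_psd[OF e m mn]] .
  obtain \<xi> \<eta> where 1: "summable (\<lambda>n. (norm (\<xi> n))\<^sup>2)" "summable (\<lambda>n. (norm (\<eta> n))\<^sup>2)"
    "\<And>x. x \<in> M \<Longrightarrow> \<psi> x = (\<Sum>n. cinner J (x (\<xi> n)) (\<eta> n))"
    using normal_pos_fun[OF p] by (auto simp: normal_fun_def)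
  let ?u = "\<lambda>i. s n (\<xi> i) + s n (\<eta> i)" and ?w = "\<lambda>i. s n (\<xi> i) - s n (\<eta> i)"
  have ss: "summable (\<lambda>i. (norm (s n (\<xi> i)))\<^sup>2)" "summable (\<lambda>i. (norm (s n (\<eta> i)))\<^sup>2)"
    using summable_norm_image[OF sn.bounded_linear_axioms] 1(1,2) by blast+
  note uw = summable_norm_add_diff[OF ss]
  have sk: "summable (\<lambda>i. (norm (k (\<xi> i)))\<^sup>2)" "summable (\<lambda>i. (norm (k (\<eta> i)))\<^sup>2)"
    using summable_norm_image[OF M_linear[OF kin]] 1(1,2) by blast+
  have \<psi>k: "\<psi> (\<lambda>v. k (y (k v))) = of_real (1/4) * vecs_fun (\<lambda>i. g (?u i)) y + of_real (- 1/4) * vecs_fun (\<lambda>i. g (?w i)) y"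
    if y: "y \<in> M" for y
  proof -
    have "\<psi> (\<lambda>v. k (z (k v))) = (\<Sum>i. cinner J (z (k (\<xi> i))) (k (\<eta> i)))" if z: "z \<in> M" for z
      using 1(3)[OF M_comp[OF kin M_comp[OF z kin]]] by (simp add: cinner_def ksym M_commute_J[OF kin])
    from normal_pos_polarization[OF normal_pos_conj[OF p kin ksym] sk this y]
    show ?thesis by (simp add: kg g.add g.diff)
  qed
  note W = Dpos_Dherm[OF vecs_fun_g(1)[OF uw(1)]] Dpos_Dherm[OF vecs_fun_g(1)[OF uw(2)]]
  show "(\<lambda>y. \<psi> (\<lambda>v. K e m n (y (K e m n v)))) \<in> Dherm J M D a"
    using Dherm_comb[OF W, of "\<lambda>y. \<psi> (\<lambda>v. k (y (k v)))" "1/4" "- 1/4"] \<psi>k by (simp add: k_def)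
  have F1: "F (\<lambda>y. \<psi> (\<lambda>v. k (y (k v)))) = 1/4 * F (vecs_fun (\<lambda>i. g (?u i))) + (- 1/4) * F (vecs_fun (\<lambda>i. g (?w i)))"
    by (rule F_comb[OF W \<psi>k])
  have xsym: "inner (x z) w = inner (x w) z" for z w by (simp add: x form_sym)
  have "(\<lambda>i. 1/4 * form (?u i) (?u i) + (- 1/4) * form (?w i) (?w i)) sums F (\<lambda>y. \<psi> (\<lambda>v. k (y (k v))))"
    unfolding F1 by (intro sums_add sums_mult F_vecs_fun_sums uw)
  moreover have "1/4 * form (?u i) (?u i) + (- 1/4) * form (?w i) (?w i) = inner (x (s n (\<xi> i))) (s n (\<eta> i))" for i
    using xsym[of "s n (\<eta> i)" "s n (\<xi> i)"]
    by (simp add: x[symmetric] x.add x.diff inner_add_left inner_add_right inner_diff_left inner_diff_right field_simps)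
  ultimately have "(\<lambda>i. inner (x (s n (\<xi> i))) (s n (\<eta> i))) sums F (\<lambda>y. \<psi> (\<lambda>v. k (y (k v))))" by simp
  moreover have "(\<lambda>i. inner (x (s n (\<xi> i))) (s n (\<eta> i))) sums Re (\<psi> (\<lambda>v. s n (x (s n v))))"
  proof -
    have sxs: "(\<lambda>v. s n (x (s n v))) \<in> M" by (rule M_comp[OF s_in[OF n] M_comp[OF xM s_in[OF n]]])
    have "(\<lambda>i. cinner J (s n (x (s n (\<xi> i)))) (\<eta> i)) sums \<psi> (\<lambda>v. s n (x (s n v)))"
      unfolding 1(3)[OF sxs] by (rule summable_sums[OF summable_cinner[OF cs M_linear[OF sxs] 1(1,2)]])
    then have "(\<lambda>i. Re (cinner J (s n (x (s n (\<xi> i)))) (\<eta> i))) sums Re (\<psi> (\<lambda>v. s n (x (s n v))))"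
      by (rule sums_Re)
    then show ?thesis by (simp add: Re_cinner psdD(2)[OF s_psd[OF n]])
  qed
  ultimately show "F (\<lambda>y. \<psi> (\<lambda>v. K e m n (y (K e m n v)))) = Re (\<psi> (\<lambda>v. s n (x (s n v))))"
    unfolding k_def by (rule sums_unique2)
qed

end

text \<open>This is \<psi> applied to the operator inequality \<open>cutoff_error_psd\<close>. The
  bound tends to 0 as m grows and e tends to 0, and it does not involve n.\<close>

lemma conj_cutoff_bound:
  assumes e: "0 < e" and m: "0 < m" and mn: "m \<le> n" and \<psi>: "\<psi> \<in> Dpos J M D a"
  defines "c \<equiv> \<lambda>v. v - K e m n v"
  defines "\<rho> \<equiv> \<lambda>y. \<psi> (\<lambda>v. c (y (c v)))"
  shows "\<rho> \<in> Dpos J M D a" "val \<rho> \<le> 2 * (val \<psi> - Re (\<psi> (A m))) + e * Re (\<psi> (\<lambda>v. v))"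
proof -
  have n: "0 < n" using m mn by simp
  note p = Dpos_normal[OF \<psi>]
  note nf = normal_fun_linear[OF normal_pos_fun[OF p]]
  have cin: "c \<in> M" unfolding c_def by (rule M_diff[OF M_id K_in[OF e m n]])
  have cpsd: "psd c" unfolding c_def by (rule id_minus_K_psd[OF e m mn])
  have pr: "normal_pos J M \<rho>" unfolding \<rho>_def by (rule normal_pos_conj[OF p cin psdD(2)[OF cpsd]])
  have "Re (\<rho> (A l)) \<le> 2 * (val \<psi> - Re (\<psi> (A m))) + e * Re (\<psi> (\<lambda>v. v))" if l: "0 < l" for l
  proof -
    \<comment> \<open>k \<ge> 2 m gives k / (k - m) \<le> 2, the source of the factor 2; k \<ge> l
      carries the bound back to l by monotonicity.\<close>
    define k where "k = max l (2 * m)"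
    have k: "0 < k" "m < k" "l \<le> k" "2 * m \<le> k" using l m by (auto simp: k_def)
    have cAc: "(\<lambda>v. c (A k (c v))) \<in> M" by (rule M_comp[OF cin M_comp[OF A_in[OF k(1)] cin]])
    have inM: "(\<lambda>v. A k v - A m v) \<in> M" using M_diff[OF A_in[OF k(1)] A_in[OF m]] .
    have inM2: "(\<lambda>v. (k / (k - m)) *\<^sub>R (A k v - A m v)) \<in> M" "(\<lambda>v. e *\<^sub>R v) \<in> M"
      using M_scale[OF inM] M_scale[OF M_id] by auto
    have "psd (\<lambda>v. (k / (k - m)) *\<^sub>R (A k v - A m v) + e *\<^sub>R v - c (A k (c v)))"
      unfolding c_def by (rule cutoff_error_psd[OF e m mn k(2)])
    from normal_pos_mono[OF p cAc M_add[OF inM2] this]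
    have "Re (\<psi> (\<lambda>v. c (A k (c v)))) \<le> Re (\<psi> (\<lambda>v. (k / (k - m)) *\<^sub>R (A k v - A m v) + e *\<^sub>R v))" .
    also have "\<dots> = k / (k - m) * (Re (\<psi> (A k)) - Re (\<psi> (A m))) + e * Re (\<psi> (\<lambda>v. v))"
      using nf(1)[OF inM2] nf(2)[OF inM inM, of "k / (k - m)"] nf(2)[OF M_id M_id, of e] nf(4)[OF A_in[OF k(1)] A_in[OF m]]
      by (simp del: of_real_divide)
    also have "k / (k - m) * (Re (\<psi> (A k)) - Re (\<psi> (A m))) \<le> 2 * (val \<psi> - Re (\<psi> (A m)))"
    proof (rule mult_mono)
      show "k / (k - m) \<le> 2" using k m by (simp add: field_simps)
      show "0 \<le> Re (\<psi> (A k)) - Re (\<psi> (A m))" using normal_pos_A_mono[OF p m] k by simp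
      show "Re (\<psi> (A k)) - Re (\<psi> (A m)) \<le> val \<psi> - Re (\<psi> (A m))" using Dpos_val(3)[OF \<psi> k(1)] by simp
    qed simp
    finally have "Re (\<rho> (A k)) \<le> 2 * (val \<psi> - Re (\<psi> (A m))) + e * Re (\<psi> (\<lambda>v. v))" by (simp add: \<rho>_def)
    then show ?thesis using normal_pos_A_mono[OF pr l k(3)] by linarith
  qed
  from normal_pos_bounded_tendsto(3,5)[OF pr this]
  show "\<rho> \<in> Dpos J M D a" "val \<rho> \<le> 2 * (val \<psi> - Re (\<psi> (A m))) + e * Re (\<psi> (\<lambda>v. v))" by auto
qed

text \<open>With c = 1 - K, the functionals psi conjugated by 1 + tc and 1 - tc are positive, their difference is
  2t(c psi + psi c), and their sum is 2 psi + 2 t^2 c psi c.\<close>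

lemma F_cutoff_error:
  assumes e: "0 < e" and m: "0 < m" and mn: "m \<le> n" and \<psi>: "\<psi> \<in> Dpos J M D a" and t: "0 < t"
    and KW: "(\<lambda>y. \<psi> (\<lambda>v. K e m n (y (K e m n v)))) \<in> Dherm J M D a"
  shows "\<bar>F \<psi> - F (\<lambda>y. \<psi> (\<lambda>v. K e m n (y (K e m n v))))\<bar>
    \<le> 2 / t * val \<psi> + (2 * t + 1) * (2 * (val \<psi> - Re (\<psi> (A m))) + e * Re (\<psi> (\<lambda>v. v)))"
proof -
  have n: "0 < n" using m mn by simp
  define E where "E = 2 * (val \<psi> - Re (\<psi> (A m))) + e * Re (\<psi> (\<lambda>v. v))"
  define k where "k = K e m n"
  define c where "c = (\<lambda>v. v - k v)"
  define \<rho> where "\<rho> = (\<lambda>y. \<psi> (\<lambda>v. c (y (c v))))"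
  have \<rho>: "\<rho> \<in> Dpos J M D a" "val \<rho> \<le> E"
    using conj_cutoff_bound[OF e m mn \<psi>] by (simp_all add: \<rho>_def c_def k_def E_def)
  note p = Dpos_normal[OF \<psi>]
  note nf = normal_fun_linear[OF normal_pos_fun[OF p]]
  have kin: "k \<in> M" unfolding k_def by (rule K_in[OF e m n])
  have cin: "c \<in> M" unfolding c_def by (rule M_diff[OF M_id kin])
  have csym: "inner (c u) v = inner u (c v)" for u v
    unfolding c_def k_def using psdD(2)[OF id_minus_K_psd[OF e m mn]] .
  interpret c: bounded_linear c using M_linear[OF cin] .
  define h where "h r = (\<lambda>v. v + r *\<^sub>R c v)" for r
  define \<theta> where "\<theta> r = (\<lambda>y. \<psi> (\<lambda>v. h r (y (h r v))))" for r
  have hin: "h r \<in> M" for r unfolding h_def by (rule M_add[OF M_id M_scale[OF cin]])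
  have hsym: "inner (h r u) v = inner u (h r v)" for r u v
    by (simp add: h_def inner_add_left inner_add_right csym)
  have \<theta>p: "normal_pos J M (\<theta> r)" for r unfolding \<theta>_def by (rule normal_pos_conj[OF p hin hsym])
  have \<theta>eq: "\<theta> r y = (\<psi> y + of_real (r\<^sup>2) * \<rho> y) + of_real r * (\<psi> (\<lambda>v. c (y v)) + \<psi> (\<lambda>v. y (c v)))" if y: "y \<in> M" for r y
  proof -
    interpret y: bounded_linear y using M_linear[OF y] .
    have i: "(\<lambda>v. c (y (c v))) \<in> M" "(\<lambda>v. c (y v)) \<in> M" "(\<lambda>v. y (c v)) \<in> M"
      by (rule M_comp[OF cin M_comp[OF y cin]], rule M_comp[OF cin y], rule M_comp[OF y cin])
    have "(\<lambda>v. h r (y (h r v))) = (\<lambda>v. (y v + r\<^sup>2 *\<^sub>R c (y (c v))) + r *\<^sub>R (c (y v) + y (c v)))"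
      by (simp add: h_def y.add y.scaleR c.add c.scaleR power2_eq_square algebra_simps)
    then show ?thesis unfolding \<theta>_def \<rho>_def
      by (simp only: nf(1)[OF M_add[OF y M_scale[OF i(1)]] M_scale[OF M_add[OF i(2,3)]]]
          nf(1)[OF y M_scale[OF i(1)]] nf(1)[OF i(2,3)] nf(2)[OF i(1) i(1)]
          nf(2)[OF M_add[OF i(2,3)] M_add[OF i(2,3)]])
  qed
  have \<theta>le: "\<theta> r \<in> Dpos J M D a" "val (\<theta> r) \<le> 2 * val \<psi> + 2 * r\<^sup>2 * E" for r
  proof -
    have "Re (\<theta> r (A l)) \<le> 2 * val \<psi> + 2 * r\<^sup>2 * E" if l: "0 < l" for l
    proof -
      have "0 \<le> Re (\<theta> (- r) (A l))" by (rule normal_posD(1)[OF \<theta>p A_in[OF l] A_psd[OF l]])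
      \<comment> \<open>Positivity of the companion with - r means that each of the two is at most
        their sum, in which the mixed terms cancel.\<close>
      moreover have "Re (\<theta> r (A l)) + Re (\<theta> (- r) (A l)) = 2 * Re (\<psi> (A l)) + 2 * r\<^sup>2 * Re (\<rho> (A l))"
        by (simp add: \<theta>eq[OF A_in[OF l]] del: of_real_power)
      moreover have "Re (\<rho> (A l)) \<le> E" using Dpos_val(3)[OF \<rho>(1) l] \<rho>(2) by simp
      then have "2 * r\<^sup>2 * Re (\<rho> (A l)) \<le> 2 * r\<^sup>2 * E" by (intro mult_left_mono) auto
      moreover have "Re (\<psi> (A l)) \<le> val \<psi>" using Dpos_val(3)[OF \<psi> l] .
      ultimately show ?thesis by linarith
    qed
    from normal_pos_bounded_tendsto(3,5)[OF \<theta>p this]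
    show "\<theta> r \<in> Dpos J M D a" "val (\<theta> r) \<le> 2 * val \<psi> + 2 * r\<^sup>2 * E" by auto
  qed
  define \<delta> where "\<delta> = (\<lambda>y. of_real (1 / (2 * t)) * \<theta> t y + of_real (- (1 / (2 * t))) * \<theta> (- t) y)"
  have \<delta>W: "\<delta> \<in> Dherm J M D a" unfolding \<delta>_def
    by (rule Dherm_comb[OF Dpos_Dherm[OF \<theta>le(1)] Dpos_Dherm[OF \<theta>le(1)] refl])
  have \<delta>eq: "\<delta> y = \<psi> (\<lambda>v. c (y v)) + \<psi> (\<lambda>v. y (c v))" if "y \<in> M" for y
    using t unfolding \<delta>_def \<theta>eq[OF that] by (simp add: field_simps)
  have F\<delta>: "F \<delta> = 1 / (2 * t) * F (\<theta> t) + (- (1 / (2 * t))) * F (\<theta> (- t))"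
    by (rule F_comb[OF Dpos_Dherm[OF \<theta>le(1)] Dpos_Dherm[OF \<theta>le(1)]]) (simp add: \<delta>_def)
  \<comment> \<open>Since k = 1 - c, the functional \<psi> - k \<psi> k equals (c \<psi> + \<psi> c)
    - c \<psi> c; F is evaluated on both sides.\<close>
  have "F (\<lambda>y. \<delta> y + - \<rho> y) = 1 * F \<delta> + (- 1) * F \<rho>"
    by (rule F_comb[OF \<delta>W Dpos_Dherm[OF \<rho>(1)]]) simp
  moreover have "F (\<lambda>y. \<delta> y + - \<rho> y) = 1 * F \<psi> + (- 1) * F (\<lambda>y. \<psi> (\<lambda>v. k (y (k v))))"
  proof (rule F_comb[OF Dpos_Dherm[OF \<psi>]])
    show "(\<lambda>y. \<psi> (\<lambda>v. k (y (k v)))) \<in> Dherm J M D a" unfolding k_def by (rule KW)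
    fix y assume y: "y \<in> M"
    interpret y: bounded_linear y using M_linear[OF y] .
    interpret k: bounded_linear k using M_linear[OF kin] .
    have i: "(\<lambda>v. c (y (c v))) \<in> M" "(\<lambda>v. c (y v)) \<in> M" "(\<lambda>v. y (c v)) \<in> M"
      by (rule M_comp[OF cin M_comp[OF y cin]], rule M_comp[OF cin y], rule M_comp[OF y cin])
    have "(\<lambda>v. k (y (k v))) = (\<lambda>v. (y v + c (y (c v))) - (c (y v) + y (c v)))"
      by (simp add: c_def y.diff k.diff)
    then have "\<psi> (\<lambda>v. k (y (k v))) = \<psi> y + \<rho> y - \<delta> y"
      using nf(4)[OF M_add[OF y i(1)] M_add[OF i(2,3)]] nf(1)[OF y i(1)] nf(1)[OF i(2,3)] \<delta>eq[OF y] by (simp add: \<rho>_def)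
    then show "\<delta> y + - \<rho> y = of_real 1 * \<psi> y + of_real (- 1) * \<psi> (\<lambda>v. k (y (k v)))" by simp
  qed
  ultimately have eq: "F \<psi> - F (\<lambda>y. \<psi> (\<lambda>v. k (y (k v)))) = 1 / (2 * t) * (F (\<theta> t) - F (\<theta> (- t))) - F \<rho>"
    by (simp add: F\<delta> algebra_simps)
  have b1: "\<bar>F (\<theta> t)\<bar> \<le> 2 * val \<psi> + 2 * t\<^sup>2 * E" using F_bound[OF \<theta>le(1), of t] \<theta>le(2)[of t] by simp
  have b2: "\<bar>F (\<theta> (- t))\<bar> \<le> 2 * val \<psi> + 2 * t\<^sup>2 * E" using F_bound[OF \<theta>le(1), of "- t"] \<theta>le(2)[of "- t"] by simp
  have b3: "\<bar>F \<rho>\<bar> \<le> E" using F_bound[OF \<rho>(1)] \<rho>(2) by simp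
  have "\<bar>1 / (2 * t) * (F (\<theta> t) - F (\<theta> (- t)))\<bar> \<le> 1 / (2 * t) * (2 * (2 * val \<psi> + 2 * t\<^sup>2 * E))"
    unfolding abs_mult using t b1 b2 by (intro mult_mono) auto
  also have "\<dots> = 2 / t * val \<psi> + 2 * t * E" using t by (simp add: field_simps power2_eq_square)
  finally have "\<bar>F \<psi> - F (\<lambda>y. \<psi> (\<lambda>v. k (y (k v))))\<bar> \<le> 2 / t * val \<psi> + 2 * t * E + E"
    unfolding eq using b3 by linarith
  then show ?thesis by (simp add: k_def E_def algebra_simps)
qed

text \<open>The choices are ordered: t controls the term 2 / t, then m and e have to beat the factor
  2 t + 1. They determine x, and only then does n tend to infinity.\<close>

lemma F_le_pred_norm:
  assumes \<phi>: "\<phi> \<in> Dherm J M D a"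
  shows "F \<phi> \<le> pred_norm M (sandwich J D a \<phi>)"
proof (rule field_le_epsilon)
  fix \<epsilon> :: real assume "0 < \<epsilon>"
  \<comment> \<open>\<psi> and \<rho> each contribute an error of at most 2 d.\<close>
  define d where "d = \<epsilon> / 4"
  have d: "0 < d" using \<open>0 < \<epsilon>\<close> by (simp add: d_def)
  obtain \<psi> \<rho> where dec: "\<psi> \<in> Dpos J M D a" "\<rho> \<in> Dpos J M D a" "\<And>x. x \<in> M \<Longrightarrow> \<phi> x = \<psi> x - \<rho> x"
    using \<phi> by (auto simp: Dherm_def)
  note p = Dpos_normal[OF dec(1)] Dpos_normal[OF dec(2)]
  \<comment> \<open>Chosen so that 2 / t = d / (val \<psi> + val \<rho> + 1), which makes both terms
    with 2 / t at most d.\<close>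
  define t where "t = 2 * (val \<psi> + val \<rho> + 1) / d"
  have v0: "0 \<le> val \<psi>" "0 \<le> val \<rho>" using Dpos_val(4) dec by auto
  have t: "0 < t" unfolding t_def using d v0 by simp
  have t1: "2 / t * val \<psi> \<le> d" "2 / t * val \<rho> \<le> d"
    unfolding t_def using d v0 by (simp_all add: field_simps)
  define d' where "d' = d / (2 * t + 1)"
  have d': "0 < d'" unfolding d'_def using d t by simp
  have "\<forall>\<^sub>F l in at_top. val \<psi> - d' / 4 < Re (\<psi> (A l)) \<and> val \<rho> - d' / 4 < Re (\<rho> (A l)) \<and> 0 < l"
    using order_tendstoD(1)[OF Dpos_val(1)[OF dec(1)], of "val \<psi> - d' / 4"]
      order_tendstoD(1)[OF Dpos_val(1)[OF dec(2)], of "val \<rho> - d' / 4"] d'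
    by (intro eventually_conj eventually_gt_at_top) auto
  \<comment> \<open>A gap below d' / 4 makes twice the gap at most d' / 2; the other half of d' is
    left for e.\<close>
  then obtain m where m: "0 < m" "val \<psi> - d' / 4 < Re (\<psi> (A m))" "val \<rho> - d' / 4 < Re (\<rho> (A m))"
    using eventually_happens'[OF trivial_limit_at_top_linorder] by blast
  \<comment> \<open>The summand 1 keeps the denominator of e positive when both functionals vanish
    at the identity.\<close>
  define N where "N = Re (\<psi> (\<lambda>v. v)) + Re (\<rho> (\<lambda>v. v)) + 1"
  have i0: "0 \<le> Re (\<psi> (\<lambda>v. v))" "0 \<le> Re (\<rho> (\<lambda>v. v))" using normal_posD(1)[OF _ M_id psd_id] p by auto
  then have N: "1 \<le> N" by (simp add: N_def)
  define e where "e = d' / (2 * N)"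
  have e: "0 < e" unfolding e_def using d' N by simp
  have e1: "e * Re (\<psi> (\<lambda>v. v)) \<le> d' / 2" "e * Re (\<rho> (\<lambda>v. v)) \<le> d' / 2"
  proof -
    have "e * Re (\<psi> (\<lambda>v. v)) \<le> e * N" "e * Re (\<rho> (\<lambda>v. v)) \<le> e * N"
      using i0 e by (auto intro!: mult_left_mono simp: N_def)
    moreover have "e * N = d' / 2" unfolding e_def using N by simp
    ultimately show "e * Re (\<psi> (\<lambda>v. v)) \<le> d' / 2" "e * Re (\<rho> (\<lambda>v. v)) \<le> d' / 2" by auto
  qed
  have small: "(2 * t + 1) * r \<le> d" if "r \<le> d'" for r
    using that t by (simp add: d'_def field_simps)
  obtain x where x: "x \<in> M" "\<And>v. norm (x v) \<le> norm v" "\<And>z w. inner (x z) w = form e m z w"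
    by (rule form_operator[OF e m(1)]) blast
  have le: "F \<phi> \<le> Re (\<phi> (s n \<circ> x \<circ> s n)) + \<epsilon>" if mn: "m \<le> n" for n
  proof -
    have n: "0 < n" using m(1) mn by simp
    note K1 = F_conj_K[OF e m(1) mn p(1) x(3,1)] and K2 = F_conj_K[OF e m(1) mn p(2) x(3,1)]
    have s1: "(2 * t + 1) * (2 * (val \<psi> - Re (\<psi> (A m))) + e * Re (\<psi> (\<lambda>v. v))) \<le> d"
    proof (rule small)
      have "2 * (val \<psi> - Re (\<psi> (A m))) \<le> d' / 2" using m(2) by simp
      with e1(1) show "2 * (val \<psi> - Re (\<psi> (A m))) + e * Re (\<psi> (\<lambda>v. v)) \<le> d'" by simp
    qed
    have s2: "(2 * t + 1) * (2 * (val \<rho> - Re (\<rho> (A m))) + e * Re (\<rho> (\<lambda>v. v))) \<le> d"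
    proof (rule small)
      have "2 * (val \<rho> - Re (\<rho> (A m))) \<le> d' / 2" using m(3) by simp
      with e1(2) show "2 * (val \<rho> - Re (\<rho> (A m))) + e * Re (\<rho> (\<lambda>v. v)) \<le> d'" by simp
    qed
    have "\<bar>F \<psi> - Re (\<psi> (\<lambda>v. s n (x (s n v))))\<bar> \<le> 2 * d"
      using F_cutoff_error[OF e m(1) mn dec(1) t K1(1)] s1 t1 unfolding K1(2) by linarith
    moreover have "\<bar>F \<rho> - Re (\<rho> (\<lambda>v. s n (x (s n v))))\<bar> \<le> 2 * d"
      using F_cutoff_error[OF e m(1) mn dec(2) t K2(1)] s2 t1 unfolding K2(2) by linarith
    moreover have "F \<phi> = 1 * F \<psi> + (- 1) * F \<rho>"
      by (rule F_comb[OF Dpos_Dherm[OF dec(1)] Dpos_Dherm[OF dec(2)]]) (simp add: dec(3))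
    moreover have "Re (\<phi> (s n \<circ> x \<circ> s n)) = Re (\<psi> (\<lambda>v. s n (x (s n v)))) - Re (\<rho> (\<lambda>v. s n (x (s n v))))"
      using dec(3)[OF sandwich_in[OF x(1) n]] by (simp add: comp_def)
    ultimately show ?thesis unfolding d_def by linarith
  qed
  have "F \<phi> \<le> Re (sandwich J D a \<phi> x) + \<epsilon>"
  proof (rule tendsto_lowerbound)
    show "((\<lambda>n. Re (\<phi> (s n \<circ> x \<circ> s n)) + \<epsilon>) \<longlongrightarrow> Re (sandwich J D a \<phi> x) + \<epsilon>) at_top"
      by (intro tendsto_intros sandwich_tendsto \<phi> x)
    show "\<forall>\<^sub>F n in at_top. F \<phi> \<le> Re (\<phi> (s n \<circ> x \<circ> s n)) + \<epsilon>"
      using eventually_ge_at_top[of m] by eventually_elim (rule le)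
  qed simp
  also have "\<dots> \<le> pred_norm M (sandwich J D a \<phi>) + \<epsilon>"
    using Re_sandwich_le_pred_norm[OF \<phi> x(1,2)] by simp
  finally show "F \<phi> \<le> pred_norm M (sandwich J D a \<phi>) + \<epsilon>" .
qed

end

theorem theorem8:
  fixes J :: "'h::{real_inner,complete_space} \<Rightarrow> 'h"
    and M :: "('h \<Rightarrow> 'h) set"
    and D :: "'h set" and a :: "'h \<Rightarrow> 'h"
    and \<phi> :: "('h \<Rightarrow> 'h) \<Rightarrow> complex"
  assumes "vNa J M"
    and "pos_selfadj J D a"
    and "affiliated J M D a"
    and "\<phi> \<in> Dherm J M D a"
  shows "(INF p \<in> {(\<psi>1, \<psi>2). \<psi>1 \<in> Dpos J M D a \<and> \<psi>2 \<in> Dpos J M D a \<and>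
                        (\<forall>x\<in>M. \<phi> x = \<psi>1 x - \<psi>2 x)}.
             fval D a (fst p) + fval D a (snd p))
         = ereal (pred_norm M (sandwich J D a \<phi>))"
proof -
  interpret affiliated_operator J M D a using assms by unfold_locales
  let ?n = "pred_norm M (sandwich J D a \<phi>)"
  obtain F where F: "\<And>u v w c d. v \<in> Dherm J M D a \<Longrightarrow> w \<in> Dherm J M D a \<Longrightarrow>
      (\<And>x. x \<in> M \<Longrightarrow> u x = of_real c * v x + of_real d * w x) \<Longrightarrow> F u = c * F v + d * F w"
    "\<And>\<psi>. \<psi> \<in> Dpos J M D a \<Longrightarrow> \<bar>F \<psi>\<bar> \<le> val \<psi>" "F \<phi> = decomp_norm \<phi>"
    by (rule dominated_functional_exists[OF assms(4)]) blast
  interpret dominated_functional J M D a F by unfold_locales (fact F(1), fact F(2))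
  have le: "decomp_norm \<phi> \<le> ?n" using F_le_pred_norm[OF assms(4)] F(3) by simp
  \<comment> \<open>On decompositions all values are finite, so the infimum in \<open>ereal\<close>
    can be compared with the real seminorm.\<close>
  have fv: "fval D a (fst p) + fval D a (snd p) = ereal (val (fst p) + val (snd p))" if "p \<in> decomps \<phi>" for p
    using that by (auto simp: decomps_def Dpos_val(2))
  have ne: "decomps \<phi> \<noteq> {}" using assms(4) by (auto simp: decomps_def Dherm_def)
  have "(INF p \<in> decomps \<phi>. fval D a (fst p) + fval D a (snd p)) = ereal ?n"
  proof (rule antisym)
    show "ereal ?n \<le> (INF p \<in> decomps \<phi>. fval D a (fst p) + fval D a (snd p))"
    proof (rule INF_greatest)
      fix p assume p: "p \<in> decomps \<phi>"
      show "ereal ?n \<le> fval D a (fst p) + fval D a (snd p)"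
        unfolding fv[OF p] using p pred_norm_sandwich_le[of "fst p" "snd p" \<phi>] by (auto simp: decomps_def)
    qed
    show "(INF p \<in> decomps \<phi>. fval D a (fst p) + fval D a (snd p)) \<le> ereal ?n"
    proof (rule ereal_le_epsilon2)
      fix \<epsilon> :: real assume "0 < \<epsilon>"
      then have "decomp_norm \<phi> < ?n + \<epsilon>" using le by simp
      then obtain p where p: "p \<in> decomps \<phi>" "val (fst p) + val (snd p) < ?n + \<epsilon>"
        unfolding decomp_norm_def using cInf_lessD[of "(\<lambda>p. val (fst p) + val (snd p)) ` decomps \<phi>"] ne by blast
      have "(INF p \<in> decomps \<phi>. fval D a (fst p) + fval D a (snd p)) \<le> fval D a (fst p) + fval D a (snd p)"
        by (rule INF_lower[OF p(1)])
      also have "\<dots> \<le> ereal ?n + ereal \<epsilon>" unfolding fv[OF p(1)] using p(2) by simp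
      finally show "(INF p \<in> decomps \<phi>. fval D a (fst p) + fval D a (snd p)) \<le> ereal ?n + ereal \<epsilon>" .
    qed
  qed
  then show ?thesis by (simp only: decomps_def)
qed

end
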